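(* Let $q\in\Bbbk$ be a root of unity of multiplicative order $d\ge 2$, and let $\mathcal{D}_q$ be the tensor category of finite dimensional right $\Bbbk\mathcal{A}(q)$-comodules with its objects $V(i,l)$, $i\in\mathbb{Z}$, $l\ge 0$. Let $e,m\ge 0$ and $0\le f,h\le d-1$ be integers with $ed+f\le md+h$, and set $\gamma=f+h-d+1$. Then the following isomorphisms hold in $\mathcal{D}_q$. (1) If $0\le f\le h$ and $f+h<d-1$, then $$\begin{aligned}V(0,ed+f)\otimes V(0,md+h)\cong{}&\bigoplus_{k=0}^{e-1}\Big[\bigoplus_{i=0}^{f}V(kd+i,(e+m-2k)d+f+h-2i)\oplus\bigoplus_{j=f+1}^{h}V(kd+j,(e+m-2k)d-1)\\&\oplus\bigoplus_{r=h+1}^{f+h+1}V(kd+r,(e+m-2k)d+h+f-2r)\oplus\bigoplus_{s=f+h+2}^{d-1}V(kd+s,(e+m-1-2k)d-1)\Big]\\&\oplus\bigoplus_{i=0}^{f}V(ed+i,(m-e)d+h+f-2i).\end{aligned}$$ (2) If $0<f\le h<d$ and $f+h\ge d$, then $$\begin{aligned}V(0,ed+f)\otimes V(0,md+h)\cong{}&\bigoplus_{k=0}^{e-1}\Big[\bigoplus_{i=0}^{\gamma}V(kd+i,(e+m-2k)d+d-1)\oplus\bigoplus_{j=\gamma+1}^{f}V(kd+j,(e+m-2k)d+f+h-2j)\\&\oplus\bigoplus_{r=f+1}^{h}V(kd+r,(e+m-2k)d-1)\oplus\bigoplus_{s=h+1}^{d-1}V(kd+s,(e+m-2k)d+h+f-2s)\Big]\\&\oplus\bigoplus_{i=0}^{\gamma}V(ed+i,(m-e)d+d-1)\oplus\bigoplus_{i=\gamma+1}^{f}V(ed+i,(m-e)d+f+h-2i).\end{aligned}$$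 (3) If $0\le h<f<d$ and $f+h<d-1$, then $$\begin{aligned}V(0,ed+f)\otimes V(0,md+h)\cong{}&\bigoplus_{k=0}^{e-1}\Big[\bigoplus_{i=0}^{h}V(kd+i,(e+m-2k)d+h+f-2i)\oplus\bigoplus_{j=h+1}^{f}V(kd+j,(e+m-2k)d-1)\\&\oplus\bigoplus_{r=f+1}^{h+f+1}V(kd+r,(e+m-2k)d+h+f-2r)\oplus\bigoplus_{s=f+h+2}^{d-1}V(kd+s,(e+m-1-2k)d-1)\Big]\\&\oplus\bigoplus_{i=0}^{h}V(ed+i,(m-e)d+h+f-2i)\oplus\bigoplus_{i=h+1}^{f}V(ed+i,(m-e)d-1).\end{aligned}$$ (4) If $0<h<f<d$ and $f+h\ge d$, then $$\begin{aligned}V(0,ed+f)\otimes V(0,md+h)\cong{}&\bigoplus_{k=0}^{e-1}\Big[\bigoplus_{i=0}^{\gamma}V(kd+i,(e+m-2k)d+d-1)\oplus\bigoplus_{j=\gamma+1}^{h}V(kd+j,(e+m-2k)d+f+h-2j)\\&\oplus\bigoplus_{r=h+1}^{f}V(kd+r,(e+m-2k)d-1)\oplus\bigoplus_{s=f+1}^{d-1}V(kd+s,(e+m-2k)d+h+f-2s)\Big]\\&\oplus\bigoplus_{i=0}^{\gamma}V(ed+i,(m-e)d+d-1)\oplus\bigoplus_{i=\gamma+1}^{h}V(ed+i,(m-e)d+f+h-2i)\\&\oplus\bigoplus_{i=h+1}^{f}V(ed+i,(m-e)d-1).\end{aligned}$$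
   Context: $\Bbbk$ is an algebraically closed field of characteristic $0$. For $q\in\Bbbk$ and integers $l,m\ge 0$ put $l_q=1+q+\cdots+q^{l-1}$, $l!_q=1_q\cdots l_q$, and let $\binom{l+m}{l}_q=\frac{(l+m)!_q}{l!_q\,m!_q}$ be the Gaussian binomial coefficient (a polynomial in $q$, evaluated at $q$). For $0\ne q\in\Bbbk$, $\Bbbk\mathcal{A}(q)$ is the Hopf algebra with $\Bbbk$-basis $\{p_i^l\mid i\in\mathbb{Z},\ l\ge 0\}$ ($p_i^l$ is the path of length $l$ starting at vertex $i$ of the infinite linear quiver, with vertex set $\mathbb{Z}$ and one arrow $i\to i+1$ for each $i$), comultiplication $\Delta(p_i^l)=\sum_{j=0}^{l}p_{i+j}^{l-j}\otimes p_i^{j}$, counit $\varepsilon(p_i^l)=\delta_{l,0}$, multiplication $p_i^l\cdot p_j^m=q^{im}\binom{l+m}{l}_q\,p_{i+j}^{l+m}$, and unit $p_0^0$. $\mathcal{D}_q$ is the tensor category of finite dimensional right $\Bbbk\mathcal{A}(q)$-comodules, where the comodule structure of $U\otimes V$ is $u\otimes v\mapsto u_0\otimes v_0\otimes u_1v_1$ (Sweedler notation). For $i\in\mathbb{Z}$ and $l\ge 0$, $V(i,l)$ is the right $\Bbbk\mathcal{A}(q)$-comodule with basis $v^i_0,\dots,v^i_l$ and coaction $v^i_m\mapsto\sum_{j=m}^{l}v^i_j\otimes p_{i+m}^{j-m}$. A direct sum over an empty index range is $0$. *)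

theory Defs
  imports "HOL-Library.Poly_Mapping" "HOL-Computational_Algebra.Polynomial"
begin

section \<open>Coordinate vector spaces and their tensor products\<close>

text \<open>
  A vector space with basis \<open>B\<close> over a field \<open>'k\<close> is the space of finitely supported functions
  \<open>B \<rightarrow> 'k\<close>, i.e. the set of \<open>x :: 'b \<Rightarrow>\<^sub>0 'k\<close> with \<open>keys x \<subseteq> B\<close>.  The tensor product of the spaces
  with bases \<open>B\<close> and \<open>C\<close> is the space with basis \<open>B \<times> C\<close>.
\<close>

definition scale :: "'k::field \<Rightarrow> ('b \<Rightarrow>\<^sub>0 'k) \<Rightarrow> ('b \<Rightarrow>\<^sub>0 'k)" where
  "scale c x = Poly_Mapping.map ((*) c) x"

abbreviation bvec :: "'b \<Rightarrow> ('b \<Rightarrow>\<^sub>0 'k::field)" where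
  "bvec b \<equiv> Poly_Mapping.single b 1"

text \<open>The linear map with prescribed values on the basis vectors.\<close>

definition lin_ext :: "('b \<Rightarrow> ('c \<Rightarrow>\<^sub>0 'k)) \<Rightarrow> ('b \<Rightarrow>\<^sub>0 'k::field) \<Rightarrow> ('c \<Rightarrow>\<^sub>0 'k)" where
  "lin_ext g x = (\<Sum>b\<in>Poly_Mapping.keys x. scale (Poly_Mapping.lookup x b) (g b))"

definition basis_map :: "('b \<Rightarrow> 'c) \<Rightarrow> ('b \<Rightarrow>\<^sub>0 'k::field) \<Rightarrow> ('c \<Rightarrow>\<^sub>0 'k)" where
  "basis_map g = lin_ext (\<lambda>b. bvec (g b))"

definition tens :: "('a \<Rightarrow>\<^sub>0 'k) \<Rightarrow> ('b \<Rightarrow>\<^sub>0 'k::field) \<Rightarrow> ('a \<times> 'b \<Rightarrow>\<^sub>0 'k)" where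
  "tens x y = lin_ext (\<lambda>a. lin_ext (\<lambda>b. bvec (a, b)) y) x"

definition tens_map ::
  "(('a \<Rightarrow>\<^sub>0 'k) \<Rightarrow> ('c \<Rightarrow>\<^sub>0 'k)) \<Rightarrow> (('b \<Rightarrow>\<^sub>0 'k) \<Rightarrow> ('d \<Rightarrow>\<^sub>0 'k)) \<Rightarrow>
     ('a \<times> 'b \<Rightarrow>\<^sub>0 'k::field) \<Rightarrow> ('c \<times> 'd \<Rightarrow>\<^sub>0 'k)" where
  "tens_map f g = lin_ext (\<lambda>(a, b). tens (f (bvec a)) (g (bvec b)))"

definition tens_assoc :: "(('a \<times> 'b) \<times> 'c \<Rightarrow>\<^sub>0 'k::field) \<Rightarrow> ('a \<times> ('b \<times> 'c) \<Rightarrow>\<^sub>0 'k)" where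
  "tens_assoc = basis_map (\<lambda>((a, b), c). (a, (b, c)))"

definition tens_swap ::
  "(('a \<times> 'b) \<times> ('c \<times> 'd) \<Rightarrow>\<^sub>0 'k::field) \<Rightarrow> (('a \<times> 'c) \<times> ('b \<times> 'd) \<Rightarrow>\<^sub>0 'k)" where
  "tens_swap = basis_map (\<lambda>((a, b), (c, d)). ((a, c), (b, d)))"


section \<open>Gaussian binomial coefficients\<close>

definition qint :: "'a::comm_ring_1 \<Rightarrow> nat \<Rightarrow> 'a" where
  "qint q l = (\<Sum>i<l. q ^ i)"

definition qfact :: "'a::comm_ring_1 \<Rightarrow> nat \<Rightarrow> 'a" where
  "qfact q l = (\<Prod>j=1..l. qint q j)"

text \<open>
  At a root of unity the \<open>q\<close>-factorials may vanish, so the quotient is formed in the polynomial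
  ring (where it is exact) and then evaluated at \<open>q\<close>.
\<close>

definition qbinom :: "'k::field \<Rightarrow> nat \<Rightarrow> nat \<Rightarrow> 'k" where
  "qbinom q l m =
     (let X = [:0, 1:] in poly (qfact X (l + m) div (qfact X l * qfact X m)) q)"


section \<open>The Hopf algebra of the infinite linear quiver\<close>

text \<open>
  The pair \<open>(i, l)\<close> stands for the path \<open>p_i^l\<close> of length \<open>l\<close> starting at the vertex \<open>i\<close>.
  The unit \<open>p_0^0\<close> and the antipode play no role for comodules, their direct sums and their tensor
  products, so they are not named.
\<close>

type_synonym path = "int \<times> nat"

definition comult :: "(path \<Rightarrow>\<^sub>0 'k::field) \<Rightarrow> (path \<times> path \<Rightarrow>\<^sub>0 'k)" where
  "comult = lin_ext (\<lambda>(i, l). \<Sum>j\<le>l. tens (bvec (i + int j, l - j)) (bvec (i, j)))"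

definition counit :: "(path \<Rightarrow>\<^sub>0 'k::field) \<Rightarrow> 'k" where
  "counit x = (\<Sum>(i, l)\<in>Poly_Mapping.keys x. Poly_Mapping.lookup x (i, l) * (if l = 0 then 1 else 0))"

definition mult :: "'k::field \<Rightarrow> (path \<times> path \<Rightarrow>\<^sub>0 'k) \<Rightarrow> (path \<Rightarrow>\<^sub>0 'k)" where
  "mult q = lin_ext (\<lambda>((i, l), (j, m)).
     scale (q powi (i * int m) * qbinom q l m) (bvec (i + j, l + m)))"


section \<open>Finite dimensional right comodules\<close>

text \<open>
  Only the restriction of the field \<open>coact\<close> to the subspace \<open>space X\<close> is meaningful.  The
  coalgebra structure, hence the category of comodules, does not depend on \<open>q\<close>; only the tensor
  product of comodules does.
\<close>

record (overloaded) ('b, 'k) precomodule =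
  basis :: "'b set"
  coact :: "('b \<Rightarrow>\<^sub>0 'k::field) \<Rightarrow> ('b \<times> path \<Rightarrow>\<^sub>0 'k)"

definition space :: "('b, 'k::field) precomodule \<Rightarrow> ('b \<Rightarrow>\<^sub>0 'k) set" where
  "space X = {x. Poly_Mapping.keys x \<subseteq> basis X}"

text \<open>
  The last condition is \<open>(id \<otimes> \<epsilon>) \<circ> \<rho> = id\<close>, with \<open>V \<otimes> \<k>\<close> identified with \<open>V\<close>.
\<close>

definition comodule :: "('b, 'k::field) precomodule \<Rightarrow> bool" where
  "comodule X \<longleftrightarrow>
     finite (basis X) \<and>
     Vector_Spaces.linear scale scale (coact X) \<and>
     (\<forall>x\<in>space X. Poly_Mapping.keys (coact X x) \<subseteq> basis X \<times> UNIV) \<and>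
     (\<forall>x\<in>space X. tens_assoc (tens_map (coact X) id (coact X x)) = tens_map id comult (coact X x)) \<and>
     (\<forall>x\<in>space X. lin_ext (\<lambda>(b, p). scale (counit (bvec p)) (bvec b)) (coact X x) = x)"

definition comodule_hom ::
  "('b, 'k::field) precomodule \<Rightarrow> ('c, 'k) precomodule \<Rightarrow> (('b \<Rightarrow>\<^sub>0 'k) \<Rightarrow> ('c \<Rightarrow>\<^sub>0 'k)) \<Rightarrow> bool" where
  "comodule_hom X Y f \<longleftrightarrow>
     Vector_Spaces.linear scale scale f \<and>
     f ` space X \<subseteq> space Y \<and>
     (\<forall>x\<in>space X. coact Y (f x) = tens_map f id (coact X x))"

definition comodule_iso ::
  "('b, 'k::field) precomodule \<Rightarrow> ('c, 'k) precomodule \<Rightarrow> bool" (infix \<open>\<cong>\<close> 50) where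
  "X \<cong> Y \<longleftrightarrow> comodule X \<and> comodule Y \<and>
     (\<exists>f g. comodule_hom X Y f \<and> comodule_hom Y X g \<and>
        (\<forall>x\<in>space X. g (f x) = x) \<and> (\<forall>y\<in>space Y. f (g y) = y))"

text \<open>\<open>u \<otimes> v \<mapsto> u\<^sub>0 \<otimes> v\<^sub>0 \<otimes> u\<^sub>1 v\<^sub>1\<close>\<close>

definition tensor_comodule ::
  "'k::field \<Rightarrow> ('b, 'k) precomodule \<Rightarrow> ('c, 'k) precomodule \<Rightarrow> ('b \<times> 'c, 'k) precomodule" where
  "tensor_comodule q X Y =
     \<lparr>basis = basis X \<times> basis Y,
      coact = tens_map id (mult q) \<circ> tens_swap \<circ> tens_map (coact X) (coact Y)\<rparr>"

abbreviation tensor_comodule_syntax ::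
  "('b, 'k::field) precomodule \<Rightarrow> 'k \<Rightarrow> ('c, 'k) precomodule \<Rightarrow> ('b \<times> 'c, 'k) precomodule"
  (\<open>(_ \<otimes>\<^bsub>_\<^esub> _)\<close> [71, 0, 71] 70) where
  "X \<otimes>\<^bsub>q\<^esub> Y \<equiv> tensor_comodule q X Y"

definition sum_comodule ::
  "('b, 'k::field) precomodule \<Rightarrow> ('c, 'k) precomodule \<Rightarrow> ('b + 'c, 'k) precomodule" (infixl \<open>\<oplus>\<close> 65) where
  "X \<oplus> Y =
     \<lparr>basis = basis X <+> basis Y,
      coact = lin_ext (case_sum
        (\<lambda>b. tens_map (basis_map Inl) id (coact X (bvec b)))
        (\<lambda>c. tens_map (basis_map Inr) id (coact Y (bvec c))))\<rparr>"

text \<open>The direct sum of a family; for an empty index set it is the zero comodule.\<close>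

definition dsum ::
  "'i set \<Rightarrow> ('i \<Rightarrow> ('b, 'k::field) precomodule) \<Rightarrow> ('i \<times> 'b, 'k) precomodule" where
  "dsum I X =
     \<lparr>basis = (SIGMA i:I. basis (X i)),
      coact = lin_ext (\<lambda>(i, b). tens_map (basis_map (Pair i)) id (coact (X i) (bvec b)))\<rparr>"

text \<open>The number \<open>m\<close> stands for the basis vector \<open>v^i_m\<close>.\<close>

definition V :: "int \<Rightarrow> nat \<Rightarrow> (nat, 'k::field) precomodule" where
  "V i l =
     \<lparr>basis = {0..l},
      coact = lin_ext (\<lambda>m. \<Sum>j=m..l. tens (bvec j) (bvec (i + int m, j - m)))\<rparr>"


section \<open>Basic facts\<close>

lemma qint_add: "qint q (l + m) = qint q l + q ^ l * qint q m"
  by (induction m) (auto simp: qint_def power_add algebra_simps)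

lemma qfact_Suc: "qfact q (Suc n) = qfact q n * qint q (Suc n)"
  by (simp add: qfact_def)

text \<open>Exactness of the division in \<open>qbinom\<close>.\<close>

lemma qfact_mult_dvd: "qfact q l * qfact q m dvd qfact q (l + m)"
proof (induction "l + m" arbitrary: l m rule: less_induct)
  case less
  show ?case
  proof (cases l)
    case 0
    then show ?thesis by (simp add: qfact_def)
  next
    case l: (Suc l')
    show ?thesis
    proof (cases m)
      case 0
      then show ?thesis by (simp add: qfact_def)
    next
      case m: (Suc m')
      have "qfact q l' * qfact q m dvd qfact q (l' + m)"
        and "qfact q l * qfact q m' dvd qfact q (l + m')"
        using l m by (auto intro!: less.hyps simp del: add_Suc add_Suc_right)
      then obtain u v where u: "qfact q (l' + m) = qfact q l' * qfact q m * u"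
        and v: "qfact q (l + m') = qfact q l * qfact q m' * v"
        by (auto elim!: dvdE)
      have "qfact q (l + m) = qfact q (l' + m) * qint q l + q ^ l * (qfact q (l + m') * qint q m)"
        using l m qfact_Suc[of q "l' + m"] qint_add[of q l m] by (simp add: algebra_simps)
      also have "\<dots> = qfact q l * qfact q m * (u + q ^ l * v)"
        unfolding u v using l m by (simp add: qfact_Suc algebra_simps)
      finally show ?thesis by simp
    qed
  qed
qed

lemma lookup_scale [simp]: "Poly_Mapping.lookup (scale c x) b = c * Poly_Mapping.lookup x b"
  by (simp add: scale_def Poly_Mapping.map.rep_eq when_def)

lemma vector_space_scale: "vector_space (scale :: 'k::field \<Rightarrow> ('b \<Rightarrow>\<^sub>0 'k) \<Rightarrow> _)"
  by unfold_locales (auto intro!: poly_mapping_eqI simp: lookup_add algebra_simps)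


lemma linear_lin_ext: "Vector_Spaces.linear scale scale (lin_ext g)"
proof -
  have supp: "lin_ext g x = (\<Sum>b\<in>A. scale (Poly_Mapping.lookup x b) (g b))"
    if "finite A" "Poly_Mapping.keys x \<subseteq> A" for A x
    unfolding lin_ext_def
    by (rule sum.mono_neutral_left)
       (use that in \<open>auto simp: in_keys_iff intro!: poly_mapping_eqI\<close>)
  have add: "lin_ext g (x + y) = lin_ext g x + lin_ext g y" for x y
  proof -
    let ?A = "Poly_Mapping.keys x \<union> Poly_Mapping.keys y"
    have "scale (a + b) v = scale a v + scale b v" for a b :: 'a and v :: "'c \<Rightarrow>\<^sub>0 'a"
      by (auto intro!: poly_mapping_eqI simp: lookup_add algebra_simps)
    then show ?thesis
      using keys_add[of x y] supp[of ?A "x + y"] supp[of ?A x] supp[of ?A y]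
      by (simp add: lookup_add sum.distrib)
  qed
  have sc: "lin_ext g (scale c x) = scale c (lin_ext g x)" for c x
  proof -
    have sub: "Poly_Mapping.keys (scale c x) \<subseteq> Poly_Mapping.keys x"
      by (auto simp: in_keys_iff)
    show ?thesis
      using supp[OF _ sub] supp[of "Poly_Mapping.keys x" x]
      by (auto intro!: poly_mapping_eqI simp: lookup_sum sum_distrib_left mult.assoc)
  qed
  show ?thesis
    by (intro Vector_Spaces.linear.intro module_hom.intro module_hom_axioms.intro
        vector_space_scale vector_space_scale[folded module_iff_vector_space] add sc)
qed

lemma scale_0 [simp]: "scale 0 x = 0" and scale_1 [simp]: "scale 1 x = x"
  by (auto intro!: poly_mapping_eqI)

lemma lin_ext_bvec [simp]: "lin_ext g (bvec b) = g b"
  by (simp add: lin_ext_def)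

lemma lin_ext_sum: "lin_ext g (\<Sum>i\<in>I. x i) = (\<Sum>i\<in>I. lin_ext g (x i))"
  by (rule module_hom.sum[OF module_hom_iff_linear[THEN iffD2, OF linear_lin_ext]])

lemma lin_ext_scale: "lin_ext g (scale c x) = scale c (lin_ext g x)"
  by (rule module_hom.scale[OF module_hom_iff_linear[THEN iffD2, OF linear_lin_ext]])

lemma bvec_expand: "x = (\<Sum>b\<in>Poly_Mapping.keys x. scale (Poly_Mapping.lookup x b) (bvec b))"
  by (rule poly_mapping_eqI) 
     (simp add: lookup_sum lookup_single when_def in_keys_iff if_distrib[of "(*) _"] sum.delta
       cong: if_cong)

lemma tens_bvec [simp]: "tens (bvec a) (bvec b) = bvec (a, b)"
  by (simp add: tens_def)

lemma tens_map_bvec [simp]: "tens_map f g (bvec (a, b)) = tens (f (bvec a)) (g (bvec b))"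
  by (simp add: tens_map_def)

lemma tens_map_sum: "tens_map f g (\<Sum>i\<in>I. x i) = (\<Sum>i\<in>I. tens_map f g (x i))"
  by (simp add: tens_map_def lin_ext_sum)

lemma tens_sum_left: "tens (\<Sum>i\<in>I. x i) y = (\<Sum>i\<in>I. tens (x i) y)"
  by (simp add: tens_def lin_ext_sum)

lemma tens_sum_right: "tens (bvec a) (\<Sum>i\<in>I. y i) = (\<Sum>i\<in>I. tens (bvec a) (y i))"
  by (simp add: tens_def lin_ext_sum)

lemma tens_assoc_bvec [simp]: "tens_assoc (bvec ((a, b), c)) = bvec (a, (b, c))"
  by (simp add: tens_assoc_def basis_map_def)

lemma tens_assoc_sum: "tens_assoc (\<Sum>i\<in>I. x i) = (\<Sum>i\<in>I. tens_assoc (x i))"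
  by (simp add: tens_assoc_def basis_map_def lin_ext_sum)

lemma tens_swap_bvec [simp]: "tens_swap (bvec ((a, b), (c, d))) = bvec ((a, c), (b, d))"
  by (simp add: tens_swap_def basis_map_def)

lemma comult_bvec: "comult (bvec (i, l)) = (\<Sum>j\<le>l. bvec ((i + int j, l - j), (i, j)))"
  by (simp add: comult_def)

lemma counit_bvec [simp]: "counit (bvec (i, l)) = (if l = 0 then 1 else 0)"
  by (simp add: counit_def)

lemma mult_bvec:
  "mult q (bvec ((i, l), (j, m))) = scale (q powi (i * int m) * qbinom q l m) (bvec (i + j, l + m))"
  by (simp add: mult_def)

lemma coact_V_bvec: "coact (V i l) (bvec m) = (\<Sum>j=m..l. bvec (j, (i + int m, j - m)))"
  by (simp add: V_def)

lemma comodule_V: "comodule (V i l :: (nat, 'k::field) precomodule)"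
proof -
  let ?V = "V i l :: (nat, 'k) precomodule"
  let ?\<rho> = "coact ?V"
  have lin: "Vector_Spaces.linear scale scale ?\<rho>"
    by (simp add: V_def linear_lin_ext)
  have \<rho>_expand: "?\<rho> x = (\<Sum>b\<in>Poly_Mapping.keys x. scale (Poly_Mapping.lookup x b) (?\<rho> (bvec b)))" for x
    by (simp add: V_def lin_ext_def)
  have ker: "Poly_Mapping.keys (?\<rho> x) \<subseteq> {0..l} \<times> UNIV" for x
  proof
    fix p assume "p \<in> Poly_Mapping.keys (?\<rho> x)"
    then obtain b where "p \<in> Poly_Mapping.keys (scale (Poly_Mapping.lookup x b) (?\<rho> (bvec b)))"
      unfolding \<rho>_expand[of x] using keys_sum by fast
    then have "p \<in> Poly_Mapping.keys (?\<rho> (bvec b))"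
      by (auto simp: in_keys_iff)
    then obtain j where "j \<in> {b..l}" "p \<in> Poly_Mapping.keys (bvec (j, (i + int b, j - b)) :: _ \<Rightarrow>\<^sub>0 'k)"
      unfolding coact_V_bvec using keys_sum by fast
    then show "p \<in> {0..l} \<times> UNIV" by (auto split: if_splits)
  qed
  have coass: "tens_assoc (tens_map ?\<rho> id (?\<rho> (bvec b))) = tens_map id comult (?\<rho> (bvec b))" for b
  proof -
    have "tens_assoc (tens_map ?\<rho> id (?\<rho> (bvec b))) =
       (\<Sum>j=b..l. \<Sum>n=j..l. bvec (n, ((i + int j, n - j), (i + int b, j - b))))"
      by (simp add: coact_V_bvec tens_map_sum tens_sum_left tens_assoc_sum)
    also have "\<dots> = (\<Sum>n=b..l. \<Sum>j=b..n. bvec (n, ((i + int j, n - j), (i + int b, j - b))))"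
      unfolding sum.Sigma[OF finite_atLeastAtMost ballI[OF finite_atLeastAtMost]]
      by (rule sum.reindex_bij_witness[where i="\<lambda>(a, b). (b, a)" and j="\<lambda>(a, b). (b, a)"]) auto
    also have "\<dots> = (\<Sum>n=b..l. \<Sum>t\<le>n - b. bvec (n, ((i + int b + int t, n - b - t), (i + int b, t))))"
    proof (rule sum.cong[OF refl])
      fix n assume "n \<in> {b..l}"
      then show "(\<Sum>j=b..n. bvec (n, ((i + int j, n - j), (i + int b, j - b)))) =
        (\<Sum>t\<le>n - b. bvec (n, ((i + int b + int t, n - b - t), (i + int b, t))))"
        by (intro sum.reindex_bij_witness[where i="\<lambda>t. b + t" and j="\<lambda>j. j - b"])
           (auto simp: of_nat_diff)
    qed
    also have "\<dots> = tens_map id comult (?\<rho> (bvec b))"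
      by (simp add: coact_V_bvec tens_map_sum comult_bvec tens_sum_right)
    finally show ?thesis .
  qed
  have "tens_assoc (tens_map ?\<rho> id (?\<rho> x)) = tens_map id comult (?\<rho> x)" for x
    using coass unfolding \<rho>_expand[of x]
    by (simp add: tens_map_def tens_assoc_def basis_map_def lin_ext_sum lin_ext_scale)
  moreover have "lin_ext (\<lambda>(b, p). scale (counit (bvec p)) (bvec b)) (?\<rho> x) = x" if "x \<in> space ?V" for x
  proof -
    have "lin_ext (\<lambda>(b, p). scale (counit (bvec p)) (bvec b)) (?\<rho> (bvec b)) = bvec b" if "b \<le> l" for b
    proof -
      have "lin_ext (\<lambda>(b, p). scale (counit (bvec p)) (bvec b)) (?\<rho> (bvec b)) =
            (\<Sum>j=b..l. if j = b then bvec b else 0)"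
        unfolding coact_V_bvec lin_ext_sum by (rule sum.cong) auto
      then show ?thesis using that by simp
    qed
    moreover have "b \<le> l" if "b \<in> Poly_Mapping.keys x" for b
      using that \<open>x \<in> space ?V\<close> by (auto simp: space_def V_def)
    ultimately show ?thesis
      unfolding \<rho>_expand[of x]
      by (subst (3) bvec_expand) (simp add: lin_ext_sum lin_ext_scale)
  qed
  ultimately show ?thesis
    using lin ker by (simp add: comodule_def) (simp add: V_def)
qed

end

theory Submission
  imports Defs
begin

text \<open>
  A comodule is a graded space with a nilpotent operator \<open>N\<close> of degree 1, and \<open>V(i,l)\<close> is a single
  \<open>N\<close>-chain of length \<open>l + 1\<close> that starts in degree \<open>i\<close>.  On \<open>V(0,a) \<otimes> V(0,b)\<close> the operator is
  \<open>N (u_s \<otimes> v_t) = u_{s+1} \<otimes> v_t + q\<^sup>s u_s \<otimes> v_{t+1}\<close>, that is, multiplication by \<open>x + y\<close> on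
  \<open>k\<langle>x, y\<rangle> / (y x = q x y, x^{a+1}, y^{b+1})\<close>.  If for every \<open>i \<le> a \<le> b\<close> some vector of degree \<open>i\<close>
  generates a chain of length \<open>L i + 1\<close>, if the end degrees \<open>i + L i\<close> are distinct and if the lengths
  add up to \<open>(a+1)(b+1)\<close>, then these chains form a basis: a linear relation is moved by a power of \<open>N\<close>
  to one between chain ends, which live in different degrees.

  The generators come from the quantum Clebsch--Gordan highest weight vectors, whose coefficients are
  products of Gaussian binomials.  Depending on the residue of \<open>i\<close> modulo \<open>d\<close>, one uses either this
  vector itself, after division by its order of vanishing at the root of unity, or the classical
  (\<open>q = 1\<close>) vector in the central elements \<open>x^d\<close>, \<open>y^d\<close>, times a monomial.
\<close>

section \<open>Linear maps between coordinate spaces\<close>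

text \<open>For a parameter that is no root of unity, the primitive vector of degree i alone
  generates a chain of a + b - 2 i + 1 vectors. At \<open>q\<close> its coefficients and the end of
  its chain may vanish. Division by a power of X - q repairs this if the coefficients vanish to at
  least the order of the end, a condition on carries in base d that is checked for the digits in the
  last branch of \<open>mirror_digit\<close>. In the ranges that are reflected, the dimension of the
  summand is a multiple of d. There N^d supplies the chain, and the obstacle is room: after the last
  nonzero power of N^d another d - 1 steps of N must fit into the truncation. The end degrees a + b
  - \<open>mirror\<close> i come from an involution of {0..a}; this one fact makes them distinct and
  makes the lengths add up correctly. The identities behind the primitive vectors need division by
  (t; t)_n, so they are proved where t is no root of unity and are carried over as polynomial
  identities.\<close>

abbreviation lin :: "(('b \<Rightarrow>\<^sub>0 'k) \<Rightarrow> ('c \<Rightarrow>\<^sub>0 'k::field)) \<Rightarrow> bool" where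
  "lin \<equiv> Vector_Spaces.linear scale scale"

interpretation pm: vector_space "scale :: 'k::field \<Rightarrow> ('b \<Rightarrow>\<^sub>0 'k) \<Rightarrow> _"
  by (rule vector_space_scale)

interpretation pm_pair: vector_space_pair
  "scale :: 'k::field \<Rightarrow> ('b \<Rightarrow>\<^sub>0 'k) \<Rightarrow> _" "scale :: 'k::field \<Rightarrow> ('c \<Rightarrow>\<^sub>0 'k) \<Rightarrow> _"
  by unfold_locales

lemma lin_add: "lin f \<Longrightarrow> f (x + y) = f x + f y"
  and lin_scale: "lin f \<Longrightarrow> f (scale c x) = scale c (f x)"
  and lin_0: "lin f \<Longrightarrow> f 0 = 0"
  and lin_sum: "lin f \<Longrightarrow> f (\<Sum>i\<in>I. g i) = (\<Sum>i\<in>I. f (g i))"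
  by (simp_all add: pm_pair.linear_add pm_pair.linear_scale pm_pair.linear_0 pm_pair.linear_sum)

lemma linI: "(\<And>x y. f (x + y) = f x + f y) \<Longrightarrow> (\<And>c x. f (scale c x) = scale c (f x)) \<Longrightarrow> lin f"
  by (intro Vector_Spaces.linear.intro module_hom.intro module_hom_axioms.intro
      vector_space_scale vector_space_scale[folded module_iff_vector_space])

lemma lin_compose: "lin f \<Longrightarrow> lin g \<Longrightarrow> lin (\<lambda>x. g (f x))"
  by (rule linI) (simp_all add: lin_add lin_scale)

lemma lin_lin_ext: "lin (lin_ext g)" by (rule linear_lin_ext)
lemma lin_id: "lin (\<lambda>x. x)" by (rule linI) auto
lemma lin_id': "lin id" by (rule linI) auto
lemma lin_tens_map: "lin (tens_map f g)" by (simp add: tens_map_def linear_lin_ext)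
lemma lin_tens_assoc: "lin tens_assoc" by (simp add: tens_assoc_def basis_map_def linear_lin_ext)
lemma lin_tens_swap: "lin tens_swap" by (simp add: tens_swap_def basis_map_def linear_lin_ext)
lemma lin_tens_left: "lin (\<lambda>x. tens x y)" by (simp add: tens_def linear_lin_ext)

lemma lin_expand:
  assumes "lin f"
  shows "f x = (\<Sum>b\<in>Poly_Mapping.keys x. scale (Poly_Mapping.lookup x b) (f (bvec b)))"
  by (subst bvec_expand) (simp add: assms lin_sum lin_scale)

lemma lin_eq_on_keys:
  assumes "lin f" "lin g" "\<And>b. b \<in> Poly_Mapping.keys x \<Longrightarrow> f (bvec b) = g (bvec b)"
  shows "f x = g x"
  by (subst lin_expand[OF assms(1)], subst lin_expand[OF assms(2)]) (simp add: assms(3))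

lemma lin_funpow: "lin (N :: ('b \<Rightarrow>\<^sub>0 'k::field) \<Rightarrow> ('b \<Rightarrow>\<^sub>0 'k)) \<Longrightarrow> lin (N ^^ n)"
  by (induction n) (auto intro!: linI simp: lin_add lin_scale)

lemma lookup_lin_ext:
  "Poly_Mapping.lookup (lin_ext g x) c =
     (\<Sum>b\<in>Poly_Mapping.keys x. Poly_Mapping.lookup x b * Poly_Mapping.lookup (g b) c)"
  by (simp add: lin_ext_def lookup_sum)

lemma lookup_tens [simp]:
  "Poly_Mapping.lookup (tens x y) (a, b) = Poly_Mapping.lookup x a * Poly_Mapping.lookup y b"
proof -
  have 1: "Poly_Mapping.lookup (lin_ext (\<lambda>b'. bvec (a', b')) y) (a, b) =
        (if a' = a then Poly_Mapping.lookup y b else 0)" for a'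
  proof -
    have "Poly_Mapping.lookup (lin_ext (\<lambda>b'. bvec (a', b')) y) (a, b) =
       (\<Sum>b'\<in>Poly_Mapping.keys y. if b' = b then (if a' = a then Poly_Mapping.lookup y b else 0) else 0)"
      unfolding lookup_lin_ext by (rule sum.cong) (auto simp: lookup_single when_def)
    then show ?thesis by (auto simp: in_keys_iff)
  qed
  have "Poly_Mapping.lookup (tens x y) (a, b) =
       (\<Sum>a'\<in>Poly_Mapping.keys x. if a' = a then Poly_Mapping.lookup x a * Poly_Mapping.lookup y b else 0)"
    unfolding tens_def by (subst lookup_lin_ext, rule sum.cong) (auto simp: 1)
  then show ?thesis by (auto simp: in_keys_iff)
qed

lemma lin_tens_right: "lin (tens x)"
  by (rule linI; rule poly_mapping_eqI) (auto simp: lookup_add algebra_simps)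

lemma tens_0 [simp]: "tens 0 y = 0" "tens x 0 = 0"
  using lin_0[OF lin_tens_left] lin_0[OF lin_tens_right] by auto

lemma tens_scale: "tens (scale c x) y = scale c (tens x y)" "tens x (scale c y) = scale c (tens x y)"
  using lin_scale[OF lin_tens_left] lin_scale[OF lin_tens_right] by auto

lemma tens_sum:
  fixes x :: "'i \<Rightarrow> ('b \<Rightarrow>\<^sub>0 'k::field)" and y :: "'j \<Rightarrow> ('c \<Rightarrow>\<^sub>0 'k)"
  shows "tens (\<Sum>i\<in>I. x i) v = (\<Sum>i\<in>I. tens (x i) v)"
    and "tens u (\<Sum>j\<in>J. y j) = (\<Sum>j\<in>J. tens u (y j))"
  by (auto simp: lin_sum[OF lin_tens_left] lin_sum[OF lin_tens_right])

lemma keys_tens: "Poly_Mapping.keys (tens x y) \<subseteq> Poly_Mapping.keys x \<times> Poly_Mapping.keys y"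
  by (auto simp: in_keys_iff)

lemma keys_scale: "Poly_Mapping.keys (scale c x) \<subseteq> Poly_Mapping.keys x"
  by (auto simp: in_keys_iff)

lemma tens_map_tens:
  assumes "lin f" "lin g"
  shows "tens_map f g (tens x y) = tens (f x) (g y)"
proof -
  have "tens_map f g (tens x (bvec b)) = tens (f x) (g (bvec b))" for b
    by (rule lin_eq_on_keys[OF lin_compose[OF lin_tens_left[of "bvec b"] lin_tens_map[of f g]]
          lin_compose[OF assms(1) lin_tens_left[of "g (bvec b)"]]]) simp
  then show ?thesis
    by (rule lin_eq_on_keys[OF lin_compose[OF lin_tens_right[of x] lin_tens_map[of f g]]
          lin_compose[OF assms(2) lin_tens_right[of "f x"]]])
qed

lemma tens_map_compose:
  assumes "lin f'" "lin g'"
  shows "tens_map f' g' (tens_map f g x) = tens_map (\<lambda>x. f' (f x)) (\<lambda>x. g' (g x)) x"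
  by (rule lin_eq_on_keys[OF lin_compose[OF lin_tens_map[of f g] lin_tens_map[of f' g']] lin_tens_map])
     (auto simp: tens_map_tens assms)

lemma tens_assoc_tens: "tens_assoc (tens (tens x y) z) = tens x (tens y z)"
proof -
  have 1: "tens_assoc (tens (tens (bvec a) (bvec b)) (bvec c)) = tens (bvec a) (tens (bvec b) (bvec c))" for a b c
    by simp
  have 2: "tens_assoc (tens (tens x (bvec b)) (bvec c)) = tens x (tens (bvec b) (bvec c))" for b c
    by (rule lin_eq_on_keys[where f = "\<lambda>x. tens_assoc (tens (tens x (bvec b)) (bvec c))"])
       (use 1 in \<open>auto intro!: linI simp: lin_add[OF lin_tens_left] lin_add[OF lin_tens_assoc] lin_scale[OF lin_tens_assoc] tens_scale\<close>)
  have 3: "tens_assoc (tens (tens x y) (bvec c)) = tens x (tens y (bvec c))" for c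
    by (rule lin_eq_on_keys[where f = "\<lambda>y. tens_assoc (tens (tens x y) (bvec c))"])
       (use 2 in \<open>auto intro!: linI simp: lin_add[OF lin_tens_left] lin_add[OF lin_tens_right] lin_add[OF lin_tens_assoc] lin_scale[OF lin_tens_assoc] tens_scale\<close>)
  show ?thesis
    by (rule lin_eq_on_keys[where f = "\<lambda>z. tens_assoc (tens (tens x y) z)"])
       (use 3 in \<open>auto intro!: linI simp: lin_add[OF lin_tens_left] lin_add[OF lin_tens_right] lin_add[OF lin_tens_assoc] lin_scale[OF lin_tens_assoc] tens_scale\<close>)
qed

lemma lin_comult: "lin comult" by (simp add: comult_def linear_lin_ext)

lemma space_bvec [simp]: "bvec b \<in> space X \<longleftrightarrow> b \<in> basis X"
  by (simp add: space_def)

section \<open>Comodules as graded nilpotent operators\<close>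

text \<open>A comodule over the path coalgebra is a graded space with a nilpotent operator \<open>N\<close> of degree 1:
  the coaction is \<open>x \<mapsto> \<Sum>n. N\<^sup>n x \<otimes> p_i^n\<close> for \<open>x\<close> of degree \<open>i\<close>.  The number \<open>K\<close> only bounds the
  nilpotency index.\<close>

definition graded_rep ::
  "('b, 'k::field) precomodule \<Rightarrow> ('b \<Rightarrow> int) \<Rightarrow> (('b \<Rightarrow>\<^sub>0 'k) \<Rightarrow> ('b \<Rightarrow>\<^sub>0 'k)) \<Rightarrow> nat \<Rightarrow> bool" where
  "graded_rep X deg N K \<longleftrightarrow>
     finite (basis X) \<and> lin (coact X) \<and> lin N \<and>
     (\<forall>b\<in>basis X. Poly_Mapping.keys (N (bvec b)) \<subseteq> {c\<in>basis X. deg c = deg b + 1}) \<and>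
     (\<forall>b\<in>basis X. \<forall>n>K. (N ^^ n) (bvec b) = 0) \<and>
     (\<forall>b\<in>basis X. coact X (bvec b) = (\<Sum>n\<le>K. tens ((N ^^ n) (bvec b)) (bvec (deg b, n))))"

definition homog :: "('b, 'k::field) precomodule \<Rightarrow> ('b \<Rightarrow> int) \<Rightarrow> int \<Rightarrow> ('b \<Rightarrow>\<^sub>0 'k) set" where
  "homog X deg i = {x. Poly_Mapping.keys x \<subseteq> {b\<in>basis X. deg b = i}}"

lemma keys_lin_subset:
  assumes "lin f" "\<And>b. b \<in> Poly_Mapping.keys x \<Longrightarrow> Poly_Mapping.keys (f (bvec b)) \<subseteq> A"
  shows "Poly_Mapping.keys (f x) \<subseteq> A"
proof -
  have "Poly_Mapping.keys (f x) \<subseteq> (\<Union>b\<in>Poly_Mapping.keys x. Poly_Mapping.keys (scale (Poly_Mapping.lookup x b) (f (bvec b))))"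
    by (subst lin_expand[OF assms(1)]) (rule keys_sum)
  then show ?thesis using assms(2) keys_scale by fast
qed

lemma homog_N:
  assumes "graded_rep X deg N K" "x \<in> homog X deg i"
  shows "N x \<in> homog X deg (i + 1)"
  using assms keys_lin_subset[of N x "{b\<in>basis X. deg b = i + 1}"]
  unfolding homog_def graded_rep_def by fastforce

lemma homog_funpow:
  assumes "graded_rep X deg N K" "x \<in> homog X deg i"
  shows "(N ^^ n) x \<in> homog X deg (i + int n)"
proof (induction n)
  case (Suc n)
  from homog_N[OF assms(1) this] show ?case by (simp add: algebra_simps)
qed (use assms in auto)

lemma homog_bvec: "b \<in> basis X \<Longrightarrow> bvec b \<in> homog X deg (deg b)"
  by (simp add: homog_def)

lemma homog_subset_space: "x \<in> homog X deg i \<Longrightarrow> x \<in> space X"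
  by (auto simp: homog_def space_def)

lemma funpow_space_zero:
  assumes "graded_rep X deg N K" "x \<in> space X" "n > K"
  shows "(N ^^ n) x = 0"
proof -
  have N: "lin N" using assms(1) by (simp add: graded_rep_def)
  have 0: "lin (\<lambda>x :: 'a \<Rightarrow>\<^sub>0 'b. 0 :: 'a \<Rightarrow>\<^sub>0 'b)" by (rule linI) auto
  show ?thesis
    by (rule lin_eq_on_keys[OF lin_funpow[OF N] 0]) (use assms in \<open>auto simp: graded_rep_def space_def\<close>)
qed

text \<open>Homogeneity matters because the path in the second tensor factor starts at the degree of
  the vector.\<close>

lemma coact_homog:
  assumes R: "graded_rep X deg N K" and x: "x \<in> homog X deg i"
  shows "coact X x = (\<Sum>n\<le>K. tens ((N ^^ n) x) (bvec (i, n)))"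
proof -
  have N: "lin N" and \<rho>: "lin (coact X)" using R by (auto simp: graded_rep_def)
  note P = lin_funpow[OF N]
  have "lin (\<lambda>x. \<Sum>n\<le>K. tens ((N ^^ n) x) (bvec (i, n) :: path \<Rightarrow>\<^sub>0 'b))"
    by (rule linI) (simp_all add: lin_add[OF P] lin_scale[OF P] lin_add[OF lin_tens_left] tens_scale
          sum.distrib pm.scale_sum_right)
  then show ?thesis
    by (rule lin_eq_on_keys[OF \<rho>]) (use R x in \<open>auto simp: graded_rep_def homog_def\<close>)
qed

text \<open>Coassociativity comes down to N^n N^j = N^(n+j), the counit axiom to N^0 = id.\<close>

lemma comodule_graded_rep:
  assumes R: "graded_rep X deg N K"
  shows "comodule X"
proof -
  have N: "lin N" and \<rho>: "lin (coact X)" and fin: "finite (basis X)"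
    and ac: "\<And>b. b \<in> basis X \<Longrightarrow> coact X (bvec b) = (\<Sum>n\<le>K. tens ((N ^^ n) (bvec b)) (bvec (deg b, n)))"
    using R by (auto simp: graded_rep_def)
  have keys: "Poly_Mapping.keys (coact X x) \<subseteq> basis X \<times> UNIV" if "x \<in> space X" for x
  proof (rule keys_lin_subset[OF \<rho>])
    fix b assume "b \<in> Poly_Mapping.keys x"
    then have b: "b \<in> basis X" using that by (auto simp: space_def)
    have "Poly_Mapping.keys (tens ((N ^^ n) (bvec b)) (bvec (deg b, n))) \<subseteq> basis X \<times> UNIV" for n
      using keys_tens[of "(N ^^ n) (bvec b)" "bvec (deg b, n)"] homog_funpow[OF R homog_bvec[OF b], of n]
      unfolding homog_def by fast
    then show "Poly_Mapping.keys (coact X (bvec b)) \<subseteq> basis X \<times> UNIV"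
      unfolding ac[OF b] using keys_sum[of "\<lambda>n. tens ((N ^^ n) (bvec b)) (bvec (deg b, n))" "{..K}"] by fast
  qed
  have coass: "tens_assoc (tens_map (coact X) id (coact X x)) = tens_map id comult (coact X x)"
    if "x \<in> space X" for x
  proof (rule lin_eq_on_keys[where x = x])
    show "lin (\<lambda>x. tens_assoc (tens_map (coact X) id (coact X x)))"
      by (rule lin_compose[OF lin_compose[OF \<rho> lin_tens_map] lin_tens_assoc])
    show "lin (\<lambda>x. tens_map id comult (coact X x))" by (rule lin_compose[OF \<rho> lin_tens_map])
    fix b assume "b \<in> Poly_Mapping.keys x"
    then have b: "b \<in> basis X" using that by (auto simp: space_def)
    let ?N = "\<lambda>n. (N ^^ n) (bvec b)"
    let ?t = "\<lambda>n j. tens (?N n) (bvec ((deg b + int j, n - j), (deg b, j)))"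
    have Z: "?N n = 0" if "n > K" for n
      using funpow_space_zero[OF R _ that] b by simp
    have "tens_assoc (tens_map (coact X) id (coact X (bvec b))) =
      (\<Sum>j\<le>K. tens_assoc (tens (coact X (?N j)) (bvec (deg b, j))))"
      by (simp add: ac[OF b] tens_map_sum tens_assoc_sum tens_map_tens[OF \<rho> lin_id'])
    also have "\<dots> = (\<Sum>j\<le>K. \<Sum>n\<le>K. ?t (n + j) j)"
      by (rule sum.cong[OF refl], subst coact_homog[OF R homog_funpow[OF R homog_bvec[OF b]]])
         (simp add: tens_sum tens_assoc_sum tens_assoc_tens funpow_add)
    also have "\<dots> = (\<Sum>(j, n)\<in>{..K} \<times> {..K}. ?t (n + j) j)"
      by (simp add: sum.cartesian_product)
    \<comment> \<open>Pairs with j + n > K contribute 0, so the square shrinks to a triangle, on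
      which n + j can serve as the outer index.\<close>
    also have "\<dots> = (\<Sum>(j, n)\<in>{(j, n). j + n \<le> K}. ?t (n + j) j)"
      by (rule sum.mono_neutral_right) (auto, metis Z not_le tens_0(1) add.commute)
    also have "\<dots> = (\<Sum>(n, j)\<in>(SIGMA n:{..K}. {..n}). ?t n j)"
      by (rule sum.reindex_bij_witness[where i = "\<lambda>(n, j). (j, n - j)" and j = "\<lambda>(j, n). (n + j, j)"]) auto
    also have "\<dots> = (\<Sum>n\<le>K. \<Sum>j\<le>n. ?t n j)"
      by (simp add: sum.Sigma)
    also have "\<dots> = tens_map id comult (coact X (bvec b))"
      by (simp add: ac[OF b] tens_map_sum tens_map_tens[OF lin_id' lin_comult] comult_bvec tens_sum)
    finally show "tens_assoc (tens_map (coact X) id (coact X (bvec b))) = tens_map id comult (coact X (bvec b))" .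
  qed
  have cou: "lin_ext (\<lambda>(b, p). scale (counit (bvec p)) (bvec b)) (coact X x) = x" if "x \<in> space X" for x
  proof (rule lin_eq_on_keys[where x = x and g = "\<lambda>x. x"])
    let ?c = "lin_ext (\<lambda>(b, p). scale (counit (bvec p)) (bvec b :: 'a \<Rightarrow>\<^sub>0 'b))"
    show "lin (\<lambda>x. ?c (coact X x))"
      by (rule lin_compose[OF \<rho> lin_lin_ext])
    show "lin (\<lambda>x. x)" by (rule lin_id)
    fix b assume "b \<in> Poly_Mapping.keys x"
    then have b: "b \<in> basis X" using that by (auto simp: space_def)
    have *: "?c (tens x (bvec (i, n))) = (if n = 0 then x else 0)" for x i n
    proof (rule lin_eq_on_keys[where f = "\<lambda>x. ?c (tens x (bvec (i, n)))" and g = "\<lambda>x. if n = 0 then x else 0"])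
      show "lin (\<lambda>x. ?c (tens x (bvec (i, n))))" by (rule lin_compose[OF lin_tens_left lin_lin_ext])
      show "lin (\<lambda>x. if n = 0 then x else 0)" by (rule linI) auto
    qed simp
    show "?c (coact X (bvec b)) = bvec b"
      by (simp add: ac[OF b] lin_ext_sum * sum.delta)
  qed
  show ?thesis unfolding comodule_def using fin \<rho> keys coass cou by blast
qed

section \<open>Decomposition into chains\<close>

lemma space_eq_span: "space X = pm.span (bvec ` basis X)"
proof (intro set_eqI iffI)
  fix x assume x: "x \<in> space X"
  have "(\<Sum>b\<in>Poly_Mapping.keys x. scale (Poly_Mapping.lookup x b) (bvec b)) \<in> pm.span (bvec ` basis X)"
    by (intro pm.span_sum pm.span_scale pm.span_base) (use x in \<open>auto simp: space_def\<close>)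
  then show "x \<in> pm.span (bvec ` basis X)" using bvec_expand[of x] by simp
next
  fix x :: "'a \<Rightarrow>\<^sub>0 'b" assume "x \<in> pm.span (bvec ` basis X)"
  then show "x \<in> space X"
  proof (induction rule: pm.span_induct_alt)
    case base
    then show ?case by (simp add: space_def)
  next
    case (step c x y)
    then obtain b where b: "b \<in> basis X" "x = bvec b" by auto
    have "Poly_Mapping.keys (scale c x + y) \<subseteq> Poly_Mapping.keys x \<union> Poly_Mapping.keys y"
      using keys_add[of "scale c x" y] keys_scale[of c x] by blast
    then show ?case using step b by (auto simp: space_def)
  qed
qed

lemma independent_bvec: "pm.independent ((bvec :: 'b \<Rightarrow> 'b \<Rightarrow>\<^sub>0 'k::field) ` B)"
  unfolding pm.independent_explicit_finite_subsets
proof (intro allI impI ballI)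
  fix A :: "('b \<Rightarrow>\<^sub>0 'k) set" and u v
  assume A: "A \<subseteq> bvec ` B" "finite A" and eq: "(\<Sum>v\<in>A. scale (u v) v) = 0" and v: "v \<in> A"
  obtain b where b: "v = bvec b" using v A by auto
  have "0 = Poly_Mapping.lookup (\<Sum>v\<in>A. scale (u v) v) b" by (simp add: eq)
  also have "\<dots> = (\<Sum>w\<in>A. if w = v then u v else 0)"
    unfolding lookup_sum lookup_scale
  proof (rule sum.cong[OF refl])
    fix w assume "w \<in> A"
    then obtain c where "w = bvec c" using A by auto
    moreover have "(bvec c = (bvec b :: _ \<Rightarrow>\<^sub>0 'k)) \<longleftrightarrow> c = b"
      by (metis lookup_single_eq lookup_single_not_eq zero_neq_one)
    ultimately show "u w * Poly_Mapping.lookup w b = (if w = v then u v else 0)"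
      using b by (auto simp: lookup_single when_def)
  qed
  also have "\<dots> = u v" using v A by simp
  finally show "u v = 0" by simp
qed

text \<open>The images of the basis vectors of Y are independent and as many as those of X, so a
  vector outside their span would give too large an independent set. The inverse is taken linear on
  the whole type because \<open>comodule_hom\<close> demands that.\<close>

lemma lin_bij_of_inj_card:
  fixes X :: "('b, 'k::field) precomodule" and Y :: "('c, 'k) precomodule"
  assumes fin: "finite (basis X)" and card: "card (basis X) = card (basis Y)"
    and f: "lin f" "f ` space Y \<subseteq> space X" and inj: "\<And>y. y \<in> space Y \<Longrightarrow> f y = 0 \<Longrightarrow> y = 0"
  obtains g where "lin g" "g ` space X \<subseteq> space Y"
    "\<And>y. y \<in> space Y \<Longrightarrow> g (f y) = y" "\<And>x. x \<in> space X \<Longrightarrow> f (g x) = x"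
proof -
  let ?BX = "(bvec :: 'b \<Rightarrow> 'b \<Rightarrow>\<^sub>0 'k) ` basis X" and ?BY = "(bvec :: 'c \<Rightarrow> 'c \<Rightarrow>\<^sub>0 'k) ` basis Y"
  have sub: "pm.subspace (space Y)" unfolding space_eq_span by (rule pm.subspace_span)
  have inj_f: "inj_on f (space Y)"
  proof (rule inj_onI)
    fix x y assume xy: "x \<in> space Y" "y \<in> space Y" "f x = f y"
    have "x - y = 0"
    proof (rule inj)
      show "x - y \<in> space Y" using sub xy by (simp add: pm.subspace_diff)
      show "f (x - y) = 0" using xy pm_pair.linear_diff[OF f(1)] by simp
    qed
    then show "x = y" by simp
  qed
  have bvec_inj: "inj_on (bvec :: 'd \<Rightarrow> 'd \<Rightarrow>\<^sub>0 'k) A" for A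
    by (rule inj_onI) (metis lookup_single_eq lookup_single_not_eq zero_neq_one)
  have ind: "pm.independent (f ` ?BY)"
    by (rule pm_pair.linear_independent_injective_image[OF f(1) independent_bvec])
       (use inj_f in \<open>simp add: space_eq_span\<close>)
  have "inj_on f ?BY" by (rule inj_on_subset[OF inj_f]) auto
  then have cardF: "card (f ` ?BY) = card (basis X)"
    by (simp add: card_image bvec_inj card)
  have surj: "space X \<subseteq> f ` space Y"
  proof
    fix x assume x: "x \<in> space X"
    have "x \<in> pm.span (f ` ?BY)"
    proof (rule ccontr)
      assume nx: "x \<notin> pm.span (f ` ?BY)"
      then have "pm.independent (insert x (f ` ?BY))" using ind by (rule pm.independent_insertI)
      moreover have "insert x (f ` ?BY) \<subseteq> pm.span ?BX"
        using x f(2) unfolding space_eq_span[symmetric] by auto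
      ultimately have le: "finite (insert x (f ` ?BY)) \<and> card (insert x (f ` ?BY)) \<le> card ?BX"
        by (rule pm.independent_span_bound[OF finite_imageI[OF fin]])
      have "x \<notin> f ` ?BY" using nx pm.span_base[of x "f ` ?BY"] by argo
      then have "card (insert x (f ` ?BY)) = Suc (card (basis X))"
        using le cardF by (subst card_insert_disjoint) auto
      then show False using le by (simp add: card_image bvec_inj)
    qed
    then show "x \<in> f ` space Y"
      by (simp only: pm_pair.linear_span_image[OF f(1), of ?BY] space_eq_span[of Y])
  qed
  obtain g where g: "g ` UNIV \<subseteq> space Y" "lin g" "\<forall>v\<in>space Y. g (f v) = v"
    using pm_pair.linear_exists_left_inverse_on[OF f(1) sub inj_f] by auto
  show thesis
  proof (rule that[of g])
    show "f (g x) = x" if "x \<in> space X" for x using surj that g(3) by force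
  qed (use g in auto)
qed

text \<open>\<open>Y\<close> is the direct sum of the \<open>V i (L i)\<close> for \<open>i \<in> S\<close>.  A set of starting vertices suffices
  because in the theorem no two summands start at the same vertex.\<close>

definition chain_decomp :: "('b, 'k::field) precomodule \<Rightarrow> int set \<Rightarrow> (int \<Rightarrow> nat) \<Rightarrow> bool" where
  "chain_decomp Y S L \<longleftrightarrow> lin (coact Y) \<and> finite S \<and>
     (\<exists>emb. bij_betw emb (SIGMA i:S. {0..L i}) (basis Y) \<and>
        (\<forall>i\<in>S. \<forall>m\<le>L i. coact Y (bvec (emb (i, m))) =
            (\<Sum>j=m..L i. bvec (emb (i, j), (i + int m, j - m)))))"

text \<open>\<open>comodule_iso\<close> asks for comodules on both sides. For Y the graded operator
  is the shift along each chain.\<close>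

lemma comodule_chain_decomp:
  assumes "chain_decomp Y S L"
  shows "comodule Y"
proof -
  obtain emb where lin: "lin (coact Y)" and fin: "finite S"
    and bij: "bij_betw emb (SIGMA i:S. {0..L i}) (basis Y)"
    and ac: "\<And>i m. i \<in> S \<Longrightarrow> m \<le> L i \<Longrightarrow>
       coact Y (bvec (emb (i, m))) = (\<Sum>j=m..L i. bvec (emb (i, j), (i + int m, j - m)))"
    using assms unfolding chain_decomp_def by blast
  define inv where "inv = the_inv_into (SIGMA i:S. {0..L i}) emb"
  define deg where "deg b = (case inv b of (i, m) \<Rightarrow> i + int m)" for b
  define N where "N = lin_ext (\<lambda>b. case inv b of (i, m) \<Rightarrow> if m < L i then bvec (emb (i, Suc m)) else (0 :: 'a \<Rightarrow>\<^sub>0 'b))"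
  have inv: "inv (emb (i, m)) = (i, m)" if "i \<in> S" "m \<le> L i" for i m
    unfolding inv_def using that bij by (intro the_inv_into_f_f) (auto simp: bij_betw_def)
  have basis: "\<exists>i m. i \<in> S \<and> m \<le> L i \<and> b = emb (i, m)" if "b \<in> basis Y" for b
    using that bij by (force simp: bij_betw_def)
  have emb: "emb (i, m) \<in> basis Y" if "i \<in> S" "m \<le> L i" for i m
    using that bij by (auto simp: bij_betw_def)
  have N: "(N ^^ n) (bvec (emb (i, m))) = (if m + n \<le> L i then bvec (emb (i, m + n)) else 0)"
    if "i \<in> S" "m \<le> L i" for i m n
  proof (induction n)
    case (Suc n)
    have "lin N" by (simp add: N_def linear_lin_ext)
    then show ?case using Suc that by (auto simp: N_def inv lin_0[OF linear_lin_ext])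
  qed (use that in auto)
  define K where "K = (\<Sum>i\<in>S. L i)"
  have K: "L i \<le> K" if "i \<in> S" for i
    unfolding K_def using that fin by (intro member_le_sum) auto
  have "graded_rep Y deg N K"
    unfolding graded_rep_def
  proof (intro conjI ballI allI impI)
    show "finite (basis Y)" using bij fin bij_betw_finite by blast
    show "lin (coact Y)" by fact
    show "lin N" by (simp add: N_def linear_lin_ext)
    fix b assume "b \<in> basis Y"
    then obtain i m where b: "i \<in> S" "m \<le> L i" "b = emb (i, m)" using basis by blast
    show "Poly_Mapping.keys (N (bvec b)) \<subseteq> {c \<in> basis Y. deg c = deg b + 1}"
      using N[of i m 1] b by (auto simp: deg_def inv emb)
    show "(N ^^ n) (bvec b) = 0" if "n > K" for n
      using N[of i m n] b that K[of i] by auto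
    have "(\<Sum>n\<le>K. tens ((N ^^ n) (bvec b)) (bvec (deg b, n))) =
       (\<Sum>n\<le>K. if m + n \<le> L i then bvec (emb (i, m + n), (i + int m, n)) else 0)"
      by (rule sum.cong) (use b in \<open>auto simp: N deg_def inv\<close>)
    also have "\<dots> = (\<Sum>n | n \<le> K \<and> m + n \<le> L i. bvec (emb (i, m + n), (i + int m, n)))"
      by (subst sum.inter_filter[symmetric]) auto
    also have "\<dots> = (\<Sum>j=m..L i. bvec (emb (i, j), (i + int m, j - m)))"
      by (rule sum.reindex_bij_witness[where i = "\<lambda>j. j - m" and j = "\<lambda>n. m + n"]) (use b K[of i] in auto)
    finally show "coact Y (bvec b) = (\<Sum>n\<le>K. tens ((N ^^ n) (bvec b)) (bvec (deg b, n)))"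
      using ac b by simp
  qed
  then show ?thesis by (rule comodule_graded_rep)
qed

lemma chain_decomp_iso:
  fixes X :: "('b, 'k::field) precomodule" and Y :: "('c, 'k) precomodule"
  assumes R: "graded_rep X deg N K" and D: "chain_decomp Y S L"
    and w: "\<And>i. i \<in> S \<Longrightarrow> w i \<in> homog X deg i"
    and w0: "\<And>i. i \<in> S \<Longrightarrow> (N ^^ L i) (w i) \<noteq> 0"
    and w1: "\<And>i. i \<in> S \<Longrightarrow> (N ^^ Suc (L i)) (w i) = 0"
    and inj: "inj_on (\<lambda>i. i + int (L i)) S"
    and card: "card (basis X) = (\<Sum>i\<in>S. Suc (L i))"
  shows "X \<cong> Y"
proof -
  obtain emb where lin: "lin (coact Y)" and fin: "finite S"
    and bij: "bij_betw emb (SIGMA i:S. {0..L i}) (basis Y)"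
    and ac: "\<And>i m. i \<in> S \<Longrightarrow> m \<le> L i \<Longrightarrow>
       coact Y (bvec (emb (i, m))) = (\<Sum>j=m..L i. bvec (emb (i, j), (i + int m, j - m)))"
    using D unfolding chain_decomp_def by blast
  have N: "lin N" and finX: "finite (basis X)" using R by (auto simp: graded_rep_def)
  define inv where "inv = the_inv_into (SIGMA i:S. {0..L i}) emb"
  define f where "f = lin_ext (\<lambda>b. case inv b of (i, m) \<Rightarrow> (N ^^ m) (w i))"
  have inv: "inv (emb (i, m)) = (i, m)" if "i \<in> S" "m \<le> L i" for i m
    unfolding inv_def using that bij by (intro the_inv_into_f_f) (auto simp: bij_betw_def)
  have basis: "\<exists>i m. i \<in> S \<and> m \<le> L i \<and> b = emb (i, m)" if "b \<in> basis Y" for b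
    using that bij by (force simp: bij_betw_def)
  have emb: "emb (i, m) \<in> basis Y" if "i \<in> S" "m \<le> L i" for i m
    using that bij by (auto simp: bij_betw_def)
  have f: "lin f" by (simp add: f_def linear_lin_ext)
  have fb: "f (bvec (emb (i, m))) = (N ^^ m) (w i)" if "i \<in> S" "m \<le> L i" for i m
    using that by (simp add: f_def inv)
  have fspace: "f ` space Y \<subseteq> space X"
  proof clarify
    fix y assume y: "y \<in> space Y"
    show "f y \<in> space X" unfolding space_def mem_Collect_eq
    proof (rule keys_lin_subset[OF f])
      fix b assume "b \<in> Poly_Mapping.keys y"
      then obtain i m where b: "i \<in> S" "m \<le> L i" "b = emb (i, m)"
        using basis[of b] y unfolding space_def by blast
      then show "Poly_Mapping.keys (f (bvec b)) \<subseteq> basis X"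
        using homog_funpow[OF R w, of i m] by (auto simp: fb homog_def)
    qed
  qed
  have Z: "(N ^^ n) (w i) = 0" if "i \<in> S" "n > L i" for i n
  proof -
    have "(N ^^ n) (w i) = (N ^^ (n - Suc (L i))) ((N ^^ Suc (L i)) (w i))"
      using that by (subst funpow_add[THEN fun_cong, unfolded o_def, symmetric]) simp
    then show ?thesis using w1[OF that(1)] lin_0[OF lin_funpow[OF N]] by simp
  qed
  have hom: "coact X (f y) = tens_map f id (coact Y y)" if yY: "y \<in> space Y" for y
  proof -
    have \<rho>: "lin (coact X)" using R by (simp add: graded_rep_def)
    show ?thesis
    proof (rule lin_eq_on_keys[OF lin_compose[OF f \<rho>] lin_compose[OF lin lin_tens_map[of f id]]])
      fix b assume "b \<in> Poly_Mapping.keys y"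
      then obtain i m where b: "i \<in> S" "m \<le> L i" "b = emb (i, m)"
        using basis[of b] yY unfolding space_def by blast
      \<comment> \<open>N^(L i) does not kill w i, whereas powers above K kill all of
        \<open>space X\<close>. Hence the bound K cuts off no part of a chain.\<close>
      have KL: "L i \<le> K"
        using funpow_space_zero[OF R homog_subset_space[OF w], of i "L i"] w0[of i] b(1) by force
      have "coact X (f (bvec b)) = (\<Sum>n\<le>K. tens ((N ^^ (n + m)) (w i)) (bvec (i + int m, n)))"
        using b coact_homog[OF R homog_funpow[OF R w, of i m]] by (simp add: fb funpow_add)
      also have "\<dots> = (\<Sum>n | n \<le> K \<and> n + m \<le> L i. tens ((N ^^ (n + m)) (w i)) (bvec (i + int m, n)))"
        by (rule sum.mono_neutral_right) (auto, metis Z[OF b(1)] not_le tens_0(1))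
      also have "\<dots> = (\<Sum>j=m..L i. tens ((N ^^ j) (w i)) (bvec (i + int m, j - m)))"
        by (rule sum.reindex_bij_witness[where i = "\<lambda>j. j - m" and j = "\<lambda>n. n + m"]) (use b KL in auto)
      also have "\<dots> = tens_map f id (coact Y (bvec b))"
        using b by (simp add: ac tens_map_sum fb)
      finally show "coact X (f (bvec b)) = tens_map f id (coact Y (bvec b))" .
    qed
  qed
  have ker: "y = 0" if y: "y \<in> space Y" and fy: "f y = 0" for y
  proof (rule ccontr)
    assume "y \<noteq> 0"
    let ?A = "inv ` Poly_Mapping.keys y"
    have ky: "\<exists>i m. i \<in> S \<and> m \<le> L i \<and> b = emb (i, m)" if "b \<in> Poly_Mapping.keys y" for b
      using basis[of b] y that unfolding space_def by blast
    have "finite ?A" "?A \<noteq> {}" using \<open>y \<noteq> 0\<close> by auto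
    \<comment> \<open>Among the basis vectors in the support of y, p is one farthest from the end of
      its chain. N^?h moves it to that end, kills the vectors that are nearer to theirs, and sends
      equally distant ones to ends in other degrees. The coordinate c therefore sees p
      alone.\<close>
    then have "Max ((\<lambda>p. L (fst p) - snd p) ` ?A) \<in> (\<lambda>p. L (fst p) - snd p) ` ?A" by (intro Max_in) auto
    then obtain p where p: "p \<in> ?A" "Max ((\<lambda>p. L (fst p) - snd p) ` ?A) = L (fst p) - snd p" by blast
    have pmax: "L (fst p') - snd p' \<le> L (fst p) - snd p" if "p' \<in> ?A" for p'
      unfolding p(2)[symmetric] using that \<open>finite ?A\<close> by (intro Max_ge) auto
    obtain b0 where b0: "b0 \<in> Poly_Mapping.keys y" "p = inv b0" using p by auto
    obtain i m where im: "i \<in> S" "m \<le> L i" "b0 = emb (i, m)" using ky[OF b0(1)] by blast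
    have pim: "p = (i, m)" using b0 im inv by simp
    let ?h = "L i - m"
    obtain c where c: "c \<in> Poly_Mapping.keys ((N ^^ L i) (w i))" using w0[OF im(1)] by fastforce
    have degc: "deg c = i + int (L i)"
      using c homog_funpow[OF R w[OF im(1)], of "L i"] by (auto simp: homog_def)
    have "0 = Poly_Mapping.lookup ((N ^^ ?h) (f y)) c" by (simp add: fy lin_0[OF lin_funpow[OF N]])
    also have "\<dots> = (\<Sum>b\<in>Poly_Mapping.keys y. Poly_Mapping.lookup y b * Poly_Mapping.lookup ((N ^^ ?h) (f (bvec b))) c)"
      by (subst lin_expand[OF lin_compose[OF f lin_funpow[OF N]]]) (simp add: lookup_sum)
    also have "\<dots> = (\<Sum>b\<in>Poly_Mapping.keys y. if b = b0 then
        Poly_Mapping.lookup y b0 * Poly_Mapping.lookup ((N ^^ L i) (w i)) c else 0)"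
    proof (rule sum.cong[OF refl])
      fix b assume b: "b \<in> Poly_Mapping.keys y"
      obtain i' m' where im': "i' \<in> S" "m' \<le> L i'" "b = emb (i', m')" using ky[OF b] by blast
      have Nb: "(N ^^ ?h) (f (bvec b)) = (N ^^ (?h + m')) (w i')"
        using im' by (simp add: fb funpow_add)
      have le: "L i' - m' \<le> ?h" using pmax[OF imageI[OF b]] im' pim by (simp add: inv)
      show "Poly_Mapping.lookup y b * Poly_Mapping.lookup ((N ^^ ?h) (f (bvec b))) c =
        (if b = b0 then Poly_Mapping.lookup y b0 * Poly_Mapping.lookup ((N ^^ L i) (w i)) c else 0)"
      proof (cases "b = b0")
        case True
        then have "(i', m') = (i, m)" using im im' inv by metis
        then show ?thesis using Nb True im by simp
      next
        case False
        have "Poly_Mapping.lookup ((N ^^ (?h + m')) (w i')) c = 0"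
        proof (cases "?h + m' > L i'")
          case True
          then show ?thesis using Z[OF im'(1) True] by simp
        next
          case F: False
          then have eq: "?h + m' = L i'" using le by simp
          have "i' \<noteq> i"
          proof
            assume "i' = i"
            moreover from this have "m' = m" using eq im(2) by simp
            ultimately show False using False im(3) im'(3) by simp
          qed
          then have "i' + int (L i') \<noteq> i + int (L i)" using inj im im' by (auto simp: inj_on_def)
          moreover have "(N ^^ L i') (w i') \<in> homog X deg (i' + int (L i'))"
            by (rule homog_funpow[OF R w[OF im'(1)]])
          ultimately show ?thesis unfolding eq using degc by (auto simp: homog_def in_keys_iff)
        qed
        then show ?thesis using Nb False by simp
      qed
    qed
    also have "\<dots> = Poly_Mapping.lookup y b0 * Poly_Mapping.lookup ((N ^^ L i) (w i)) c"
      using b0 by simp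
    finally show False using b0(1) c by (simp add: in_keys_iff)
  qed
  have cardY: "card (basis X) = card (basis Y)"
    using bij_betw_same_card[OF bij] fin card by (simp add: card_SigmaI)
  obtain g where g: "lin g" "g ` space X \<subseteq> space Y"
    "\<And>y. y \<in> space Y \<Longrightarrow> g (f y) = y" "\<And>x. x \<in> space X \<Longrightarrow> f (g x) = x"
    using lin_bij_of_inj_card[OF finX cardY f fspace ker] by blast
  have comY: "comodule Y" by (rule comodule_chain_decomp[OF D])
  have homf: "comodule_hom Y X f" unfolding comodule_hom_def using f fspace hom by blast
  have homg: "comodule_hom X Y g"
    unfolding comodule_hom_def
  proof (intro conjI ballI)
    fix x assume x: "x \<in> space X"
    let ?y = "g x"
    have y: "?y \<in> space Y" using g x by auto
    \<comment> \<open>The equation for g is that of f with g \<otimes> id applied. As g undoes f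
      only on \<open>space Y\<close>, it matters that the coaction of Y stays over
      \<open>basis Y\<close>.\<close>
    have "tens_map g id (coact X x) = tens_map g id (tens_map f id (coact Y ?y))"
      using hom[OF y] g(4)[OF x] by simp
    also have "\<dots> = tens_map (\<lambda>x. g (f x)) (\<lambda>x. id (id x)) (coact Y ?y)"
      by (rule tens_map_compose[OF g(1) lin_id'])
    also have "\<dots> = coact Y ?y"
    proof (rule lin_eq_on_keys[OF lin_tens_map lin_id])
      fix c assume "c \<in> Poly_Mapping.keys (coact Y ?y)"
      then have "c \<in> basis Y \<times> UNIV" using comY y unfolding comodule_def by blast
      then show "tens_map (\<lambda>x. g (f x)) (\<lambda>x. id (id x)) (bvec c) = bvec c"
        by (cases c) (simp add: g(3))
    qed
    finally show "coact Y ?y = tens_map g id (coact X x)" by simp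
  qed (use g in auto)
  show ?thesis
    unfolding comodule_iso_def
    using comodule_graded_rep[OF R] comY homf homg g(3,4) by blast
qed

section \<open>Chain decompositions of direct sums\<close>

lemma chain_decomp_V: "L i = l \<Longrightarrow> chain_decomp (V i l) {i} L"
  unfolding chain_decomp_def
proof (intro conjI exI[of _ snd])
  assume l: "L i = l"
  show "lin (coact (V i l))" by (simp add: V_def linear_lin_ext)
  show "bij_betw snd (SIGMA i:{i}. {0..L i}) (basis (V i l))"
    by (auto simp: V_def bij_betw_def inj_on_def l image_def)
qed (auto simp: coact_V_bvec)

lemma chain_decomp_dsum:
  assumes I: "finite I" and D: "\<And>i. i \<in> I \<Longrightarrow> chain_decomp (X i) (T i) L"
    and disj: "\<And>i j. i \<in> I \<Longrightarrow> j \<in> I \<Longrightarrow> i \<noteq> j \<Longrightarrow> T i \<inter> T j = {}"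
  shows "chain_decomp (dsum I X) (\<Union>i\<in>I. T i) L"
proof -
  have "\<forall>i\<in>I. \<exists>emb. bij_betw emb (SIGMA s:T i. {0..L s}) (basis (X i)) \<and>
    (\<forall>s\<in>T i. \<forall>m\<le>L s. coact (X i) (bvec (emb (s, m))) = (\<Sum>j=m..L s. bvec (emb (s, j), (s + int m, j - m))))"
    using D unfolding chain_decomp_def by blast
  from bchoice[OF this] obtain emb where bij: "\<And>i. i \<in> I \<Longrightarrow> bij_betw (emb i) (SIGMA s:T i. {0..L s}) (basis (X i))"
    and ac: "\<And>i s m. i \<in> I \<Longrightarrow> s \<in> T i \<Longrightarrow> m \<le> L s \<Longrightarrow>
      coact (X i) (bvec (emb i (s, m))) = (\<Sum>j=m..L s. bvec (emb i (s, j), (s + int m, j - m)))"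
    by blast
  \<comment> \<open>The sets T i are disjoint, so a starting vertex determines the summand that
    contains its chain.\<close>
  define ix where "ix s = (THE i. i \<in> I \<and> s \<in> T i)" for s
  have ix: "ix s = i" if "i \<in> I" "s \<in> T i" for i s
    unfolding ix_def using that disj by blast
  have "bij_betw (\<lambda>(s, m). (ix s, emb (ix s) (s, m))) (SIGMA s:(\<Union>i\<in>I. T i). {0..L s}) (SIGMA i:I. basis (X i))"
    unfolding bij_betw_def
  proof
    show "inj_on (\<lambda>(s, m). (ix s, emb (ix s) (s, m))) (SIGMA s:(\<Union>i\<in>I. T i). {0..L s})"
    proof (rule inj_onI)
      fix p p' assume p: "p \<in> (SIGMA s:(\<Union>i\<in>I. T i). {0..L s})" "p' \<in> (SIGMA s:(\<Union>i\<in>I. T i). {0..L s})"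
        and eq: "(\<lambda>(s, m). (ix s, emb (ix s) (s, m))) p = (\<lambda>(s, m). (ix s, emb (ix s) (s, m))) p'"
      from p(1) obtain i where i: "i \<in> I" "p \<in> (SIGMA s:T i. {0..L s})" by auto
      from p(2) obtain i' where i': "i' \<in> I" "p' \<in> (SIGMA s:T i'. {0..L s})" by auto
      have "ix (fst p) = i" "ix (fst p') = i'" using i i' by (auto intro: ix)
      then have "i = i'" "emb i p = emb i p'" using eq by (auto simp: case_prod_beta)
      then show "p = p'" using bij[OF i(1)] i i' by (auto simp: bij_betw_def dest: inj_onD)
    qed
    show "(\<lambda>(s, m). (ix s, emb (ix s) (s, m))) ` (SIGMA s:(\<Union>i\<in>I. T i). {0..L s}) = (SIGMA i:I. basis (X i))"
    proof (intro equalityI subsetI)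
      fix p assume "p \<in> (\<lambda>(s, m). (ix s, emb (ix s) (s, m))) ` (SIGMA s:(\<Union>i\<in>I. T i). {0..L s})"
      then obtain i s m where "i \<in> I" "s \<in> T i" "m \<le> L s" "p = (i, emb i (s, m))" by (auto simp: ix)
      then show "p \<in> (SIGMA i:I. basis (X i))" using bij[of i] by (auto simp: bij_betw_def)
    next
      fix p assume "p \<in> (SIGMA i:I. basis (X i))"
      then obtain i b where p: "p = (i, b)" "i \<in> I" "b \<in> basis (X i)" by auto
      then obtain s m where sm: "s \<in> T i" "m \<le> L s" "b = emb i (s, m)"
        using bij[of i] by (force simp: bij_betw_def)
      then have "p = (\<lambda>(s, m). (ix s, emb (ix s) (s, m))) (s, m)" using p by (simp add: ix)
      then show "p \<in> (\<lambda>(s, m). (ix s, emb (ix s) (s, m))) ` (SIGMA s:(\<Union>i\<in>I. T i). {0..L s})"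
        by (rule image_eqI) (use sm p in auto)
    qed
  qed
  moreover have "coact (dsum I X) (bvec (ix s, emb (ix s) (s, m))) =
      (\<Sum>j=m..L s. bvec ((ix s, emb (ix s) (s, j)), (s + int m, j - m)))"
    if "s \<in> (\<Union>i\<in>I. T i)" "m \<le> L s" for s m
  proof -
    obtain i where "i \<in> I" "s \<in> T i" using \<open>s \<in> (\<Union>i\<in>I. T i)\<close> by blast
    then show ?thesis using that(2) ix[of i s]
      by (simp add: dsum_def ac tens_map_sum basis_map_def)
  qed
  moreover have "finite (\<Union>i\<in>I. T i)" using I D by (auto simp: chain_decomp_def)
  ultimately show ?thesis
    unfolding chain_decomp_def
    by (intro conjI exI[of _ "\<lambda>(s, m). (ix s, emb (ix s) (s, m))"]) (auto simp: dsum_def linear_lin_ext)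
qed

lemma chain_decomp_sum:
  assumes X: "chain_decomp X S L" and Y: "chain_decomp Y T L" and disj: "S \<inter> T = {}"
  shows "chain_decomp (X \<oplus> Y) (S \<union> T) L"
proof -
  obtain e1 where 1: "finite S" "bij_betw e1 (SIGMA i:S. {0..L i}) (basis X)"
    "\<And>i m. i \<in> S \<Longrightarrow> m \<le> L i \<Longrightarrow>
       coact X (bvec (e1 (i, m))) = (\<Sum>j=m..L i. bvec (e1 (i, j), (i + int m, j - m)))"
    using X unfolding chain_decomp_def by blast
  obtain e2 where 2: "finite T" "bij_betw e2 (SIGMA i:T. {0..L i}) (basis Y)"
    "\<And>i m. i \<in> T \<Longrightarrow> m \<le> L i \<Longrightarrow>
       coact Y (bvec (e2 (i, m))) = (\<Sum>j=m..L i. bvec (e2 (i, j), (i + int m, j - m)))"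
    using Y unfolding chain_decomp_def by blast
  define e where "e p = (if fst p \<in> S then Inl (e1 p) else Inr (e2 p))" for p
  have e: "e (i, m) = Inl (e1 (i, m))" if "i \<in> S" for i m using that by (simp add: e_def)
  have e': "e (i, m) = Inr (e2 (i, m))" if "i \<in> T" for i m using that disj by (auto simp: e_def)
  have "bij_betw (\<lambda>p. Inl (e1 p)) (SIGMA i:S. {0..L i}) (Inl ` basis X)"
    using bij_betw_trans[OF 1(2), of Inl "Inl ` basis X"] by (simp add: o_def inj_on_imp_bij_betw)
  then have b1: "bij_betw e (SIGMA i:S. {0..L i}) (Inl ` basis X)"
    by (rule bij_betw_cong[THEN iffD2, rotated]) (auto simp: e)
  have "bij_betw (\<lambda>p. Inr (e2 p)) (SIGMA i:T. {0..L i}) (Inr ` basis Y)"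
    using bij_betw_trans[OF 2(2), of Inr "Inr ` basis Y"] by (simp add: o_def inj_on_imp_bij_betw)
  then have b2: "bij_betw e (SIGMA i:T. {0..L i}) (Inr ` basis Y)"
    by (rule bij_betw_cong[THEN iffD2, rotated]) (auto simp: e')
  have "bij_betw e ((SIGMA i:S. {0..L i}) \<union> (SIGMA i:T. {0..L i})) (Inl ` basis X \<union> Inr ` basis Y)"
    by (rule bij_betw_combine[OF b1 b2]) auto
  moreover have "(SIGMA i:S. {0..L i}) \<union> (SIGMA i:T. {0..L i}) = (SIGMA i:S \<union> T. {0..L i})" by auto
  ultimately have bij: "bij_betw e (SIGMA i:S \<union> T. {0..L i}) (basis (X \<oplus> Y))"
    by (simp add: sum_comodule_def Plus_def)
  have ac: "coact (X \<oplus> Y) (bvec (e (i, m))) = (\<Sum>j=m..L i. bvec (e (i, j), (i + int m, j - m)))"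
    if "i \<in> S \<union> T" "m \<le> L i" for i m
    using that 1(3) 2(3) by (auto simp: e e' sum_comodule_def tens_map_sum basis_map_def)
  show ?thesis unfolding chain_decomp_def
    using bij ac 1(1) 2(1) by (auto simp: sum_comodule_def linear_lin_ext intro!: exI[of _ e])
qed

text \<open>Half-open intervals let consecutive summands fit together even when one of them is
  empty, with x = y or y = z.\<close>

lemma chain_decomp_sum_ivl:
  assumes "chain_decomp X {x..<y} L" "chain_decomp Y {y..<z} L" "x \<le> y" "y \<le> z"
  shows "chain_decomp (X \<oplus> Y) {x..<z} L"
  using chain_decomp_sum[OF assms(1,2)] assms(3,4) by (simp add: ivl_disj_un_two(3))

lemma chain_decomp_dsum_V:
  assumes "\<And>i. p \<le> i \<Longrightarrow> i \<le> r \<Longrightarrow> l i = L (c + i)" "x = c + p" "y = c + r + 1"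
  shows "chain_decomp (dsum {p..r} (\<lambda>i. V (c + i) (l i))) {x..<y} L"
proof -
  have "chain_decomp (dsum {p..r} (\<lambda>i. V (c + i) (l i))) (\<Union>i\<in>{p..r}. {c + i}) L"
    by (rule chain_decomp_dsum) (use assms(1) in \<open>auto intro: chain_decomp_V\<close>)
  moreover have "(\<Union>i\<in>{p..r}. {c + i}) = {x..<y}"
  proof -
    have "(\<Union>i\<in>{p..r}. {c + i}) = (+) c ` {p..r}" by (rule UNION_singleton_eq_range)
    also have "\<dots> = {c + p..c + r}" by (simp add: add.commute)
    finally show ?thesis by (auto simp: assms(2,3))
  qed
  ultimately show ?thesis by simp
qed

lemma chain_decomp_dsum_blocks:
  fixes d :: int
  assumes d: "d > 0" and D: "\<And>k. 0 \<le> k \<Longrightarrow> k < e \<Longrightarrow> chain_decomp (X k) {k*d..<k*d + d} L"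
  shows "chain_decomp (dsum {0..e-1} X) {0..<e*d} L"
proof -
  have div: "s div d = k" if "s \<in> {k*d..<k*d + d}" for s k :: int
  proof -
    have "s div d = (s - k * d + k * d) div d" by simp
    also have "\<dots> = k + (s - k * d) div d" using d by (intro div_mult_self1) simp
    also have "(s - k * d) div d = 0" using that by (intro div_pos_pos_trivial) auto
    finally show ?thesis by simp
  qed
  have "(\<Union>k\<in>{0..e-1}. {k*d..<k*d + d}) = {0..<e*d}"
  proof (intro equalityI subsetI)
    fix s assume "s \<in> (\<Union>k\<in>{0..e-1}. {k*d..<k*d + d})"
    then obtain k where k: "0 \<le> k" "k + 1 \<le> e" "k * d \<le> s" "s < k * d + d" by auto
    have "(k + 1) * d \<le> e * d" "0 \<le> k * d" using k d by auto
    then show "s \<in> {0..<e*d}" using k(3,4) by (simp add: algebra_simps)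
  next
    fix s assume s: "s \<in> {0..<e*d}"
    have m: "s = s div d * d + s mod d" "0 \<le> s mod d" "s mod d < d" using d by auto
    have "s < e * d" using s by auto
    then have "s div d * d < e * d" using m by linarith
    then have "s div d < e" by (rule mult_right_less_imp_less) (use d in auto)
    moreover have "0 \<le> s div d" using s d by (simp add: pos_imp_zdiv_nonneg_iff)
    moreover have "s div d * d \<le> s" "s < s div d * d + d" using m by linarith+
    ultimately show "s \<in> (\<Union>k\<in>{0..e-1}. {k*d..<k*d + d})"
      by (intro UN_I[of "s div d"]) auto
  qed
  moreover have "chain_decomp (dsum {0..e-1} X) (\<Union>k\<in>{0..e-1}. {k*d..<k*d + d}) L"
  proof (rule chain_decomp_dsum)
    show "{i*d..<i*d + d} \<inter> {j*d..<j*d + d} = {}" if "i \<noteq> j" for i j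
      using div[of _ i] div[of _ j] that by (metis disjoint_iff)
  qed (use D in auto)
  ultimately show ?thesis by simp
qed

section \<open>Gaussian binomial polynomials\<close>

abbreviation qX :: "'k::field poly" where "qX \<equiv> [:0, 1:]"

text \<open>Kept as a polynomial, not as its value, so that its order of vanishing at a root of
  unity can be measured. The value 0 for r > n lets the q-Pascal rule hold without side
  conditions.\<close>

definition gauss :: "nat \<Rightarrow> nat \<Rightarrow> 'k::field poly" where
  "gauss n r = (if r \<le> n then qfact qX n div (qfact qX r * qfact qX (n - r)) else 0)"

lemma qbinom_gauss: "qbinom q l m = poly (gauss (l + m) l) q"
  by (simp add: qbinom_def gauss_def Let_def)

lemma qint_qX_nonzero: "n > 0 \<Longrightarrow> qint qX n \<noteq> (0 :: 'k::field poly)"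
proof -
  assume "n > 0"
  then have "poly (qint qX n :: 'k poly) 0 = 1"
    by (cases n) (simp_all add: qint_def poly_sum sum.lessThan_Suc_shift power_0_left)
  then show ?thesis by auto
qed

lemma qfact_qX_nonzero: "qfact qX n \<noteq> (0 :: 'k::field poly)"
  by (auto simp: qfact_def qint_qX_nonzero)

lemma gauss_mult:
  assumes "r \<le> n"
  shows "gauss n r * (qfact qX r * qfact qX (n - r)) = (qfact qX n :: 'k::field poly)"
proof -
  have "qfact qX r * qfact qX (n - r) dvd (qfact qX n :: 'k poly)"
    using qfact_mult_dvd[of "qX :: 'k poly" r "n - r"] assms by simp
  then show ?thesis using assms by (simp add: gauss_def)
qed

lemma gauss_eqI:
  assumes "r \<le> n" "p * (qfact qX r * qfact qX (n - r)) = (qfact qX n :: 'k::field poly)"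
  shows "gauss n r = p"
  using assms gauss_mult[OF assms(1), where 'k='k] qfact_qX_nonzero[where 'k='k]
  by (metis mult_cancel_right mult_eq_0_iff)

lemma gauss_0 [simp]: "gauss n 0 = 1"
  by (rule gauss_eqI) (auto simp: qfact_def)

lemma gauss_self [simp]: "gauss n n = 1"
  by (rule gauss_eqI) (auto simp: qfact_def)

lemma gauss_eq_0 [simp]: "n < r \<Longrightarrow> gauss n r = 0"
  by (simp add: gauss_def)

lemma gauss_symmetric: "r \<le> n \<Longrightarrow> gauss n (n - r) = gauss n r"
  by (rule gauss_eqI) (use gauss_mult[of r n] in \<open>auto simp: mult_ac\<close>)

text \<open>The first q-Pascal rule: the last factor of the q-factorial of n + 1 is split by
  \<open>qint_add\<close> according to n + 1 = (r + 1) + (n - r).\<close>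

lemma gauss_Suc_Suc: "gauss (Suc n) (Suc r) = gauss n r + qX ^ Suc r * (gauss n (Suc r) :: 'k::field poly)"
proof -
  consider "r < n" | "r = n" | "r > n" by linarith
  then show ?thesis
  proof cases
    case 1
    define m where "m = n - Suc r"
    then have m: "n - r = Suc m" "n - Suc r = m" using 1 by auto
    have aux: "F * b + x * d * F = (g + x * g') * ((a * b) * (c * d))"
      if "g * (a * (c * d)) = F" "g' * ((a * b) * c) = F" for F a b c d g g' x :: "'k poly"
    proof -
      have "F * b + x * d * F = g * (a * (c * d)) * b + x * d * (g' * ((a * b) * c))" by (simp only: that)
      also have "\<dots> = (g + x * g') * ((a * b) * (c * d))" by (simp only: distrib_right distrib_left mult_ac)
      finally show ?thesis .
    qed
    show ?thesis
    proof (rule gauss_eqI)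
      have 1: "gauss n r * (qfact qX r * (qfact qX m * qint qX (Suc m))) = (qfact qX n :: 'k poly)"
        using gauss_mult[of r n, where 'k='k] 1 m by (simp add: qfact_Suc)
      have 2: "gauss n (Suc r) * ((qfact qX r * qint qX (Suc r)) * qfact qX m) = (qfact qX n :: 'k poly)"
        using gauss_mult[of "Suc r" n, where 'k='k] \<open>r < n\<close> m by (simp add: qfact_Suc)
      have n: "Suc n = Suc r + Suc m" using m by simp
      have "(qint qX (Suc n) :: 'k poly) = qint qX (Suc r) + qX ^ Suc r * qint qX (Suc m)"
        by (simp only: n qint_add)
      then have "(qfact qX (Suc n) :: 'k poly) = qfact qX n * (qint qX (Suc r) + qX ^ Suc r * qint qX (Suc m))"
        by (simp only: qfact_Suc)
      also have "\<dots> = qfact qX n * qint qX (Suc r) + qX ^ Suc r * qint qX (Suc m) * qfact qX n"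
        by (simp only: distrib_left mult_ac)
      also have "\<dots> = (gauss n r + qX ^ Suc r * gauss n (Suc r)) *
          ((qfact qX r * qint qX (Suc r)) * (qfact qX m * qint qX (Suc m)))"
        by (rule aux[OF 1 2])
      finally show "(gauss n r + qX ^ Suc r * gauss n (Suc r)) * (qfact qX (Suc r) * qfact qX (Suc n - Suc r))
          = (qfact qX (Suc n) :: 'k poly)"
        using m by (simp only: qfact_Suc diff_Suc_Suc)
    qed (use 1 in simp)
  qed auto
qed

text \<open>The first q-Pascal rule at the complementary index n - r, carried back by
  symmetry.\<close>

lemma gauss_Suc_Suc': "r \<le> n \<Longrightarrow> gauss (Suc n) (Suc r) = qX ^ (n - r) * gauss n r + (gauss n (Suc r) :: 'k::field poly)"
proof (cases "r = n")
  case False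
  assume "r \<le> n"
  then obtain m where m: "n = Suc (r + m)" using False less_iff_Suc_add by (metis le_neq_implies_less)
  have "gauss (Suc n) (Suc m) = (gauss (Suc n) (Suc r) :: 'k poly)"
    using gauss_symmetric[of "Suc r" "Suc n"] m by simp
  then have "gauss (Suc n) (Suc r) = (gauss (Suc n) (Suc m) :: 'k poly)" by (rule sym)
  also have "\<dots> = gauss n m + qX ^ Suc m * gauss n (Suc m)" by (rule gauss_Suc_Suc)
  also have "gauss n m = (gauss n (Suc r) :: 'k poly)"
    using gauss_symmetric[of "Suc r" n] m by simp
  also have "gauss n (Suc m) = (gauss n r :: 'k poly)"
    using gauss_symmetric[of r n] m by (simp add: Suc_diff_le)
  finally show ?thesis using m by (simp add: Suc_diff_le)
qed auto

section \<open>The q-binomial theorem and q-differences\<close>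

lemma choose_two_Suc: "Suc r choose 2 = r + (r choose 2)"
  by (simp add: numeral_2_eq_2)

text \<open>The second q-Pascal rule splits the sum in two. Because t^r t^(n - r) = t^n, one part is
  t^n times the previous case and the other is y times it, which gives the new factor y -
  t^n.\<close>

lemma q_binomial_theorem:
  fixes t y :: "'k::field"
  shows "(\<Prod>i<n. y - t ^ i) = (\<Sum>r\<le>n. (-1) ^ r * t ^ (r choose 2) * poly (gauss n r) t * y ^ (n - r))"
proof (induction n)
  case (Suc n)
  let ?G = "\<lambda>n r. poly (gauss n r) t"
  let ?c = "\<lambda>r. (-1) ^ r * t ^ (r choose 2)"
  have "(\<Sum>r\<le>Suc n. ?c r * ?G (Suc n) r * y ^ (Suc n - r)) =
     y ^ Suc n + (\<Sum>r\<le>n. ?c (Suc r) * ?G (Suc n) (Suc r) * y ^ (n - r))"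
    by (subst sum.atMost_Suc_shift) (simp add: numeral_2_eq_2)
  also have "(\<Sum>r\<le>n. ?c (Suc r) * ?G (Suc n) (Suc r) * y ^ (n - r)) =
     (\<Sum>r\<le>n. ?c (Suc r) * ?G n (Suc r) * y ^ (n - r)) - (\<Sum>r\<le>n. t ^ n * (?c r * ?G n r * y ^ (n - r)))"
    unfolding sum_subtractf[symmetric]
  proof (rule sum.cong[OF refl])
    fix r assume "r \<in> {..n}"
    then have r: "r \<le> n" by simp
    have "t ^ n = t ^ r * t ^ (n - r)" using r by (simp flip: power_add)
    then show "?c (Suc r) * ?G (Suc n) (Suc r) * y ^ (n - r) =
      ?c (Suc r) * ?G n (Suc r) * y ^ (n - r) - t ^ n * (?c r * ?G n r * y ^ (n - r))"
      using r by (simp add: gauss_Suc_Suc' choose_two_Suc power_add algebra_simps)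
  qed
  also have "(\<Sum>r\<le>n. ?c (Suc r) * ?G n (Suc r) * y ^ (n - r)) =
     (\<Sum>r\<le>Suc n. ?c r * ?G n r * y ^ (Suc n - r)) - y ^ Suc n"
    by (subst sum.atMost_Suc_shift) (simp add: numeral_2_eq_2)
  also have "(\<Sum>r\<le>Suc n. ?c r * ?G n r * y ^ (Suc n - r)) = (\<Sum>r\<le>n. y * (?c r * ?G n r * y ^ (n - r)))"
    by (simp add: Suc_diff_le mult_ac)
  finally show ?case
    by (simp add: Suc.IH sum_distrib_left[symmetric] algebra_simps)
qed (simp add: numeral_2_eq_2)

text \<open>For P = y^k the sum is the product of the t^k - t^i over i < n, and the factor i = k is
  zero. By linearity the n-th q-difference kills all polynomials of degree below n.\<close>

lemma q_difference_poly:
  fixes t :: "'k::field"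
  assumes "degree P < n \<or> P = 0"
  shows "(\<Sum>r\<le>n. (-1) ^ r * t ^ (r choose 2) * poly (gauss n r) t * poly P (t ^ (n - r))) = 0"
proof (cases "P = 0")
  case False
  then have deg: "degree P < n" using assms by simp
  let ?c = "\<lambda>r. (-1) ^ r * t ^ (r choose 2) * poly (gauss n r) t"
  have "(\<Sum>r\<le>n. ?c r * poly P (t ^ (n - r))) = (\<Sum>r\<le>n. \<Sum>k\<le>degree P. coeff P k * (?c r * (t ^ k) ^ (n - r)))"
    by (simp add: poly_altdef[of P] sum_distrib_left mult_ac flip: power_mult)
  also have "\<dots> = (\<Sum>k\<le>degree P. coeff P k * (\<Prod>i<n. t ^ k - t ^ i))"
    by (subst sum.swap) (simp add: q_binomial_theorem sum_distrib_left)
  also have "\<dots> = 0"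
    by (rule sum.neutral) (use deg in \<open>auto intro!: bexI\<close>)
  finally show ?thesis .
qed simp

text \<open>The q-Pochhammer symbol (t; t)_n, that is, the q-factorial with the denominators 1 - t
  cleared.\<close>

definition qpoch :: "'k::field \<Rightarrow> nat \<Rightarrow> 'k" where
  "qpoch t n = (\<Prod>j=1..n. 1 - t ^ j)"

lemma qfact_qpoch: "poly (qfact qX n) t * (1 - t) ^ n = qpoch t n"
proof (induction n)
  case (Suc n)
  have "poly (qint qX (Suc n)) t * (1 - t) = 1 - t ^ Suc n"
    unfolding qint_def using one_diff_power_eq[of t "Suc n"] by (simp add: poly_sum mult.commute)
  moreover have "poly (qfact qX (Suc n)) t * (1 - t) ^ Suc n =
      (poly (qfact qX n) t * (1 - t) ^ n) * (poly (qint qX (Suc n)) t * (1 - t))"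
    by (simp only: qfact_Suc poly_mult power_Suc mult_ac)
  ultimately show ?case using Suc by (simp add: qpoch_def)
qed (simp add: qfact_def qpoch_def)

lemma gauss_qpoch:
  assumes "r \<le> n"
  shows "poly (gauss n r) t * (qpoch t r * qpoch t (n - r)) = qpoch t n"
proof -
  have "(1 - t) ^ n = (1 - t) ^ r * (1 - t) ^ (n - r)" using assms by (simp flip: power_add)
  then have "poly (gauss n r) t * (qpoch t r * qpoch t (n - r)) =
     poly (gauss n r * (qfact qX r * qfact qX (n - r))) t * (1 - t) ^ n"
    by (simp only: poly_mult mult_ac qfact_qpoch[symmetric])
  also have "\<dots> = qpoch t n" by (simp only: gauss_mult[OF assms] qfact_qpoch)
  finally show ?thesis .
qed

locale generic_parameter =
  fixes t :: "'k::field"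
  assumes nz: "t \<noteq> 0" and no_root: "\<And>n. n > 0 \<Longrightarrow> t ^ n \<noteq> 1"
begin

lemma qpoch_nonzero: "qpoch t n \<noteq> 0"
  using no_root by (auto simp: qpoch_def)

text \<open>For s \<ge> 0 the product is (t; t)_(b+s) / (t; t)_s; for -b \<le> s < 0 its factor j =
  -s is zero. So a polynomial in t^s extends the Gaussian binomial by zero to some negative
  s.\<close>

lemma prod_shift_eq_gauss:
  fixes s :: int
  assumes "s \<ge> - int b"
  shows "(\<Prod>j=1..b. 1 - t powi (s + int j)) = (if s \<ge> 0 then poly (gauss (b + nat s) b) t * qpoch t b else 0)"
proof (cases "s \<ge> 0")
  case True
  then obtain u where u: "s = int u" by (metis nonneg_int_cases)
  have "qpoch t u * (\<Prod>j=1..b. 1 - t ^ (u + j)) = qpoch t (b + u)"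
  proof (induction b)
    case (Suc b)
    then show ?case by (simp add: qpoch_def mult.assoc[symmetric] add_ac)
  qed (simp add: qpoch_def)
  then have "qpoch t u * (\<Prod>j=1..b. 1 - t ^ (u + j)) = qpoch t u * (poly (gauss (b + u) b) t * qpoch t b)"
    using gauss_qpoch[of b "b + u" t] by (simp add: mult_ac)
  then have "(\<Prod>j=1..b. 1 - t ^ (u + j)) = poly (gauss (b + u) b) t * qpoch t b"
    using qpoch_nonzero by simp
  moreover have "t powi (s + int j) = t ^ (u + j)" for j
    by (simp add: u power_int_def nat_add_distrib)
  ultimately show ?thesis using u by simp
next
  case False
  then have "nat (-s) \<in> {1..b}" using assms by auto
  moreover have "1 - t powi (s + int (nat (-s))) = 0" using False by simp
  ultimately have "(\<Prod>j=1..b. 1 - t powi (s + int j)) = 0"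
    by (meson finite_atLeastAtMost prod_zero)
  then show ?thesis using False by simp
qed

end

section \<open>Primitive vectors in the quantum plane\<close>

text \<open>The binomial coefficient "s choose 2" for every integer s, since the extended
  convolution reaches negative s.\<close>

definition tri :: "int \<Rightarrow> int" where "tri s = s * (s - 1) div 2"

lemma tri_double: "2 * tri s = s * (s - 1)"
  by (simp add: tri_def)

lemma tri_nat: "tri (int n) = int (n choose 2)"
proof -
  have "int (n choose 2) * 2 = int n * (int n - 1)"
    by (induction n) (auto simp: choose_two_Suc numeral_2_eq_2 algebra_simps)
  then show ?thesis using tri_double[of "int n"] by simp
qed

text \<open>The coefficients at \<open>u_s \<otimes> v_{i-s}\<close> of the vector of degree \<open>i\<close> in \<open>V(0, \<alpha>+i) \<otimes> V(0, \<beta>+i)\<close>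
  that is killed by the quantum \<open>sl_2\<close> lowering operator.  For generic \<open>q\<close> it is the highest weight
  vector of a Clebsch--Gordan summand; the power of \<open>q\<close> is shifted to make the exponents natural
  numbers.\<close>

definition prim_poly :: "nat \<Rightarrow> nat \<Rightarrow> nat \<Rightarrow> nat \<Rightarrow> 'k::field poly" where
  "prim_poly \<alpha> \<beta> i s = (-1) ^ s * qX ^ ((i choose 2) + (\<beta> + 1) * i - (s choose 2) - (\<beta> + 1) * s)
      * gauss (\<beta> + s) \<beta> * gauss (\<alpha> + i - s) \<alpha>"

text \<open>The coefficient at \<open>u_{s'} \<otimes> v_{i+n-s'}\<close> of \<open>N\<^sup>n (\<Sum>s. W s (u_s \<otimes> v_{i-s}))\<close>.\<close>

definition gauss_conv :: "(nat \<Rightarrow> 'k::field poly) \<Rightarrow> nat \<Rightarrow> nat \<Rightarrow> nat \<Rightarrow> 'k poly" where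
  "gauss_conv W i n s' = (\<Sum>s\<le>i. if s \<le> s' then W s * (qX ^ (s * (n - (s' - s))) * gauss n (s' - s)) else 0)"

lemma choose_two_mono: "s \<le> i \<Longrightarrow> (s choose 2) \<le> (i choose 2)"
  by (induction rule: dec_induct) (auto simp: choose_two_Suc)

lemma (in generic_parameter) powi_add: "t powi (x + y) = t powi x * t powi y"
  using nz by (simp add: power_int_add)

text \<open>As functions of \<open>t\<^sup>s\<close> both Gaussian binomials in the primitive coefficients are polynomials, and they
  vanish at the integers \<open>s\<close> outside \<open>{0..i}\<close> that the convolution reaches.  So the sum may be
  extended to all \<open>r \<le> n\<close>, where it is an \<open>n\<close>-th \<open>q\<close>-difference of a polynomial of degree
  \<open>\<alpha> + \<beta>\<close>, which is zero for \<open>n = \<alpha> + \<beta> + 1\<close>.\<close>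

lemma (in generic_parameter) gauss_conv_prim:
  assumes s': "s' \<ge> n - \<beta>" "s' \<le> \<alpha> + i"
  defines "\<sigma> \<equiv> int s' - int n"
  defines "P \<equiv> (\<Prod>j=1..\<beta>. [:1, - (t powi (\<sigma> + int j)):]) * (\<Prod>j=1..\<alpha>. [:- (t powi (int i + int j)), t powi \<sigma>:])"
  defines "\<kappa> \<equiv> tri (int i) + (int \<beta> + 1) * int i - tri \<sigma> - (int (\<alpha> + \<beta>) + 1) * \<sigma> - tri (int n)"
  shows "qpoch t \<alpha> * qpoch t \<beta> * poly (gauss_conv (prim_poly \<alpha> \<beta> i) i n s') t =
    (-1) ^ s' * t powi \<kappa> *
    (\<Sum>r\<le>n. (-1) ^ r * t ^ (r choose 2) * poly (gauss n r) t *
        (t powi (int (n - r) * (int n - int (\<alpha> + \<beta>) - 1)) * poly P (t ^ (n - r))))"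
proof -
  let ?Q = "qpoch t \<alpha> * qpoch t \<beta>"
  \<comment> \<open>Both Gaussian binomials of the primitive coefficient, times \<open>?Q\<close>,
    extended to integers s; E s is the matching exponent of t.\<close>
  define \<omega> where "\<omega> s = (\<Prod>j=1..\<beta>. 1 - t powi (s + int j)) * (\<Prod>j=1..\<alpha>. 1 - t powi (int i - s + int j))" for s
  define E where "E s = tri (int i) + (int \<beta> + 1) * int i - tri s - (int \<beta> + 1) * s" for s
  have \<omega>: "?Q * poly (prim_poly \<alpha> \<beta> i s) t = (-1) ^ s * t powi (E (int s)) * \<omega> (int s)" if "s \<le> i" for s
  proof -
    have le: "(s choose 2) + (\<beta> + 1) * s \<le> (i choose 2) + (\<beta> + 1) * i"
      using choose_two_mono[OF that] that by (intro add_mono mult_le_mono) auto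
    have "t powi (E (int s)) = t ^ ((i choose 2) + (\<beta> + 1) * i - (s choose 2) - (\<beta> + 1) * s)"
    proof -
      have "E (int s) = int ((i choose 2) + (\<beta> + 1) * i - (s choose 2) - (\<beta> + 1) * s)"
        using le unfolding E_def tri_nat by (simp add: of_nat_diff algebra_simps)
      then show ?thesis by (simp only: power_int_of_nat)
    qed
    moreover have "\<omega> (int s) = (poly (gauss (\<beta> + s) \<beta>) t * qpoch t \<beta>) * (poly (gauss (\<alpha> + i - s) \<alpha>) t * qpoch t \<alpha>)"
    proof -
      have "(\<Prod>j=1..\<alpha>. 1 - t powi (int i - int s + int j)) = poly (gauss (\<alpha> + i - s) \<alpha>) t * qpoch t \<alpha>"
        using prod_shift_eq_gauss[of \<alpha> "int i - int s"] that by (simp add: nat_diff_distrib')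
      then show ?thesis using prod_shift_eq_gauss[of \<beta> "int s"] by (simp add: \<omega>_def)
    qed
    ultimately show ?thesis by (simp add: prim_poly_def mult_ac)
  qed
  have \<omega>0: "\<omega> s = 0" if "s < 0 \<and> - int \<beta> \<le> s \<or> s > int i \<and> s \<le> int (\<alpha> + i)" for s
    using that prod_shift_eq_gauss[of \<beta> s] prod_shift_eq_gauss[of \<alpha> "int i - s"]
    by (auto simp: \<omega>_def)
  let ?f = "\<lambda>s r. (-1) powi s * t powi (E s) * \<omega> s * (t powi (s * int (n - r)) * poly (gauss n r) t)"
  have "?Q * poly (gauss_conv (prim_poly \<alpha> \<beta> i) i n s') t =
    (\<Sum>s\<le>i. if s \<le> s' then ?f (int s) (s' - s) else 0)"
    unfolding gauss_conv_def poly_sum sum_distrib_left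
  proof (rule sum.cong[OF refl])
    fix s assume "s \<in> {..i}"
    then have s: "s \<le> i" by simp
    have "t powi (int s * int (n - (s' - s))) = t ^ (s * (n - (s' - s)))"
      by (simp only: of_nat_mult[symmetric] power_int_of_nat)
    then show "?Q * poly (if s \<le> s' then prim_poly \<alpha> \<beta> i s * (qX ^ (s * (n - (s' - s))) * gauss n (s' - s)) else 0) t =
      (if s \<le> s' then ?f (int s) (s' - s) else 0)"
      using \<omega>[OF s] by (simp add: mult.assoc[symmetric] del: of_nat_diff diff_diff_right diff_diff_eq2)
  qed
  also have "\<dots> = (\<Sum>s | s \<le> i \<and> s \<le> s' \<and> s' - s \<le> n. ?f (int s) (s' - s))"
  proof -
    have "(\<Sum>s | s \<le> i \<and> s \<le> s' \<and> s' - s \<le> n. ?f (int s) (s' - s)) =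
       (\<Sum>s | s \<le> i \<and> s \<le> s' \<and> s' - s \<le> n. if s \<le> s' then ?f (int s) (s' - s) else 0)"
      by (rule sum.cong) auto
    also have "\<dots> = (\<Sum>s\<le>i. if s \<le> s' then ?f (int s) (s' - s) else 0)"
    proof (rule sum.mono_neutral_left)
      show "\<forall>s\<in>{..i} - {s. s \<le> i \<and> s \<le> s' \<and> s' - s \<le> n}. (if s \<le> s' then ?f (int s) (s' - s) else 0) = 0"
      proof
        fix s assume "s \<in> {..i} - {s. s \<le> i \<and> s \<le> s' \<and> s' - s \<le> n}"
        then have "s \<le> s' \<Longrightarrow> n < s' - s" by auto
        then show "(if s \<le> s' then ?f (int s) (s' - s) else 0) = 0" by simp
      qed
    qed auto
    finally show ?thesis by simp
  qed
  also have "\<dots> = (\<Sum>r | r \<le> n \<and> 0 \<le> int s' - int r \<and> int s' - int r \<le> int i. ?f (int s' - int r) r)"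
    by (rule sum.reindex_bij_witness[where i = "\<lambda>r. s' - r" and j = "\<lambda>s. s' - s"]) (auto simp: of_nat_diff)
  \<comment> \<open>The bounds on s' keep s' - r between -\<beta> and \<alpha> + i for all r \<le>
    n, and in that range \<omega> vanishes outside {0..i}.\<close>
  also have "\<dots> = (\<Sum>r\<le>n. ?f (int s' - int r) r)"
    by (rule sum.mono_neutral_left) (use s' in \<open>auto intro!: \<omega>0\<close>)
  also have "\<dots> = (\<Sum>r\<le>n. (-1) ^ s' * t powi \<kappa> * ((-1) ^ r * t ^ (r choose 2) * poly (gauss n r) t *
        (t powi (int (n - r) * (int n - int (\<alpha> + \<beta>) - 1)) * poly P (t ^ (n - r)))))"
  proof (rule sum.cong[OF refl])
    fix r assume "r \<in> {..n}"
    then have r: "r \<le> n" by simp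
    let ?s = "int s' - int r" and ?\<rho> = "int (n - r)"
    have s: "?s = \<sigma> + ?\<rho>" using r by (simp add: \<sigma>_def of_nat_diff)
    have y: "t ^ (n - r) = t powi ?\<rho>" by simp
    \<comment> \<open>As s = \<sigma> + (n - r), the power t^s is t^\<sigma> times the argument of
      P. The second product of \<omega> contains t^(-s) in each factor; t^(s \<alpha>) clears
      it.\<close>
    have "poly P (t ^ (n - r)) = (\<Prod>j=1..\<beta>. 1 - t powi (?s + int j)) * (\<Prod>j=1..\<alpha>. t powi ?s - t powi (int i + int j))"
      unfolding P_def y s by (simp add: poly_prod powi_add mult_ac)
    also have "(\<Prod>j=1..\<alpha>. t powi ?s - t powi (int i + int j)) = (\<Prod>j=1..\<alpha>. t powi ?s * (1 - t powi (int i - ?s + int j)))"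
      by (rule prod.cong) (simp_all add: right_diff_distrib powi_add[symmetric])
    also have "\<dots> = t powi (?s * int \<alpha>) * (\<Prod>j=1..\<alpha>. 1 - t powi (int i - ?s + int j))"
      by (simp add: prod.distrib power_int_mult)
    finally have P: "poly P (t ^ (n - r)) = t powi (?s * int \<alpha>) * \<omega> ?s"
      by (simp add: \<omega>_def mult_ac)
    have sgn: "(-1 :: 'k) powi ?s = (-1) ^ s' * (-1) ^ r"
      by (simp add: power_int_diff minus_one_power_iff)
    \<comment> \<open>The term (n - r) (n - \<alpha> - \<beta> - 1) is 0 for n = \<alpha> + \<beta>
      + 1 and -(n - r) for n = \<alpha> + \<beta>, the two cases of interest. Doubling removes the
      division in \<open>tri\<close>.\<close>
    have "E ?s + ?s * ?\<rho> = \<kappa> + int (r choose 2) + ?\<rho> * (int n - int (\<alpha> + \<beta>) - 1) + ?s * int \<alpha>"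
    proof -
      have "2 * (E ?s + ?s * ?\<rho>) = 2 * (\<kappa> + tri (int r) + ?\<rho> * (int n - int (\<alpha> + \<beta>) - 1) + ?s * int \<alpha>)"
        unfolding E_def \<kappa>_def distrib_left right_diff_distrib tri_double
        using r by (simp add: \<sigma>_def of_nat_diff algebra_simps)
      then show ?thesis by (simp add: tri_nat)
    qed
    then have "t powi (E ?s) * t powi (?s * ?\<rho>) =
        t powi \<kappa> * t ^ (r choose 2) * t powi (?\<rho> * (int n - int (\<alpha> + \<beta>) - 1)) * t powi (?s * int \<alpha>)"
      by (simp only: powi_add[symmetric] power_int_of_nat[symmetric])
    then show "?f ?s r = (-1) ^ s' * t powi \<kappa> * ((-1) ^ r * t ^ (r choose 2) * poly (gauss n r) t *
        (t powi (?\<rho> * (int n - int (\<alpha> + \<beta>) - 1)) * poly P (t ^ (n - r))))"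
      unfolding P sgn by (simp only: mult_ac)
  qed
  finally show ?thesis by (simp only: sum_distrib_left)
qed

lemma degree_linear_prod:
  "degree (\<Prod>j\<in>A. [:f j, g j:] :: 'k::field poly) \<le> card A"
proof (cases "finite A")
  case True
  have "degree (\<Prod>j\<in>A. [:f j, g j:]) \<le> sum (degree \<circ> (\<lambda>j. [:f j, g j:])) A" by (rule degree_prod_sum_le[OF True])
  also have "\<dots> \<le> (\<Sum>j\<in>A. 1)" by (rule sum_mono) (auto simp: degree_pCons_le)
  finally show ?thesis by simp
qed auto

context generic_parameter
begin

lemma gauss_conv_prim_vanish:
  assumes "s' \<ge> \<alpha> + 1" "s' \<le> \<alpha> + i"
  shows "poly (gauss_conv (prim_poly \<alpha> \<beta> i) i (\<alpha> + \<beta> + 1) s') t = 0"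
proof -
  let ?\<sigma> = "int s' - int (\<alpha> + \<beta> + 1)"
  let ?A = "\<Prod>j=1..\<beta>. [:1, - (t powi (?\<sigma> + int j)):]" and ?B = "\<Prod>j=1..\<alpha>. [:- (t powi (int i + int j)), t powi ?\<sigma>:]"
  have "degree (?A * ?B) \<le> \<beta> + \<alpha>"
    using degree_mult_le[of ?A ?B] degree_linear_prod[of "\<lambda>_. 1" "\<lambda>j. - (t powi (?\<sigma> + int j))" "{1..\<beta>}"]
     degree_linear_prod[of "\<lambda>j. - (t powi (int i + int j))" "\<lambda>_. t powi ?\<sigma>" "{1..\<alpha>}"] by simp
  then have "qpoch t \<alpha> * qpoch t \<beta> * poly (gauss_conv (prim_poly \<alpha> \<beta> i) i (\<alpha> + \<beta> + 1) s') t = 0"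
    using q_difference_poly[of "?A * ?B" "\<alpha> + \<beta> + 1" t] assms
    by (subst gauss_conv_prim) simp_all
  then show ?thesis using qpoch_nonzero by simp
qed

text \<open>For n = \<alpha> + \<beta> the sum is the n-th q-difference of P(y) / y. Writing P = P0
  + y P', the part P' has degree below n and contributes nothing, so only P0 / y is left. The
  q-binomial theorem at y = 1 / t then gives t^(-n) (t; t)_n.\<close>

lemma gauss_conv_prim_top:
  fixes \<alpha> \<beta> i
  defines "\<sigma> \<equiv> int i - int \<beta>"
  shows "poly (gauss_conv (prim_poly \<alpha> \<beta> i) i (\<alpha> + \<beta>) (\<alpha> + i)) t =
    (-1) ^ i * t powi (tri (int i) + (int \<beta> + 1) * int i - tri \<sigma> - (int (\<alpha> + \<beta>) + 1) * \<sigma> - tri (int (\<alpha> + \<beta>))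
       + - int (\<alpha> + \<beta>) + (\<Sum>j=1..\<alpha>. int i + int j)) * poly (gauss (\<alpha> + \<beta>) \<alpha>) t"
proof -
  let ?n = "\<alpha> + \<beta>"
  let ?A = "\<Prod>j=1..\<beta>. [:1, - (t powi (\<sigma> + int j)):]" and ?B = "\<Prod>j=1..\<alpha>. [:- (t powi (int i + int j)), t powi \<sigma>:]"
  let ?\<kappa> = "tri (int i) + (int \<beta> + 1) * int i - tri \<sigma> - (int ?n + 1) * \<sigma> - tri (int ?n)"
  have deg: "degree (?A * ?B) \<le> \<beta> + \<alpha>"
    using degree_mult_le[of ?A ?B] degree_linear_prod[of "\<lambda>_. 1" "\<lambda>j. - (t powi (\<sigma> + int j))" "{1..\<beta>}"]
     degree_linear_prod[of "\<lambda>j. - (t powi (int i + int j))" "\<lambda>_. t powi \<sigma>" "{1..\<alpha>}"] by simp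
  obtain P0 P' where P: "?A * ?B = pCons P0 P'" by (rule pCons_cases)
  have deg': "degree P' < ?n \<or> P' = 0"
    using deg unfolding P by (auto split: if_splits)
  have "P0 = poly (?A * ?B) 0" unfolding P by simp
  also have "\<dots> = (\<Prod>j=1..\<alpha>. - (t powi (int i + int j)))" by (simp add: poly_prod)
  also have "\<dots> = (-1) ^ \<alpha> * t powi (\<Sum>j=1..\<alpha>. int i + int j)"
  proof (induction \<alpha>)
    case (Suc \<alpha>)
    then show ?case by (simp add: powi_add mult_ac)
  qed simp
  finally have P0: "P0 = (-1) ^ \<alpha> * t powi (\<Sum>j=1..\<alpha>. int i + int j)" .
  let ?c = "\<lambda>r. (-1) ^ r * t ^ (r choose 2) * poly (gauss ?n r) t"
  have "(\<Sum>r\<le>?n. ?c r * (t powi (int (?n - r) * (int ?n - int ?n - 1)) * poly (?A * ?B) (t ^ (?n - r)))) =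
     (\<Sum>r\<le>?n. P0 * (?c r * (inverse t) ^ (?n - r)) + ?c r * poly P' (t ^ (?n - r)))"
  proof (rule sum.cong[OF refl])
    fix r
    have "t powi (int (?n - r) * (int ?n - int ?n - 1)) = (inverse t) ^ (?n - r)"
      by (simp add: power_int_minus power_inverse del: of_nat_add of_nat_diff)
    moreover have "(inverse t) ^ (?n - r) * t ^ (?n - r) = 1"
      using nz by (simp flip: power_mult_distrib)
    ultimately show "?c r * (t powi (int (?n - r) * (int ?n - int ?n - 1)) * poly (?A * ?B) (t ^ (?n - r))) =
       P0 * (?c r * (inverse t) ^ (?n - r)) + ?c r * poly P' (t ^ (?n - r))"
      unfolding P by (simp add: distrib_left)
  qed
  also have "\<dots> = P0 * (\<Prod>k<?n. inverse t - t ^ k)"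
    using q_difference_poly[OF deg', of t]
    by (simp add: sum.distrib q_binomial_theorem sum_distrib_left)
  also have "(\<Prod>k<?n. inverse t - t ^ k) = (\<Prod>k<?n. inverse t * (1 - t ^ Suc k))"
    by (rule prod.cong) (use nz in \<open>auto simp: right_diff_distrib\<close>)
  also have "\<dots> = t powi (- int ?n) * qpoch t ?n"
  proof -
    have "(\<Prod>k<?n. 1 - t ^ Suc k) = qpoch t ?n"
      unfolding qpoch_def by (rule prod.reindex_bij_witness[where i = "\<lambda>j. j - 1" and j = Suc]) auto
    then show ?thesis by (simp add: prod.distrib power_int_minus power_inverse del: of_nat_add)
  qed
  also have "qpoch t ?n = poly (gauss ?n \<alpha>) t * (qpoch t \<alpha> * qpoch t \<beta>)"
    using gauss_qpoch[of \<alpha> ?n t] by simp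
  finally have S: "(\<Sum>r\<le>?n. ?c r * (t powi (int (?n - r) * (int ?n - int ?n - 1)) * poly (?A * ?B) (t ^ (?n - r)))) =
    P0 * (t powi (- int ?n) * (poly (gauss ?n \<alpha>) t * (qpoch t \<alpha> * qpoch t \<beta>)))" .
  have \<sigma>: "int (\<alpha> + i) - int ?n = \<sigma>" by (simp add: \<sigma>_def)
  have c: "\<alpha> + i \<ge> ?n - \<beta>" "\<alpha> + i \<le> \<alpha> + i" by auto
  have "qpoch t \<alpha> * qpoch t \<beta> * poly (gauss_conv (prim_poly \<alpha> \<beta> i) i ?n (\<alpha> + i)) t =
    (-1) ^ (\<alpha> + i) * t powi ?\<kappa> * (P0 * (t powi (- int ?n) * (poly (gauss ?n \<alpha>) t * (qpoch t \<alpha> * qpoch t \<beta>))))"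
    unfolding gauss_conv_prim[OF c] \<sigma> S by (rule refl)
  also have "\<dots> = qpoch t \<alpha> * qpoch t \<beta> * ((-1) ^ i * (t powi ?\<kappa> * t powi (- int ?n) * t powi (\<Sum>j=1..\<alpha>. int i + int j)) * poly (gauss ?n \<alpha>) t)"
  proof -
    have "(-1 :: 'k) ^ (\<alpha> + i) * (-1) ^ \<alpha> = (-1) ^ i"
      by (simp add: power_add minus_one_power_iff)
    then show ?thesis unfolding P0 by (simp add: mult_ac)
  qed
  finally show ?thesis using qpoch_nonzero by (simp add: powi_add[symmetric])
qed

end

text \<open>In characteristic 0 the integers from 2 on are no roots of unity.\<close>

lemma infinite_generic: "infinite {t :: 'k::field_char_0. generic_parameter t}"
proof -
  have "generic_parameter (of_nat (k + 2) :: 'k)" for k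
  proof
    show "(of_nat (k + 2) :: 'k) ^ n \<noteq> 1" if "n > 0" for n
    proof -
      have "(k + 2) ^ n \<noteq> 1" using that by simp
      then show ?thesis by (metis of_nat_1 of_nat_eq_iff of_nat_power)
    qed
  qed (metis add_2_eq_Suc' nat.simps(3) of_nat_0_eq_iff)
  then have "range (\<lambda>k. of_nat (k + 2) :: 'k) \<subseteq> {t. generic_parameter t}" by auto
  moreover have "infinite (range (\<lambda>k. of_nat (k + 2) :: 'k))"
    by (rule range_inj_infinite) (auto simp: inj_on_def)
  ultimately show ?thesis using finite_subset by blast
qed

lemma poly_eq_generic:
  fixes p q :: "'k::field_char_0 poly"
  assumes "\<And>t. generic_parameter t \<Longrightarrow> poly p t = poly q t"
  shows "p = q"
proof (rule ccontr)
  assume "p \<noteq> q"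
  then have "finite {t. poly (p - q) t = 0}" by (intro poly_roots_finite) simp
  moreover have "{t. generic_parameter t} \<subseteq> {t. poly (p - q) t = 0}" using assms by auto
  ultimately show False using infinite_generic finite_subset by blast
qed

lemma gauss_conv_prim_eq_0:
  assumes "s' \<ge> \<alpha> + 1" "s' \<le> \<alpha> + i"
  shows "gauss_conv (prim_poly \<alpha> \<beta> i) i (\<alpha> + \<beta> + 1) s' = (0 :: 'k::field_char_0 poly)"
  by (rule poly_eq_generic) (use generic_parameter.gauss_conv_prim_vanish[OF _ assms] in simp)

text \<open>The exponent in \<open>gauss_conv_prim_top\<close> may have either sign; a power of X on
  each side turns it into a polynomial identity. These powers do not vanish at \<open>q\<close> or
  at 1, so they are harmless later.\<close>

lemma gauss_conv_prim_eq_gauss: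
  obtains k l where "qX ^ k * gauss_conv (prim_poly \<alpha> \<beta> i) i (\<alpha> + \<beta>) (\<alpha> + i) =
     (-1) ^ i * (qX ^ l * (gauss (\<alpha> + \<beta>) \<alpha> :: 'k::field_char_0 poly))"
proof -
  define x where "x = tri (int i) + (int \<beta> + 1) * int i - tri (int i - int \<beta>) - (int (\<alpha> + \<beta>) + 1) * (int i - int \<beta>)
       - tri (int (\<alpha> + \<beta>)) + - int (\<alpha> + \<beta>) + (\<Sum>j=1..\<alpha>. int i + int j)"
  have "qX ^ nat (- x) * gauss_conv (prim_poly \<alpha> \<beta> i) i (\<alpha> + \<beta>) (\<alpha> + i) =
     (-1) ^ i * (qX ^ nat x * (gauss (\<alpha> + \<beta>) \<alpha> :: 'k poly))"
  proof (rule poly_eq_generic)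
    fix t :: 'k assume t: "generic_parameter t"
    then have "t \<noteq> 0" by (simp add: generic_parameter_def)
    then have "t ^ nat (- x) * t powi x = t ^ nat x"
      by (cases "x \<ge> 0") (auto simp: power_int_def power_inverse)
    then show "poly (qX ^ nat (- x) * gauss_conv (prim_poly \<alpha> \<beta> i) i (\<alpha> + \<beta>) (\<alpha> + i)) t =
     poly ((-1) ^ i * (qX ^ nat x * (gauss (\<alpha> + \<beta>) \<alpha>))) t"
      using generic_parameter.gauss_conv_prim_top[OF t, of \<alpha> \<beta> i, folded x_def]
      by (simp add: mult_ac)
  qed
  then show thesis by (rule that)
qed

section \<open>The operator of the tensor product\<close>

text \<open>On \<open>V(0,a) \<otimes> V(0,b)\<close> the operator \<open>N\<close> is the case \<open>D = 1\<close>, \<open>Q = q\<close>.  If \<open>q\<close> is a primitive \<open>d\<close>-th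
  root of unity, then \<open>N\<^sup>d\<close> is the case \<open>D = d\<close>, \<open>Q = 1\<close>.\<close>

definition step_op :: "nat \<Rightarrow> nat \<Rightarrow> nat \<Rightarrow> 'k::field \<Rightarrow> ((nat \<times> nat \<Rightarrow>\<^sub>0 'k) \<Rightarrow> (nat \<times> nat \<Rightarrow>\<^sub>0 'k)) \<Rightarrow> bool" where
  "step_op a b D Q M \<longleftrightarrow> D > 0 \<and> lin M \<and>
     (\<forall>x s t. Poly_Mapping.keys x \<subseteq> {0..a} \<times> {0..b} \<longrightarrow>
        Poly_Mapping.lookup (M x) (s, t) =
          (if s \<le> a \<and> t \<le> b then
             (if D \<le> s then Poly_Mapping.lookup x (s - D, t) else 0) +
             Q ^ s * (if D \<le> t then Poly_Mapping.lookup x (s, t - D) else 0)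
           else 0))"

lemma step_op_lookup:
  assumes "step_op a b D Q M" "Poly_Mapping.keys x \<subseteq> {0..a} \<times> {0..b}"
  shows "Poly_Mapping.lookup (M x) (s, t) =
          (if s \<le> a \<and> t \<le> b then
             (if D \<le> s then Poly_Mapping.lookup x (s - D, t) else 0) +
             Q ^ s * (if D \<le> t then Poly_Mapping.lookup x (s, t - D) else 0)
           else 0)"
  using assms unfolding step_op_def by blast

lemma step_op_keys:
  assumes "step_op a b D Q M" "Poly_Mapping.keys x \<subseteq> {0..a} \<times> {0..b}"
  shows "Poly_Mapping.keys ((M ^^ n) x) \<subseteq> {0..a} \<times> {0..b}"
proof (induction n)
  case (Suc n)
  show ?case using step_op_lookup[OF assms(1) Suc] by (auto simp: in_keys_iff split: if_splits)
qed (use assms in simp)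

lemma step_op_support:
  assumes M: "step_op a b D Q M" and st: "s \<le> a" "t \<le> b"
    and nz: "Poly_Mapping.lookup ((M ^^ n) (bvec (s, t))) (s', t') \<noteq> 0"
  shows "\<exists>v\<le>n. s' = s + D * v \<and> t' = t + D * (n - v)"
  using nz
proof (induction n arbitrary: s' t')
  case 0
  then show ?case by (auto simp: lookup_single when_def split: if_splits)
next
  case (Suc n)
  have k: "Poly_Mapping.keys ((M ^^ n) (bvec (s, t))) \<subseteq> {0..a} \<times> {0..b}"
    by (rule step_op_keys[OF M]) (use st in auto)
  from Suc.prems consider "D \<le> s'" "Poly_Mapping.lookup ((M ^^ n) (bvec (s, t))) (s' - D, t') \<noteq> 0"
    | "D \<le> t'" "Poly_Mapping.lookup ((M ^^ n) (bvec (s, t))) (s', t' - D) \<noteq> 0"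
    by (cases "Poly_Mapping.lookup ((M ^^ n) (bvec (s, t))) (s' - D, t') = 0")
       (auto simp: step_op_lookup[OF M k] split: if_splits)
  then show ?case
  proof cases
    case 1
    from Suc.IH[OF 1(2)] obtain v where "v \<le> n" "s' - D = s + D * v" "t' = t + D * (n - v)" by blast
    then show ?thesis using 1(1) by (intro exI[of _ "Suc v"]) auto
  next
    case 2
    from Suc.IH[OF 2(2)] obtain v where "v \<le> n" "s' = s + D * v" "t' - D = t + D * (n - v)" by blast
    then show ?thesis using 2(1) by (intro exI[of _ v]) (auto simp: Suc_diff_le)
  qed
qed

text \<open>A noncommutative binomial formula. Each of the n - v steps in the second coordinate
  costs Q^s from the starting point, and Q^D more for every earlier step in the first coordinate.
  Splitting off the last step gives the first q-Pascal rule.\<close>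

lemma step_op_power:
  assumes M: "step_op a b D Q M" and v: "v \<le> n" "s + D * v \<le> a" "t + D * (n - v) \<le> b"
  shows "Poly_Mapping.lookup ((M ^^ n) (bvec (s, t))) (s + D * v, t + D * (n - v)) =
     Q ^ (s * (n - v)) * poly (gauss n v) (Q ^ D)"
  using v
proof (induction n arbitrary: v)
  case (Suc n)
  have D: "D > 0" using M by (simp add: step_op_def)
  have st: "s \<le> a" "t \<le> b" using Suc.prems by auto
  let ?x = "(M ^^ n) (bvec (s, t))"
  have k: "Poly_Mapping.keys ?x \<subseteq> {0..a} \<times> {0..b}"
    by (rule step_op_keys[OF M]) (use st in auto)
  let ?s = "s + D * v" and ?t = "t + D * (Suc n - v)"
  have 1: "(if D \<le> ?s then Poly_Mapping.lookup ?x (?s - D, ?t) else 0) =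
      (if v = 0 then 0 else Q ^ (s * (Suc n - v)) * poly (gauss n (v - 1)) (Q ^ D))"
  proof (cases v)
    case 0
    \<comment> \<open>The predecessor may lie inside the truncation, but it is to the left of the
      starting point and cannot be reached.\<close>
    have "Poly_Mapping.lookup ?x (s - D, ?t) = 0" if "D \<le> s"
    proof (rule ccontr)
      assume "Poly_Mapping.lookup ?x (s - D, ?t) \<noteq> 0"
      from step_op_support[OF M st this] obtain v' where "s - D = s + D * v'" by blast
      then show False using D that by linarith
    qed
    then show ?thesis using 0 by simp
  next
    case v: (Suc v')
    have "Poly_Mapping.lookup ?x (s + D * v', t + D * (n - v')) = Q ^ (s * (n - v')) * poly (gauss n v') (Q ^ D)"
      by (rule Suc.IH) (use Suc.prems v in auto)
    then show ?thesis using v by (simp add: add.assoc)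
  qed
  have 2: "(if D \<le> ?t then Poly_Mapping.lookup ?x (?s, ?t - D) else 0) =
      (if v = Suc n then 0 else Q ^ (s * (n - v)) * poly (gauss n v) (Q ^ D))"
  proof (cases "v = Suc n")
    case True
    have "Poly_Mapping.lookup ?x (?s, t - D) = 0" if "D \<le> t"
    proof (rule ccontr)
      assume "Poly_Mapping.lookup ?x (?s, t - D) \<noteq> 0"
      from step_op_support[OF M st this] obtain v' where "t - D = t + D * (n - v')" by blast
      then show False using D that by linarith
    qed
    then show ?thesis using True by simp
  next
    case False
    then have v: "v \<le> n" "Suc n - v = Suc (n - v)" using Suc.prems by auto
    have "Poly_Mapping.lookup ?x (?s, t + D * (n - v)) = Q ^ (s * (n - v)) * poly (gauss n v) (Q ^ D)"
      by (rule Suc.IH) (use Suc.prems v in auto)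
    then show ?thesis using v False by simp
  qed
  have "Poly_Mapping.lookup ((M ^^ Suc n) (bvec (s, t))) (?s, ?t) =
     (if v = 0 then 0 else Q ^ (s * (Suc n - v)) * poly (gauss n (v - 1)) (Q ^ D)) +
     Q ^ ?s * (if v = Suc n then 0 else Q ^ (s * (n - v)) * poly (gauss n v) (Q ^ D))"
    using step_op_lookup[OF M k, of ?s ?t] Suc.prems unfolding 1 2 by simp
  also have "\<dots> = Q ^ (s * (Suc n - v)) * poly (gauss (Suc n) v) (Q ^ D)"
  proof (cases v)
    case (Suc v')
    show ?thesis
    proof (cases "v = Suc n")
      case False
      then have "Suc n - v = Suc (n - v)" using Suc.prems by auto
      then have "Q ^ ?s * Q ^ (s * (n - v)) = Q ^ (s * (Suc n - v)) * (Q ^ D) ^ v"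
        by (simp add: power_add power_mult[symmetric] mult_ac)
      then show ?thesis using Suc False
        by (simp add: gauss_Suc_Suc distrib_left mult.assoc[symmetric])
    qed (use Suc in simp)
  qed (simp add: power_add)
  finally show ?case .
qed (simp add: lookup_single)

text \<open>The assumption on s0 holds in both applications: s0 = 0 for N, and Q = 1 for N^d. It
  removes the offset from the coefficients, which then depend on Q^D only. The second claim confines
  the support to the lattice of step D.\<close>

lemma step_op_conv:
  fixes W :: "nat \<Rightarrow> 'k::field poly" and Q :: 'k
  assumes M: "step_op a b D Q M" and Q: "Q ^ s0 = 1"
    and k: "s0 + D * k \<le> a" "t0 + D * k \<le> b"
  defines "w \<equiv> (\<Sum>u\<le>k. scale (poly (W u) (Q ^ D)) (bvec (s0 + D * u, t0 + D * (k - u))))"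
  shows "v \<le> k + n \<Longrightarrow> s0 + D * v \<le> a \<Longrightarrow> t0 + D * (k + n - v) \<le> b \<Longrightarrow>
          Poly_Mapping.lookup ((M ^^ n) w) (s0 + D * v, t0 + D * (k + n - v)) = poly (gauss_conv W k n v) (Q ^ D)"
    and "Poly_Mapping.lookup ((M ^^ n) w) (s', t') \<noteq> 0 \<Longrightarrow>
          s' \<le> a \<and> t' \<le> b \<and> (\<exists>v\<le>k + n. s' = s0 + D * v \<and> t' = t0 + D * (k + n - v))"
proof -
  have D: "D > 0" and lin: "lin M" using M by (auto simp: step_op_def)
  have range: "s0 + D * u \<le> a" "t0 + D * (k - u) \<le> b" if "u \<le> k" for u
  proof -
    have "D * u \<le> D * k" "D * (k - u) \<le> D * k" using that by auto
    then show "s0 + D * u \<le> a" "t0 + D * (k - u) \<le> b" using k by linarith+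
  qed
  have lw: "Poly_Mapping.lookup ((M ^^ n) w) p =
     (\<Sum>u\<le>k. poly (W u) (Q ^ D) * Poly_Mapping.lookup ((M ^^ n) (bvec (s0 + D * u, t0 + D * (k - u)))) p)" for p
    by (simp add: w_def lin_sum[OF lin_funpow[OF lin]] lin_scale[OF lin_funpow[OF lin]] lookup_sum)
  {
    assume v: "v \<le> k + n" "s0 + D * v \<le> a" "t0 + D * (k + n - v) \<le> b"
    show "Poly_Mapping.lookup ((M ^^ n) w) (s0 + D * v, t0 + D * (k + n - v)) = poly (gauss_conv W k n v) (Q ^ D)"
      unfolding lw gauss_conv_def poly_sum
    proof (rule sum.cong[OF refl])
      fix u assume "u \<in> {..k}"
      then have u: "u \<le> k" by simp
      let ?l = "Poly_Mapping.lookup ((M ^^ n) (bvec (s0 + D * u, t0 + D * (k - u)))) (s0 + D * v, t0 + D * (k + n - v))"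
      have "?l = (if u \<le> v then (Q ^ D) ^ (u * (n - (v - u))) * poly (gauss n (v - u)) (Q ^ D) else 0)"
      proof (cases "u \<le> v \<and> v - u \<le> n")
        case True
        have e: "s0 + D * v = s0 + D * u + D * (v - u)"
          "t0 + D * (k + n - v) = t0 + D * (k - u) + D * (n - (v - u))"
          using True u by (auto simp flip: distrib_left simp: add.assoc)
        have "?l = Q ^ ((s0 + D * u) * (n - (v - u))) * poly (gauss n (v - u)) (Q ^ D)"
          unfolding e by (rule step_op_power[OF M]) (use True v e in auto)
        also have "Q ^ ((s0 + D * u) * (n - (v - u))) = (Q ^ D) ^ (u * (n - (v - u)))"
          by (simp only: power_add distrib_right power_mult Q power_one mult_1)
        finally show ?thesis using True by simp
      next
        case False
        have "?l = 0"
        proof (rule ccontr)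
          assume "?l \<noteq> 0"
          from step_op_support[OF M range[OF u] this] obtain v' where "v' \<le> n" "s0 + D * v = s0 + D * u + D * v'" by blast
          then have "D * v = D * (u + v')" by (simp add: distrib_left)
          then have "v = u + v'" using D by simp
          then show False using False \<open>v' \<le> n\<close> by simp
        qed
        then show ?thesis using False by auto
      qed
      then show "poly (W u) (Q ^ D) * ?l =
         poly (if u \<le> v then W u * (qX ^ (u * (n - (v - u))) * gauss n (v - u)) else 0) (Q ^ D)"
        by simp
    qed
  }
  assume nz: "Poly_Mapping.lookup ((M ^^ n) w) (s', t') \<noteq> 0"
  then obtain u where u: "u \<le> k" "Poly_Mapping.lookup ((M ^^ n) (bvec (s0 + D * u, t0 + D * (k - u)))) (s', t') \<noteq> 0"
    unfolding lw by (metis (no_types, lifting) atMost_iff mult_zero_right sum.neutral)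
  from step_op_support[OF M range[OF u(1)] u(2)] obtain v where
    v: "v \<le> n" "s' = s0 + D * u + D * v" "t' = t0 + D * (k - u) + D * (n - v)" by blast
  have "Poly_Mapping.keys ((M ^^ n) (bvec (s0 + D * u, t0 + D * (k - u)))) \<subseteq> {0..a} \<times> {0..b}"
    by (rule step_op_keys[OF M]) (use range[OF u(1)] in auto)
  then have "s' \<le> a \<and> t' \<le> b" using u(2) by (auto simp: in_keys_iff)
  moreover have "\<exists>v\<le>k + n. s' = s0 + D * v \<and> t' = t0 + D * (k + n - v)"
    using v u(1) by (intro exI[of _ "u + v"]) (auto simp flip: distrib_left simp: add.assoc)
  ultimately show "s' \<le> a \<and> t' \<le> b \<and> (\<exists>v\<le>k + n. s' = s0 + D * v \<and> t' = t0 + D * (k + n - v))" by blast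
qed

definition tstep :: "nat \<Rightarrow> nat \<Rightarrow> 'k::field \<Rightarrow> (nat \<times> nat \<Rightarrow>\<^sub>0 'k) \<Rightarrow> (nat \<times> nat \<Rightarrow>\<^sub>0 'k)" where
  "tstep a b q = lin_ext (\<lambda>(s, t). (if s < a then bvec (Suc s, t) else 0) +
      scale (q ^ s) (if t < b then bvec (s, Suc t) else 0))"

lemma tstep_step_op: "step_op a b 1 q (tstep a b q)"
  unfolding step_op_def
proof (intro conjI allI impI)
  show "lin (tstep a b q)" by (simp add: tstep_def linear_lin_ext)
  fix x :: "nat \<times> nat \<Rightarrow>\<^sub>0 'a" and s t
  assume x: "Poly_Mapping.keys x \<subseteq> {0..a} \<times> {0..b}"
  let ?l = "Poly_Mapping.lookup"
  have "?l (tstep a b q x) (s, t) = (\<Sum>p\<in>Poly_Mapping.keys x.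
      (if p = (s - 1, t) then (if 1 \<le> s \<and> s \<le> a then ?l x (s - 1, t) else 0) else 0) +
      (if p = (s, t - 1) then (if 1 \<le> t \<and> t \<le> b then q ^ s * ?l x (s, t - 1) else 0) else 0))"
    unfolding tstep_def lookup_lin_ext
  proof (rule sum.cong[OF refl])
    fix p assume "p \<in> Poly_Mapping.keys x"
    obtain u v where p: "p = (u, v)" by fastforce
    have "?l ((if u < a then bvec (Suc u, v) else 0) + scale (q ^ u) (if v < b then bvec (u, Suc v) else 0)) (s, t) =
      (if Suc u = s \<and> v = t \<and> u < a then 1 else 0) + (if u = s \<and> Suc v = t \<and> v < b then q ^ s else 0)"
      by (simp add: lookup_add lookup_single when_def)
    also have "\<dots> = (if u = s - 1 \<and> v = t \<and> 1 \<le> s \<and> s \<le> a then 1 else 0) +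
        (if u = s \<and> v = t - 1 \<and> 1 \<le> t \<and> t \<le> b then q ^ s else 0)"
      by (intro arg_cong2[of _ _ _ _ "(+)"] if_cong) auto
    finally show "?l x p * ?l (case p of (s, t) \<Rightarrow> (if s < a then bvec (Suc s, t) else 0) +
         scale (q ^ s) (if t < b then bvec (s, Suc t) else 0)) (s, t) =
      (if p = (s - 1, t) then (if 1 \<le> s \<and> s \<le> a then ?l x (s - 1, t) else 0) else 0) +
      (if p = (s, t - 1) then (if 1 \<le> t \<and> t \<le> b then q ^ s * ?l x (s, t - 1) else 0) else 0)"
      by (simp add: p distrib_left)
  qed
  also have "\<dots> = (if 1 \<le> s \<and> s \<le> a then ?l x (s - 1, t) else 0) +
     (if 1 \<le> t \<and> t \<le> b then q ^ s * ?l x (s, t - 1) else 0)"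
    unfolding sum.distrib by (auto simp: in_keys_iff)
  also have "\<dots> = (if s \<le> a \<and> t \<le> b then (if 1 \<le> s then ?l x (s - 1, t) else 0) +
             q ^ s * (if 1 \<le> t then ?l x (s, t - 1) else 0) else 0)"
  proof -
    have "?l x p = 0" if "p \<notin> {0..a} \<times> {0..b}" for p using that x by (auto simp: in_keys_iff)
    then show ?thesis by auto
  qed
  finally show "?l (tstep a b q x) (s, t) = (if s \<le> a \<and> t \<le> b then (if 1 \<le> s then ?l x (s - 1, t) else 0) +
             q ^ s * (if 1 \<le> t then ?l x (s, t - 1) else 0) else 0)" .
qed simp

lemma lookup_tstep_power:
  assumes "s \<le> a" "t \<le> b"
  shows "Poly_Mapping.lookup ((tstep a b q ^^ n) (bvec (s, t))) (s', t') =
    (if s \<le> s' \<and> t \<le> t' \<and> s' + t' = s + t + n \<and> s' \<le> a \<and> t' \<le> b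
     then q ^ (s * (t' - t)) * poly (gauss n (s' - s)) q else 0)"
proof (cases "s \<le> s' \<and> t \<le> t' \<and> s' + t' = s + t + n \<and> s' \<le> a \<and> t' \<le> b")
  case True
  have "n - (s' - s) = t' - t" using True by auto
  then show ?thesis
    using step_op_power[OF tstep_step_op, of "s' - s" n s a t b q] True by auto
next
  case False
  have k: "Poly_Mapping.keys ((tstep a b q ^^ n) (bvec (s, t))) \<subseteq> {0..a} \<times> {0..b}"
    by (rule step_op_keys[OF tstep_step_op]) (use assms in auto)
  have "Poly_Mapping.lookup ((tstep a b q ^^ n) (bvec (s, t))) (s', t') = 0"
  proof (rule ccontr)
    assume nz: "Poly_Mapping.lookup ((tstep a b q ^^ n) (bvec (s, t))) (s', t') \<noteq> 0"
    then have "s' \<le> a \<and> t' \<le> b" using k by (auto simp: in_keys_iff)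
    then show False using step_op_support[OF tstep_step_op assms nz] False by auto
  qed
  then show ?thesis unfolding if_not_P[OF False] .
qed

text \<open>The structure constants q^(im) times Gaussian binomial of the Hopf algebra are the
  coefficients of N^n in \<open>lookup_tstep_power\<close>: the first path starts at i = s and the
  second has length m = t' - t.\<close>

lemma tensor_graded_rep:
  "graded_rep (V 0 a \<otimes>\<^bsub>q\<^esub> V 0 b) (\<lambda>(s, t). int (s + t)) (tstep a b q) (a + b)"
  unfolding graded_rep_def
proof (intro conjI ballI allI impI)
  let ?X = "V 0 a \<otimes>\<^bsub>q\<^esub> V 0 b"
  have basis: "basis ?X = {0..a} \<times> {0..b}" by (simp add: tensor_comodule_def V_def)
  show "finite (basis ?X)" by (simp add: basis)
  show "lin (coact ?X)"
    unfolding tensor_comodule_def o_def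
    by (simp add: lin_compose[OF lin_compose[OF lin_tens_map lin_tens_swap] lin_tens_map])
  show "lin (tstep a b q)" by (simp add: tstep_def linear_lin_ext)
  fix p assume "p \<in> basis ?X"
  then obtain s t where p: "p = (s, t)" "s \<le> a" "t \<le> b" by (auto simp: basis)
  show "Poly_Mapping.keys (tstep a b q (bvec p)) \<subseteq> {c \<in> basis ?X. (case c of (s, t) \<Rightarrow> int (s + t)) = (case p of (s, t) \<Rightarrow> int (s + t)) + 1}"
    using lookup_tstep_power[of s a t b 1 q] p by (auto simp: in_keys_iff basis split: if_splits)
  show "(tstep a b q ^^ n) (bvec p) = 0" if "n > a + b" for n
    by (rule poly_mapping_eqI) (use p that in \<open>auto simp: lookup_tstep_power\<close>)
  show "coact ?X (bvec p) = (\<Sum>n\<le>a + b. tens ((tstep a b q ^^ n) (bvec p)) (bvec (case p of (s, t) \<Rightarrow> int (s + t), n)))"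
  proof (rule poly_mapping_eqI)
    fix c :: "(nat \<times> nat) \<times> path"
    obtain s' t' i l where c: "c = ((s', t'), (i, l))" by (metis prod.exhaust)
    let ?P = "s \<le> s' \<and> t \<le> t' \<and> s' \<le> a \<and> t' \<le> b \<and> i = int s + int t \<and> l = s' - s + (t' - t)"
    let ?v = "q ^ (s * (t' - t)) * poly (gauss l (s' - s)) q"
    have "coact ?X (bvec p) = (\<Sum>j=s..a. \<Sum>j'=t..b.
        tens (bvec (j, j')) (scale (q powi (int s * int (j' - t)) * qbinom q (j - s) (j' - t)) (bvec (int s + int t, j - s + (j' - t)))))"
      using p by (simp add: tensor_comodule_def coact_V_bvec tens_sum tens_map_sum
          lin_sum[OF lin_tens_swap] mult_bvec) (rule sum.swap)
    then have "Poly_Mapping.lookup (coact ?X (bvec p)) c = (\<Sum>j=s..a. \<Sum>j'=t..b.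
        if j' = t' then (if j = s' then (if i = int s + int t \<and> l = j - s + (j' - t) then
          q powi (int s * int (j' - t)) * qbinom q (j - s) (j' - t) else 0) else 0) else 0)"
      unfolding c by (simp only: lookup_sum) (intro sum.cong refl, auto simp: lookup_single when_def)
    also have "\<dots> = (\<Sum>j=s..a. if j = s' then (if t \<le> t' \<and> t' \<le> b \<and> i = int s + int t \<and> l = s' - s + (t' - t) then
          q powi (int s * int (t' - t)) * qbinom q (s' - s) (t' - t) else 0) else 0)"
      by (intro sum.cong refl) auto
    also have "\<dots> = (if ?P then ?v else 0)"
    proof -
      have "q powi (int s * int (t' - t)) = q ^ (s * (t' - t))"
        by (simp only: of_nat_mult[symmetric] power_int_of_nat)
      then show ?thesis by (auto simp: qbinom_gauss)
    qed
    also have "\<dots> = (\<Sum>n\<le>a + b. if n = l then (if ?P then ?v else 0) else 0)"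
      by auto
    also have "\<dots> = Poly_Mapping.lookup (\<Sum>n\<le>a + b. tens ((tstep a b q ^^ n) (bvec p)) (bvec (case p of (s, t) \<Rightarrow> int (s + t), n))) c"
      unfolding lookup_sum c by (rule sum.cong) (use p in \<open>auto simp: lookup_tstep_power lookup_single when_def\<close>)
    finally show "Poly_Mapping.lookup (coact ?X (bvec p)) c = Poly_Mapping.lookup (\<Sum>n\<le>a + b. tens ((tstep a b q ^^ n) (bvec p)) (bvec (case p of (s, t) \<Rightarrow> int (s + t), n))) c" .
  qed
qed

section \<open>Chains at a root of unity\<close>

locale root_of_unity =
  fixes q :: "'k::field_char_0" and d :: nat
  assumes d: "d \<ge> 2" and q_d: "q ^ d = 1" and q_less: "\<And>n. 0 < n \<Longrightarrow> n < d \<Longrightarrow> q ^ n \<noteq> 1"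
begin

lemma q_nonzero: "q \<noteq> 0"
  using q_d d by (auto simp: power_0_left)

lemma q_power_eq_1: "q ^ n = 1 \<longleftrightarrow> d dvd n"
proof -
  have "q ^ n = (q ^ d) ^ (n div d) * q ^ (n mod d)"
    by (simp flip: power_mult power_add)
  then have "q ^ n = q ^ (n mod d)" by (simp add: q_d)
  then show ?thesis using q_less[of "n mod d"] d by (cases "n mod d = 0") (auto simp: dvd_eq_mod_eq_0)
qed

section \<open>Orders of vanishing at the root of unity\<close>

lemma order_linear_poly: "order q [:-1, 1:] = 0"
  using q_less[of 1] d by (intro order_0I) auto

text \<open>The q-integer is (X^n - 1) / (X - 1). The denominator does not vanish at
  \<open>q\<close>, and in characteristic 0 all roots of X^n - 1 are simple.\<close>

lemma order_qint:
  assumes "n > 0"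
  shows "order q (qint qX n) = (if d dvd n then 1 else 0)"
proof -
  have eq: "qint qX n * [:-1, 1:] = (qX ^ n - 1 :: 'k poly)"
  proof -
    have "(qX ^ n - 1 :: 'k poly) = (qX - 1) * (\<Sum>i<n. qX ^ i)" by (rule power_diff_1_eq)
    moreover have "(qX - 1 :: 'k poly) = [:-1, 1:]" by (simp add: one_pCons)
    ultimately show ?thesis by (simp only: qint_def mult.commute)
  qed
  have nz: "qint qX n * [:-1, 1:] \<noteq> (0 :: 'k poly)"
    by (rule no_zero_divisors[OF qint_qX_nonzero[OF assms]]) simp
  have "order q (qX ^ n - 1) = order q (qint qX n) + order q [:-1, 1:]"
    unfolding eq[symmetric] by (rule order_mult[OF nz])
  then have o: "order q (qint qX n) = order q (qX ^ n - 1)" by (simp add: order_linear_poly)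
  show ?thesis
  proof (cases "d dvd n")
    case True
    have pd: "pderiv (qX ^ n - 1 :: 'k poly) = smult (of_nat n) (qX ^ (n - 1))"
      by (simp add: pderiv_diff pderiv_power pderiv_pCons)
    have "poly (pderiv (qX ^ n - 1 :: 'k poly)) q \<noteq> 0"
      unfolding pd using assms q_nonzero by simp
    then have "order q (pderiv (qX ^ n - 1)) = 0" by (rule order_0I)
    moreover have "poly (qX ^ n - 1) q = 0" using True by (simp add: q_power_eq_1)
    then have "order q (qX ^ n - 1) = Suc (order q (pderiv (qX ^ n - 1)))"
      using nz unfolding eq by (intro order_pderiv)
    ultimately have "order q (qX ^ n - 1) = 1" by (simp only: One_nat_def)
    then show ?thesis using o True by simp
  next
    case False
    have "order q (qX ^ n - 1) = 0" using False by (intro order_0I) (simp add: q_power_eq_1)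
    then show ?thesis using o False by simp
  qed
qed

lemma order_qfact: "order q (qfact qX n) = n div d"
proof (induction n)
  case (Suc n)
  have "order q (qfact qX (Suc n)) = order q (qfact qX n) + order q (qint qX (Suc n))"
    unfolding qfact_Suc by (rule order_mult) (simp add: qfact_qX_nonzero qint_qX_nonzero)
  then show ?case using d by (simp add: Suc order_qint div_Suc dvd_eq_mod_eq_0)
qed (simp add: qfact_def)

lemma gauss_nonzero: "r \<le> n \<Longrightarrow> gauss n r \<noteq> (0 :: 'k poly)"
  using gauss_mult[of r n, where 'k='k] qfact_qX_nonzero[of n, where 'k='k] by auto

text \<open>The analogue of Kummer's theorem: the order is the carry out of the last base d digit
  when r and n - r are added. The additive form avoids truncated subtraction.\<close>

lemma order_gauss:
  assumes "r \<le> n"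
  shows "order q (gauss n r) + r div d + (n - r) div d = n div d"
proof -
  have "order q (gauss n r * (qfact qX r * qfact qX (n - r))) = n div d"
    unfolding gauss_mult[OF assms] by (rule order_qfact)
  then show ?thesis
    using gauss_nonzero[OF assms] by (simp add: order_mult qfact_qX_nonzero order_qfact)
qed

section \<open>The d-th power of the operator\<close>

lemma gauss_d: "0 < r \<Longrightarrow> r < d \<Longrightarrow> poly (gauss d r) q = 0"
  using order_gauss[of r d] d gauss_nonzero[of r d] by (simp add: order_root)

lemma gauss_below_d: "r \<le> n \<Longrightarrow> n < d \<Longrightarrow> poly (gauss n r) q \<noteq> 0"
  using order_gauss[of r n] gauss_nonzero[of r n] by (simp add: order_root)

text \<open>All middle Gaussian binomials of d vanish at \<open>q\<close>, so (x + y)^d = x^d + y^d;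
  the twist q^(u d) is 1.\<close>

lemma lookup_tstep_power_d:
  assumes p: "p = (u, v)" "u \<le> a" "v \<le> b"
  shows "Poly_Mapping.lookup ((tstep a b q ^^ d) (bvec p)) (s, t) =
      (if u = s - d \<and> v = t \<and> d \<le> s \<and> s \<le> a \<and> t \<le> b then 1 else 0) +
      (if u = s \<and> v = t - d \<and> d \<le> t \<and> s \<le> a \<and> t \<le> b then 1 else 0)"
proof (cases "u \<le> s \<and> v \<le> t \<and> s + t = u + v + d \<and> s \<le> a \<and> t \<le> b")
  case True
  then have L: "Poly_Mapping.lookup ((tstep a b q ^^ d) (bvec p)) (s, t) = q ^ (u * (t - v)) * poly (gauss d (s - u)) q"
    using p by (simp add: lookup_tstep_power)
  consider "s = u" "t = v + d" | "s = u + d" "t = v" | "0 < s - u" "s - u < d" using True by linarith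
  then show ?thesis
  proof cases
    case 1
    have "q ^ (u * d) = 1" by (simp add: q_power_eq_1)
    then show ?thesis using L 1 True d by auto
  next
    case 2
    then show ?thesis using L True d by auto
  next
    case 3
    then show ?thesis using L gauss_d[OF 3] True by auto
  qed
next
  case False
  have z: "Poly_Mapping.lookup ((tstep a b q ^^ d) (bvec p)) (s, t) = 0"
    unfolding p(1) lookup_tstep_power[OF p(2,3)] if_not_P[OF False] ..
  have n: "\<not> (u = s - d \<and> v = t \<and> d \<le> s \<and> s \<le> a \<and> t \<le> b)" "\<not> (u = s \<and> v = t - d \<and> d \<le> t \<and> s \<le> a \<and> t \<le> b)"
    using False by auto
  show ?thesis unfolding z if_not_P[OF n(1)] if_not_P[OF n(2)] by simp
qed

lemma tstep_power_step_op: "step_op a b d 1 (tstep a b q ^^ d)"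
  unfolding step_op_def
proof (intro conjI allI impI)
  have lin: "lin (tstep a b q)" by (simp add: tstep_def linear_lin_ext)
  show "lin (tstep a b q ^^ d)" by (rule lin_funpow[OF lin])
  fix x :: "nat \<times> nat \<Rightarrow>\<^sub>0 'k" and s t
  assume x: "Poly_Mapping.keys x \<subseteq> {0..a} \<times> {0..b}"
  let ?l = "Poly_Mapping.lookup"
  let ?C = "d \<le> s \<and> s \<le> a \<and> t \<le> b" and ?C' = "d \<le> t \<and> s \<le> a \<and> t \<le> b"
  have delta: "(\<Sum>p\<in>Poly_Mapping.keys x. if p = c \<and> C then ?l x p else 0) = (if C then ?l x c else 0)" for c C
    by (cases C) (auto simp: in_keys_iff)
  have "?l ((tstep a b q ^^ d) x) (s, t) = (\<Sum>p\<in>Poly_Mapping.keys x. ?l x p * ?l ((tstep a b q ^^ d) (bvec p)) (s, t))"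
    by (subst lin_expand[OF lin_funpow[OF lin]]) (simp add: lookup_sum)
  also have "\<dots> = (\<Sum>p\<in>Poly_Mapping.keys x.
      (if p = (s - d, t) \<and> ?C then ?l x p else 0) + (if p = (s, t - d) \<and> ?C' then ?l x p else 0))"
  proof (rule sum.cong[OF refl])
    fix p assume "p \<in> Poly_Mapping.keys x"
    then obtain u v where p: "p = (u, v)" "u \<le> a" "v \<le> b" using x by fastforce
    have "?l ((tstep a b q ^^ d) (bvec p)) (s, t) =
      (if p = (s - d, t) \<and> ?C then 1 else 0) + (if p = (s, t - d) \<and> ?C' then 1 else 0)"
      unfolding lookup_tstep_power_d[OF p] by (simp only: p(1) prod.inject conj_assoc)
    moreover have "y * ((if A then 1 else 0) + (if B then 1 else 0)) = (if A then y else 0) + (if B then y else 0)"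
      for A B and y :: 'k by simp
    ultimately show "?l x p * ?l ((tstep a b q ^^ d) (bvec p)) (s, t) =
      (if p = (s - d, t) \<and> ?C then ?l x p else 0) + (if p = (s, t - d) \<and> ?C' then ?l x p else 0)"
      by (simp only:)
  qed
  also have "\<dots> = (if ?C then ?l x (s - d, t) else 0) + (if ?C' then ?l x (s, t - d) else 0)"
    unfolding sum.distrib delta ..
  finally show "?l ((tstep a b q ^^ d) x) (s, t) =
    (if s \<le> a \<and> t \<le> b then (if d \<le> s then ?l x (s - d, t) else 0) + 1 ^ s * (if d \<le> t then ?l x (s, t - d) else 0) else 0)"
    by simp
qed (use d in simp)

abbreviation tdeg :: "nat \<times> nat \<Rightarrow> int" where "tdeg \<equiv> \<lambda>(s, t). int (s + t)"

lemma homog_vector: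
  assumes "s0 + D * k \<le> a" "t0 + D * k \<le> b"
  shows "(\<Sum>u\<le>k. scale (c u) (bvec (s0 + D * u, t0 + D * (k - u)))) \<in> homog (V 0 a \<otimes>\<^bsub>q\<^esub> V 0 b) tdeg (int (s0 + t0 + D * k))"
proof -
  have "basis (V 0 a \<otimes>\<^bsub>q\<^esub> V 0 b) = {0..a} \<times> {0..b}" by (simp add: tensor_comodule_def V_def)
  moreover have "p \<in> {0..a} \<times> {0..b} \<and> tdeg p = int (s0 + t0 + D * k)"
    if p: "p \<in> Poly_Mapping.keys (\<Sum>u\<le>k. scale (c u) (bvec (s0 + D * u, t0 + D * (k - u))))" for p
  proof -
    obtain u where u: "u \<le> k" "p \<in> Poly_Mapping.keys (scale (c u) (bvec (s0 + D * u, t0 + D * (k - u))))"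
      using p keys_sum[of "\<lambda>u. scale (c u) (bvec (s0 + D * u, t0 + D * (k - u)))" "{..k}"] by blast
    then have p: "p = (s0 + D * u, t0 + D * (k - u))" using keys_scale[of "c u"] by fastforce
    have D: "D * u \<le> D * k" "D * (k - u) \<le> D * k" "D * u + D * (k - u) = D * k"
      using u(1) by (auto simp flip: distrib_left)
    have "s0 + D * u + (t0 + D * (k - u)) = s0 + t0 + D * k" using D(3) by linarith
    then have "tdeg p = int (s0 + t0 + D * k)" unfolding p by (simp only: prod.case)
    moreover have "s0 + D * u \<le> a" "t0 + D * (k - u) \<le> b" using D(1,2) assms by linarith+
    then have "p \<in> {0..a} \<times> {0..b}" unfolding p by simp
    ultimately show ?thesis by blast
  qed
  ultimately show ?thesis unfolding homog_def by auto
qed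

lemma gauss_conv_mult:
  assumes "\<And>s. s \<le> i \<Longrightarrow> W s = p * W' s"
  shows "gauss_conv W i n s' = p * gauss_conv W' i n s'"
  unfolding gauss_conv_def sum_distrib_left by (rule sum.cong) (use assms in auto)

text \<open>The primitive vector may vanish at \<open>q\<close>.  The inequality says that its coefficients vanish there to at
  least the same order as the end of its chain, so both can be divided by a power of \<open>X - q\<close>.\<close>

lemma generic_chain:
  assumes fl: "\<And>s. s \<le> i \<Longrightarrow> (\<alpha> + \<beta>) div d + s div d + (i - s) div d \<le> (\<beta> + s) div d + (\<alpha> + i - s) div d"
  shows "\<exists>w\<in>homog (V 0 (\<alpha> + i) \<otimes>\<^bsub>q\<^esub> V 0 (\<beta> + i)) tdeg (int i).
     (tstep (\<alpha> + i) (\<beta> + i) q ^^ (\<alpha> + \<beta>)) w \<noteq> 0 \<and> (tstep (\<alpha> + i) (\<beta> + i) q ^^ Suc (\<alpha> + \<beta>)) w = 0"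
proof -
  let ?a = "\<alpha> + i" and ?b = "\<beta> + i"
  let ?g = "gauss (\<alpha> + \<beta>) \<alpha> :: 'k poly"
  define \<mu> where "\<mu> = order q ?g"
  let ?p = "[:- q, 1:] ^ \<mu>"
  have "?p dvd prim_poly \<alpha> \<beta> i s" if s: "s \<le> i" for s
  proof -
    let ?x = "qX ^ ((i choose 2) + (\<beta> + 1) * i - (s choose 2) - (\<beta> + 1) * s) :: 'k poly"
    have "?p dvd gauss (\<beta> + s) \<beta> * gauss (\<alpha> + i - s) \<alpha>"
    proof (subst order_divides, rule disjI2)
      have "order q (gauss (\<beta> + s) \<beta>) + \<beta> div d + s div d = (\<beta> + s) div d"
        using order_gauss[of \<beta> "\<beta> + s"] by simp
      moreover have "order q (gauss (\<alpha> + i - s) \<alpha>) + \<alpha> div d + (i - s) div d = (\<alpha> + i - s) div d"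
        using order_gauss[of \<alpha> "\<alpha> + i - s"] s by simp
      moreover have "\<mu> + \<alpha> div d + \<beta> div d = (\<alpha> + \<beta>) div d"
        using order_gauss[of \<alpha> "\<alpha> + \<beta>"] by (simp add: \<mu>_def)
      moreover have "order q (gauss (\<beta> + s) \<beta> * gauss (\<alpha> + i - s) \<alpha>) =
         order q (gauss (\<beta> + s) \<beta>) + order q (gauss (\<alpha> + i - s) \<alpha>)"
        by (rule order_mult) (use s in \<open>simp add: gauss_nonzero\<close>)
      \<comment> \<open>The orders of the three binomials share the terms \<alpha> div d and \<beta>
        div d; what remains after cancelling them is \<open>fl\<close>.\<close>
      ultimately show "\<mu> \<le> order q (gauss (\<beta> + s) \<beta> * gauss (\<alpha> + i - s) \<alpha>)"
        using fl[OF s] by linarith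
    qed
    then have "?p dvd ((-1) ^ s * ?x) * (gauss (\<beta> + s) \<beta> * gauss (\<alpha> + i - s) \<alpha>)" by (rule dvd_mult)
    then show ?thesis by (simp only: prim_poly_def mult.assoc)
  qed
  then have "\<forall>s\<in>{..i}. \<exists>w. prim_poly \<alpha> \<beta> i s = ?p * w" unfolding dvd_def by blast
  from bchoice[OF this] obtain W where W: "\<And>s. s \<le> i \<Longrightarrow> prim_poly \<alpha> \<beta> i s = ?p * W s" by auto
  have conv_W: "gauss_conv (prim_poly \<alpha> \<beta> i) i n v = ?p * gauss_conv W i n v" for n v
    by (rule gauss_conv_mult) (rule W)
  define w where "w = (\<Sum>u\<le>i. scale (poly (W u) (q ^ 1)) (bvec (0 + 1 * u, 0 + 1 * (i - u))))"
  have r: "0 + 1 * i \<le> ?a" "0 + 1 * i \<le> ?b" by auto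
  note C = step_op_conv[OF tstep_step_op[of ?a ?b q] power_0 r, where W = W, folded w_def]
  have "(tstep ?a ?b q ^^ Suc (\<alpha> + \<beta>)) w = 0"
  proof (rule poly_mapping_eqI, rule ccontr)
    fix p assume "Poly_Mapping.lookup ((tstep ?a ?b q ^^ Suc (\<alpha> + \<beta>)) w) p \<noteq> Poly_Mapping.lookup 0 p"
    then have nz: "Poly_Mapping.lookup ((tstep ?a ?b q ^^ Suc (\<alpha> + \<beta>)) w) (fst p, snd p) \<noteq> 0" by simp
    from C(2)[OF nz] obtain v where v: "v \<le> i + Suc (\<alpha> + \<beta>)" "v \<le> ?a" "i + Suc (\<alpha> + \<beta>) - v \<le> ?b"
      "fst p = 0 + 1 * v" "snd p = 0 + 1 * (i + Suc (\<alpha> + \<beta>) - v)" by auto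
    have "gauss_conv (prim_poly \<alpha> \<beta> i) i (\<alpha> + \<beta> + 1) v = (0 :: 'k poly)"
      by (rule gauss_conv_prim_eq_0) (use v in auto)
    then have "?p * gauss_conv W i (\<alpha> + \<beta> + 1) v = 0" by (simp only: conv_W)
    then have "gauss_conv W i (\<alpha> + \<beta> + 1) v = 0" by simp
    moreover have "Poly_Mapping.lookup ((tstep ?a ?b q ^^ Suc (\<alpha> + \<beta>)) w) (fst p, snd p) =
        poly (gauss_conv W i (Suc (\<alpha> + \<beta>)) v) (q ^ 1)"
      unfolding v(4,5) by (rule C(1)) (use v in auto)
    ultimately show False using nz by simp
  qed
  moreover have "(tstep ?a ?b q ^^ (\<alpha> + \<beta>)) w \<noteq> 0"
  proof
    assume z: "(tstep ?a ?b q ^^ (\<alpha> + \<beta>)) w = 0"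
    have "Poly_Mapping.lookup ((tstep ?a ?b q ^^ (\<alpha> + \<beta>)) w) (0 + 1 * ?a, 0 + 1 * (i + (\<alpha> + \<beta>) - ?a)) =
        poly (gauss_conv W i (\<alpha> + \<beta>) ?a) (q ^ 1)"
      by (rule C(1)) auto
    then have c: "poly (gauss_conv W i (\<alpha> + \<beta>) ?a) q = 0" by (simp add: z)
    obtain k l where kl: "qX ^ k * gauss_conv (prim_poly \<alpha> \<beta> i) i (\<alpha> + \<beta>) ?a = (-1) ^ i * (qX ^ l * ?g)"
      by (rule gauss_conv_prim_eq_gauss)
    have "?g \<noteq> 0" by (simp add: gauss_nonzero)
    \<comment> \<open>The cofactor g' does not vanish at \<open>q\<close>. After the common power of
      X - q is cancelled it is, up to units at \<open>q\<close>, the coefficient at the end of the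
      chain.\<close>
    from order_decomp[OF this, of q] obtain g' where g': "?g = ?p * g'" "\<not> [:- q, 1:] dvd g'"
      unfolding \<mu>_def by blast
    have E: "?p * (qX ^ k * gauss_conv W i (\<alpha> + \<beta>) ?a) = ?p * ((-1) ^ i * (qX ^ l * g'))"
      using kl unfolding conv_W g'(1) by (simp only: mult_ac)
    have "?p \<noteq> 0" by simp
    from mult_left_cancel[OF this, THEN iffD1, OF E]
    have "qX ^ k * gauss_conv W i (\<alpha> + \<beta>) ?a = (-1) ^ i * (qX ^ l * g')" .
    then have "poly (qX ^ k * gauss_conv W i (\<alpha> + \<beta>) ?a) q = poly ((-1) ^ i * (qX ^ l * g')) q" by simp
    then have "poly g' q = 0" using c q_nonzero by simp
    then show False using g'(2) by (simp add: poly_eq_0_iff_dvd)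
  qed
  moreover have "w \<in> homog (V 0 ?a \<otimes>\<^bsub>q\<^esub> V 0 ?b) tdeg (int i)"
    using homog_vector[OF r] unfolding w_def by simp
  ultimately show ?thesis by blast
qed

lemma poly_qint_1: "poly (qint qX n) 1 = (of_nat n :: 'k)"
  by (simp add: qint_def poly_sum)

lemma poly_qfact_1: "poly (qfact qX n) 1 \<noteq> (0 :: 'k)"
  by (simp add: qfact_def poly_prod poly_qint_1)

text \<open>At X = 1 the q-factorials are ordinary factorials, nonzero in characteristic 0. This
  keeps the end of a classical chain nonzero.\<close>

lemma poly_gauss_1: "r \<le> n \<Longrightarrow> poly (gauss n r) 1 \<noteq> (0 :: 'k)"
  using gauss_mult[of r n, where 'k='k] poly_qfact_1[of n] by (metis mult_zero_left poly_mult)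

text \<open>Here \<open>w\<close> is \<open>x^s0 y^t0\<close> times a classical primitive vector in \<open>x^d\<close> and \<open>y^d\<close>, since \<open>N\<^sup>d\<close> acts on
  the residue class of \<open>(s0, t0)\<close> as multiplication by \<open>x^d + y^d\<close> on
  \<open>k[x^d, y^d] / (x^(d (\<alpha>+1)), y^(d (\<beta>+1)))\<close>.\<close>

lemma block_chain:
  assumes a: "s0 + d * \<alpha> \<le> a" "a < s0 + d * Suc \<alpha>" and b: "t0 + d * \<beta> \<le> b" "b < t0 + d * Suc \<beta>"
    and k: "k \<le> \<alpha>" "k \<le> \<beta>" and r: "r < d" "s0 + r + d * \<alpha> \<le> a" "t0 + (d - 1 - r) + d * \<beta> \<le> b"
    and L: "L = (\<alpha> - k + (\<beta> - k)) * d + (d - 1)"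
  shows "\<exists>w\<in>homog (V 0 a \<otimes>\<^bsub>q\<^esub> V 0 b) tdeg (int (s0 + t0 + d * k)).
     (tstep a b q ^^ L) w \<noteq> 0 \<and> (tstep a b q ^^ Suc L) w = 0"
proof -
  let ?N = "tstep a b q"
  let ?M = "tstep a b q ^^ d"
  define \<alpha>' \<beta>' where "\<alpha>' = \<alpha> - k" and "\<beta>' = \<beta> - k"
  have \<alpha>: "\<alpha> = \<alpha>' + k" and \<beta>: "\<beta> = \<beta>' + k" using k by (auto simp: \<alpha>'_def \<beta>'_def)
  have lin: "lin ?N" by (simp add: tstep_def linear_lin_ext)
  have Dk: "d * k \<le> d * \<alpha>" "d * k \<le> d * \<beta>" using k by auto
  have rg: "s0 + d * k \<le> a" "t0 + d * k \<le> b" using a(1) b(1) Dk by linarith+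
  define W where "W = (prim_poly \<alpha>' \<beta>' k :: nat \<Rightarrow> 'k poly)"
  define w where "w = (\<Sum>u\<le>k. scale (poly (W u) (1 ^ d)) (bvec (s0 + d * u, t0 + d * (k - u))))"
  note C = step_op_conv[OF tstep_power_step_op[of a b] power_one rg, where W = W, folded w_def]
  \<comment> \<open>\<alpha> and \<beta> are the largest exponents of x^d and y^d that survive the
    truncation in this residue class.\<close>
  have v\<alpha>: "v \<le> \<alpha>" if "s0 + d * v \<le> a" for v
  proof -
    have "d * v < d * Suc \<alpha>" using that a(2) by linarith
    then show ?thesis by (metis mult_less_cancel1 less_Suc_eq_le)
  qed
  have v\<beta>: "v \<le> \<beta>" if "t0 + d * v \<le> b" for v
  proof -
    have "d * v < d * Suc \<beta>" using that b(2) by linarith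
    then show ?thesis by (metis mult_less_cancel1 less_Suc_eq_le)
  qed
  have "(?M ^^ Suc (\<alpha>' + \<beta>')) w = 0"
  proof (rule poly_mapping_eqI, rule ccontr)
    fix p assume "Poly_Mapping.lookup ((?M ^^ Suc (\<alpha>' + \<beta>')) w) p \<noteq> Poly_Mapping.lookup 0 p"
    then have nz: "Poly_Mapping.lookup ((?M ^^ Suc (\<alpha>' + \<beta>')) w) (fst p, snd p) \<noteq> 0" by simp
    from C(2)[OF nz] obtain v where v: "v \<le> k + Suc (\<alpha>' + \<beta>')" "s0 + d * v \<le> a"
      "t0 + d * (k + Suc (\<alpha>' + \<beta>') - v) \<le> b"
      "fst p = s0 + d * v" "snd p = t0 + d * (k + Suc (\<alpha>' + \<beta>') - v)" by auto
    have "gauss_conv W k (\<alpha>' + \<beta>' + 1) v = 0"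
      unfolding W_def by (rule gauss_conv_prim_eq_0) (use v\<alpha>[OF v(2)] v\<beta>[OF v(3)] v(1) \<alpha> \<beta> in auto)
    moreover have "Poly_Mapping.lookup ((?M ^^ Suc (\<alpha>' + \<beta>')) w) (fst p, snd p) =
        poly (gauss_conv W k (Suc (\<alpha>' + \<beta>')) v) (1 ^ d)"
      unfolding v(4,5) by (rule C(1)) (use v in auto)
    ultimately show False using nz by simp
  qed
  moreover have SL: "Suc L = d * Suc (\<alpha>' + \<beta>')"
    using L d by (simp add: \<alpha>'_def \<beta>'_def algebra_simps)
  ultimately have 1: "(?N ^^ Suc L) w = 0" by (simp only: funpow_mult)
  have 2: "(?N ^^ L) w \<noteq> 0"
  proof
    assume z: "(?N ^^ L) w = 0"
    define y where "y = (?M ^^ (\<alpha>' + \<beta>')) w"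
    have "L = (d - 1) + d * (\<alpha>' + \<beta>')" using L by (simp add: \<alpha>'_def \<beta>'_def algebra_simps)
    then have Ly: "(?N ^^ L) w = (?N ^^ (d - 1)) y"
      by (simp only: y_def funpow_mult funpow_add o_apply)
    \<comment> \<open>(?s, ?t) is the point of largest first coordinate in the support of y. The
      target lies r steps further in the first direction and d - 1 - r in the second, still inside
      the truncation.\<close>
    let ?s = "s0 + d * \<alpha>" and ?t = "t0 + d * \<beta>'"
    let ?s' = "s0 + r + d * \<alpha>" and ?t' = "t0 + (d - 1 - r) + d * \<beta>'"
    have D\<beta>: "d * \<beta>' \<le> d * \<beta>" using \<beta> by simp
    have ts: "?t \<le> b" "?t' \<le> b" using b(1) r(3) D\<beta> by linarith+
    have yv: "\<exists>v\<le>\<alpha>. p = (s0 + d * v, t0 + d * (k + (\<alpha>' + \<beta>') - v)) \<and> fst p \<le> a \<and> snd p \<le> b"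
      if "p \<in> Poly_Mapping.keys y" for p
    proof -
      have "Poly_Mapping.lookup ((?M ^^ (\<alpha>' + \<beta>')) w) (fst p, snd p) \<noteq> 0"
        using that by (simp add: y_def in_keys_iff)
      from C(2)[OF this] show ?thesis using v\<alpha> by (metis prod.collapse)
    qed
    have y0: "Poly_Mapping.lookup y (?s, ?t) = poly (gauss_conv W k (\<alpha>' + \<beta>') \<alpha>) 1"
    proof -
      have "k + (\<alpha>' + \<beta>') - \<alpha> = \<beta>'" using \<alpha> by simp
      then show ?thesis using C(1)[of \<alpha> "\<alpha>' + \<beta>'"] \<alpha> a(1) ts by (simp add: y_def)
    qed
    have "0 = Poly_Mapping.lookup ((?N ^^ (d - 1)) y) (?s', ?t')" using z Ly by simp
    also have "\<dots> = (\<Sum>p\<in>Poly_Mapping.keys y. Poly_Mapping.lookup y p * Poly_Mapping.lookup ((?N ^^ (d - 1)) (bvec p)) (?s', ?t'))"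
      by (subst lin_expand[OF lin_funpow[OF lin]]) (simp add: lookup_sum)
    also have "\<dots> = (\<Sum>p\<in>Poly_Mapping.keys y. if p = (?s, ?t) then
        Poly_Mapping.lookup y (?s, ?t) * (q ^ (?s * (d - 1 - r)) * poly (gauss (d - 1) r) q) else 0)"
    proof (rule sum.cong[OF refl])
      fix p assume p: "p \<in> Poly_Mapping.keys y"
      from yv[OF p] obtain v where v: "v \<le> \<alpha>" "p = (s0 + d * v, t0 + d * (k + (\<alpha>' + \<beta>') - v))"
        "s0 + d * v \<le> a" "t0 + d * (k + (\<alpha>' + \<beta>') - v) \<le> b" by auto
      show "Poly_Mapping.lookup y p * Poly_Mapping.lookup ((?N ^^ (d - 1)) (bvec p)) (?s', ?t') =
         (if p = (?s, ?t) then Poly_Mapping.lookup y (?s, ?t) * (q ^ (?s * (d - 1 - r)) * poly (gauss (d - 1) r) q) else 0)"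
      proof (cases "v = \<alpha>")
        case True
        have "k + (\<alpha>' + \<beta>') - \<alpha> = \<beta>'" using \<alpha> by simp
        then have p: "p = (?s, ?t)" using v(2) True by simp
        have "Poly_Mapping.lookup ((?N ^^ (d - 1)) (bvec (?s, ?t))) (?s', ?t') =
            q ^ (?s * (d - 1 - r)) * poly (gauss (d - 1) r) q"
        proof -
          have c: "?s \<le> ?s' \<and> ?t \<le> ?t' \<and> ?s' + ?t' = ?s + ?t + (d - 1) \<and> ?s' \<le> a \<and> ?t' \<le> b"
            using r(1,2) ts(2) by auto
          have "?t' - ?t = d - 1 - r" "?s' - ?s = r" by auto
          then show ?thesis unfolding lookup_tstep_power[OF a(1) ts(1)] if_P[OF c] by (simp only:)
        qed
        then show ?thesis unfolding p by simp
      next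
        case False
        then have "Suc v \<le> \<alpha>" using v(1) by simp
        then have "d * Suc v \<le> d * \<alpha>" by (rule mult_le_mono2)
        \<comment> \<open>The support of y has spacing d, so every other point is at least d steps
          away in the first coordinate and out of reach of d - 1 steps.\<close>
        then have "?s' - (s0 + d * v) \<ge> d" by simp
        then have "Poly_Mapping.lookup ((?N ^^ (d - 1)) (bvec p)) (?s', ?t') = 0"
          unfolding v(2) lookup_tstep_power[OF v(3,4)] using d by (intro if_not_P) linarith
        moreover have "p \<noteq> (?s, ?t)" using v(2) False d by auto
        ultimately show ?thesis by simp
      qed
    qed
    also have "\<dots> = Poly_Mapping.lookup y (?s, ?t) * (q ^ (?s * (d - 1 - r)) * poly (gauss (d - 1) r) q)"
      by (auto simp: in_keys_iff)
    finally have "poly (gauss_conv W k (\<alpha>' + \<beta>') (\<alpha>' + k)) 1 = 0"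
      using y0 q_nonzero gauss_below_d[of r "d - 1"] r(1) by (simp add: \<alpha>)
    moreover obtain k' l where "qX ^ k' * gauss_conv (prim_poly \<alpha>' \<beta>' k) k (\<alpha>' + \<beta>') (\<alpha>' + k) =
        (-1) ^ k * (qX ^ l * (gauss (\<alpha>' + \<beta>') \<alpha>' :: 'k poly))" by (rule gauss_conv_prim_eq_gauss)
    then have "poly (qX ^ k' * gauss_conv (prim_poly \<alpha>' \<beta>' k) k (\<alpha>' + \<beta>') (\<alpha>' + k)) 1 =
        poly ((-1) ^ k * (qX ^ l * (gauss (\<alpha>' + \<beta>') \<alpha>' :: 'k poly))) 1" by simp
    ultimately show False using poly_gauss_1[of \<alpha>' "\<alpha>' + \<beta>'"] by (simp add: W_def)
  qed
  have "w \<in> homog (V 0 a \<otimes>\<^bsub>q\<^esub> V 0 b) tdeg (int (s0 + t0 + d * k))"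
    unfolding w_def by (rule homog_vector[OF rg])
  then show ?thesis using 1 2 by blast
qed

end

section \<open>Lengths of the chains\<close>

text \<open>The chain that starts in degree \<open>k d + p\<close> ends in degree \<open>a + b - (k d + p')\<close>, where \<open>p'\<close> is this
  mirror image of the last digit \<open>p\<close>.  Fixed digits give generic chains, the others give block
  chains.\<close>

definition mirror_digit :: "int \<Rightarrow> int \<Rightarrow> int \<Rightarrow> int \<Rightarrow> int" where
  "mirror_digit d f h p =
    (if p \<le> f + h + 1 - d then f + h + 1 - d - p
     else if min f h < p \<and> p \<le> max f h then f + h + 1 - p
     else if f + h + 2 \<le> p then f + h + 1 + d - p
     else p)"

text \<open>The ranges {0..f+h+1-d}, {min f h + 1..max f h} and {f+h+2..d-1} are disjoint, and each
  is reflected onto itself. The last claim serves the incomplete block k = e, whose digits are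
  0..f.\<close>

lemma mirror_digit:
  assumes "0 \<le> f" "f < d" "0 \<le> h" "h < d" "0 \<le> p" "p < d"
  shows "0 \<le> mirror_digit d f h p" "mirror_digit d f h p < d"
    and "mirror_digit d f h (mirror_digit d f h p) = p"
    and mirror_digit_le: "p \<le> f \<Longrightarrow> mirror_digit d f h p \<le> f"
  using assms by (auto simp: mirror_digit_def)

text \<open>This supplies the hypothesis of \<open>generic_chain\<close>. Adding s and i - s gives v
  + v' = p without a carry, or p + d with one. Each floor on the right is at most one below m - k +
  B or e - B. If p \<le> min f h, the first never drops, and the second drops only with a carry. If
  max f h < p \<le> f + h + 1, the floor on the left is smaller by one, and both cannot drop without
  a carry, since v > f forces h - p + v \<ge> 0.\<close>

lemma generic_digit_floor:
  fixes d e m f h k p s B v C v' :: int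
  assumes fh: "0 \<le> f" "f < d" "0 \<le> h" "h < d" and p: "0 \<le> p" "p < d"
    and s: "s = d * B + v" "0 \<le> v" "v < d" and s': "k * d + p - s = d * C + v'" "0 \<le> v'" "v' < d"
    and gen: "p \<le> min f h \<and> f + h + 1 - d < p \<or> max f h < p \<and> p \<le> f + h + 1"
  shows "(e * d + f + (m * d + h) - 2 * (k * d + p)) div d + B + C \<le>
     (m * d + h - (k * d + p) + s) div d + (e * d + f - s) div d"
proof -
  have d: "d > 0" using fh by simp
  have lower: "n \<le> x div d" if "d * n \<le> x" for x n
  proof -
    have "d * n div d \<le> x div d" using that d by (rule zdiv_mono1)
    then show ?thesis using d by simp
  qed
  have upper: "x div d \<le> n" if "x < d * (n + 1)" for x n
  proof -
    have "d * (x div d) \<le> x" using d by (simp add: mult_div_mod_eq[symmetric] flip: minus_mod_eq_mult_div)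
    then have "d * (x div d) < d * (n + 1)" using that by simp
    then show ?thesis using d by (simp add: mult_less_cancel_left_pos)
  qed
  have BC: "d * (k - B - C) = v + v' - p" using s s' by (simp add: algebra_simps)
  have "k - B - C < 2"
  proof (rule ccontr)
    assume "\<not> k - B - C < 2"
    then have "d * 2 \<le> d * (k - B - C)" using d by (intro mult_left_mono) auto
    then show False using BC s s' p by simp
  qed
  moreover have "k - B - C > -1"
  proof (rule ccontr)
    assume "\<not> k - B - C > -1"
    then have "d * (k - B - C) \<le> d * (-1)" using d by (intro mult_left_mono) auto
    then show False using BC s s' p by simp
  qed
  ultimately have k: "k - B - C = 0 \<and> v + v' = p \<or> k - B - C = 1 \<and> v + v' = p + d"
    using BC by (cases "k - B - C = 0"; cases "k - B - C = 1") auto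
  have E0: "m - k + B \<le> (m * d + h - (k * d + p) + s) div d" if "0 \<le> h - p + v"
    by (rule lower) (use that s in \<open>simp add: algebra_simps\<close>)
  have E1: "m - k + B - 1 \<le> (m * d + h - (k * d + p) + s) div d"
    by (rule lower) (use fh p s in \<open>simp add: algebra_simps\<close>)
  have F0: "e - B \<le> (e * d + f - s) div d" if "v \<le> f"
    by (rule lower) (use that s in \<open>simp add: algebra_simps\<close>)
  have F1: "e - B - 1 \<le> (e * d + f - s) div d"
    by (rule lower) (use fh s in \<open>simp add: algebra_simps\<close>)
  from gen show ?thesis
  proof
    assume g: "p \<le> min f h \<and> f + h + 1 - d < p"
    have "(e * d + f + (m * d + h) - 2 * (k * d + p)) div d \<le> e + m - 2 * k"
      by (rule upper) (use g p in \<open>simp add: algebra_simps\<close>)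
    then show ?thesis using k E0 F0 F1 g s s' p by linarith
  next
    assume g: "max f h < p \<and> p \<le> f + h + 1"
    have "(e * d + f + (m * d + h) - 2 * (k * d + p)) div d \<le> e + m - 2 * k - 1"
      by (rule upper) (use g p in \<open>simp add: algebra_simps\<close>)
    then show ?thesis using k E0 E1 F0 F1 g s s' p by linarith
  qed
qed

context root_of_unity
begin

text \<open>For a block chain p is split as s0 + t0. A residue s0 \<le> f allows e as the largest
  exponent of x^d, a residue s0 > f only e - 1; likewise t0 with h and m. The split is chosen to
  produce the prescribed length.\<close>

lemma digit_chain:
  assumes fh: "f < d" "h < d" and ab: "e * d + f \<le> m * d + h" and p: "p < d" and i: "k * d + p \<le> e * d + f"
    and L: "int L = int (e * d + f) + int (m * d + h) - 2 * int d * int k - int p - mirror_digit (int d) (int f) (int h) (int p)"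
  shows "\<exists>w\<in>homog (V 0 (e * d + f) \<otimes>\<^bsub>q\<^esub> V 0 (m * d + h)) tdeg (int (k * d + p)).
     (tstep (e * d + f) (m * d + h) q ^^ L) w \<noteq> 0 \<and> (tstep (e * d + f) (m * d + h) q ^^ Suc L) w = 0"
proof -
  let ?a = "e * d + f" and ?b = "m * d + h"
  have le: "x \<le> y" if "x * d + u \<le> y * d + v" "v < d" for x y u v
  proof -
    have "x * d < Suc y * d" using that by simp
    then show ?thesis by (metis mult_less_cancel2 less_Suc_eq_le)
  qed
  have less: "x < y" if "x * d + u \<le> y * d + v" "v < u" for x y u v
  proof -
    have "x * d < y * d" using that by linarith
    then show ?thesis by (metis mult_less_cancel2)
  qed
  have ke: "k \<le> e" by (rule le[OF i fh(1)])
  have em: "e \<le> m" by (rule le[OF ab fh(2)])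
  note km = le_trans[OF ke em]
  consider (top) "int p \<le> int f + int h + 1 - int d"
    | (mid1) "f < p" "p \<le> h" "int f + int h + 1 - int d < int p"
    | (mid2) "h < p" "p \<le> f" "int f + int h + 1 - int d < int p"
    | (bot) "f + h + 2 \<le> p"
    | (gen) "p \<le> min f h \<and> int f + int h + 1 - int d < int p \<or> max f h < p \<and> p \<le> f + h + 1"
    by linarith
  then show ?thesis
  proof cases
    case top
    obtain x y where xy: "e = k + x" "m = k + y" using ke km by (metis le_add_diff_inverse)
    have "p \<le> f" "d - 1 - (f - p) \<le> h" using top fh by linarith+
    moreover have "L = (e - k + (m - k)) * d + (d - 1)"
    proof -
      have "int L = int ((e - k + (m - k)) * d + (d - 1))"
        unfolding L using top d by (simp add: mirror_digit_def xy of_nat_diff algebra_simps)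
      then show ?thesis by (simp only: of_nat_eq_iff)
    qed
    \<comment> \<open>With s0 = p and t0 = 0, f - p further steps remain in x and h in y. Together
      these are at least d - 1 exactly because p \<le> f + h + 1 - d.\<close>
    ultimately show ?thesis
      using block_chain[of p e ?a 0 m ?b k "f - p" L] p fh ke km by (simp add: algebra_simps)
  next
    case mid1
    have "k < e" by (rule less[OF i mid1(1)])
    then obtain x y where xy: "e = Suc (k + x)" "m = k + y" using km by (metis le_add_diff_inverse less_iff_Suc_add)
    have "L = (k + x - k + (m - k)) * d + (d - 1)"
    proof -
      have "int L = int ((k + x - k + (m - k)) * d + (d - 1))"
        unfolding L using mid1 d by (simp add: mirror_digit_def xy of_nat_diff algebra_simps)
      then show ?thesis by (simp only: of_nat_eq_iff)
    qed
    \<comment> \<open>s0 = p exceeds f, so the largest exponent of x^d is e - 1 = k + x.\<close>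
    then show ?thesis
      using block_chain[of p "k + x" ?a 0 m ?b k "d - 1 - p" L] p fh km mid1 by (simp add: xy(1) algebra_simps)
  next
    case mid2
    have "e < m" by (rule less[OF ab]) (use mid2 in simp)
    then obtain x y where xy: "e = k + x" "m = Suc (k + y)" using ke
      by (metis le_add_diff_inverse less_iff_Suc_add add.assoc)
    have "L = (e - k + (k + y - k)) * d + (d - 1)"
    proof -
      have "int L = int ((e - k + (k + y - k)) * d + (d - 1))"
        unfolding L using mid2 d by (simp add: mirror_digit_def xy of_nat_diff algebra_simps)
      then show ?thesis by (simp only: of_nat_eq_iff)
    qed
    then show ?thesis
      using block_chain[of 0 e ?a p "k + y" ?b k p L] p fh ke mid2 by (simp add: xy(2) algebra_simps)
  next
    case bot
    have "k < e" by (rule less[OF i]) (use bot in simp)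
    then obtain x y where xy: "e = Suc (k + x)" "m = Suc (k + y)" using em
      by (metis less_iff_Suc_add less_le_trans)
    have R: "mirror_digit (int d) (int f) (int h) (int p) = int f + int h + 1 + int d - int p"
      using bot p by (auto simp: mirror_digit_def)
    have "L = (k + x - k + (k + y - k)) * d + (d - 1)"
    proof -
      have "int L = int ((k + x - k + (k + y - k)) * d + (d - 1))"
        unfolding L R using d by (simp add: xy of_nat_diff algebra_simps)
      then show ?thesis by (simp only: of_nat_eq_iff)
    qed
    \<comment> \<open>Here s0 = f + 1 and t0 = p - f - 1 > h, so both exponents lose one.\<close>
    then show ?thesis
      using block_chain[of "f + 1" "k + x" ?a "p - f - 1" "k + y" ?b k "d - 1 - (f + 1)" L] p fh bot
      by (simp add: xy algebra_simps)
  next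
    case gen
    let ?i = "k * d + p"
    define \<alpha> \<beta> where "\<alpha> = ?a - ?i" and "\<beta> = ?b - ?i"
    have a: "?a = \<alpha> + ?i" and b: "?b = \<beta> + ?i" using i ab by (auto simp: \<alpha>_def \<beta>_def)
    have "mirror_digit (int d) (int f) (int h) (int p) = int p"
      using gen p fh by (auto simp: mirror_digit_def)
    then have "int L = int (\<alpha> + \<beta>)" unfolding L a b by (simp add: algebra_simps)
    then have L: "L = \<alpha> + \<beta>" by (simp only: of_nat_eq_iff)
    have "(\<alpha> + \<beta>) div d + s div d + (?i - s) div d \<le> (\<beta> + s) div d + (\<alpha> + ?i - s) div d" if s: "s \<le> ?i" for s
    proof -
      have 1: "int s = int d * int (s div d) + int (s mod d)" by (simp flip: of_nat_mult of_nat_add)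
      have 2: "int k * int d + int p - int s = int d * int ((?i - s) div d) + int ((?i - s) mod d)"
      proof -
        have "int k * int d + int p - int s = int (?i - s)" using s by (simp add: of_nat_diff)
        also have "\<dots> = int (d * ((?i - s) div d) + (?i - s) mod d)" by (simp only: mult_div_mod_eq)
        finally show ?thesis by (simp only: of_nat_add of_nat_mult)
      qed
      have "(int e * int d + int f + (int m * int d + int h) - 2 * (int k * int d + int p)) div int d + int (s div d) + int ((?i - s) div d) \<le>
         (int m * int d + int h - (int k * int d + int p) + int s) div int d + (int e * int d + int f - int s) div int d"
        by (rule generic_digit_floor[OF _ _ _ _ _ _ 1 _ _ 2]) (use fh p d gen in auto)
      moreover have "int e * int d + int f + (int m * int d + int h) - 2 * (int k * int d + int p) = int (\<alpha> + \<beta>)"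
        using i ab by (simp add: \<alpha>_def \<beta>_def of_nat_diff)
      moreover have "int m * int d + int h - (int k * int d + int p) + int s = int (\<beta> + s)"
        using i ab by (simp add: \<beta>_def of_nat_diff)
      moreover have "int e * int d + int f - int s = int (\<alpha> + ?i - s)"
        using i s by (simp add: \<alpha>_def of_nat_diff)
      ultimately have "int ((\<alpha> + \<beta>) div d + s div d + (?i - s) div d) \<le> int ((\<beta> + s) div d + (\<alpha> + ?i - s) div d)"
        by (simp only: zdiv_int of_nat_add)
      then show ?thesis by (simp only: of_nat_le_iff)
    qed
    from generic_chain[OF this] show ?thesis unfolding a b L .
  qed
qed

end

section \<open>The decomposition with integer parameters\<close>

locale tensor_digits =
  fixes q :: "'k::field_char_0" and d e m f h :: int
  assumes d: "d \<ge> 2" and q_d: "q ^ nat d = 1" and q_less: "\<forall>n::nat. 0 < n \<and> n < nat d \<longrightarrow> q ^ n \<noteq> 1"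
    and em: "e \<ge> 0" "m \<ge> 0" and f: "0 \<le> f" "f \<le> d - 1" and h: "0 \<le> h" "h \<le> d - 1"
    and ab: "e * d + f \<le> m * d + h"
begin

abbreviation "a \<equiv> e * d + f"
abbreviation "b \<equiv> m * d + h"

definition mirror :: "int \<Rightarrow> int" where
  "mirror i = i div d * d + mirror_digit d f h (i mod d)"

text \<open>\<open>nat\<close> does not truncate for 0 \<le> i \<le> a, since \<open>mirror\<close>
  i \<le> a \<le> b (see \<open>int_len\<close>).\<close>

definition len :: "int \<Rightarrow> nat" where
  "len i = nat (a + b - i - mirror i)"

sublocale root_of_unity q "nat d"
  by unfold_locales (use d q_d q_less in auto)

lemma div_mod_digit: "0 \<le> p \<Longrightarrow> p < d \<Longrightarrow> (k * d + p) div d = k" "0 \<le> p \<Longrightarrow> p < d \<Longrightarrow> (k * d + p) mod d = p"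
  using d by auto

lemma mirror_digit_mod: "0 \<le> mirror_digit d f h (i mod d)" "mirror_digit d f h (i mod d) < d"
  "mirror_digit d f h (mirror_digit d f h (i mod d)) = i mod d"
  using mirror_digit[of f d h "i mod d"] f h d by auto

lemma mirror_mirror: "mirror (mirror i) = i"
  unfolding mirror_def by (simp add: div_mod_digit mirror_digit_mod)

lemma mirror_range:
  assumes "0 \<le> i" "i \<le> a"
  shows "0 \<le> mirror i" "mirror i \<le> a"
proof -
  have "0 \<le> i div d" using assms d by (simp add: pos_imp_zdiv_nonneg_iff)
  then show "0 \<le> mirror i" unfolding mirror_def using mirror_digit_mod[of i] d by simp
  show "mirror i \<le> a"
  proof (cases "i div d < e")
    case True
    then have "(i div d + 1) * d \<le> e * d" using d by (intro mult_right_mono) auto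
    then show ?thesis unfolding mirror_def using mirror_digit_mod(2)[of i] f by (simp add: algebra_simps)
  next
    case False
    have "i div d \<le> a div d" using assms d by (intro zdiv_mono1) auto
    then have e: "i div d = e" using False f div_mod_digit(1)[of f e] by simp
    have "e * d + i mod d = i" unfolding e[symmetric] by simp
    then have "i mod d \<le> f" using assms(2) by linarith
    then have "mirror_digit d f h (i mod d) \<le> f"
      using f h d by (intro mirror_digit_le) auto
    then show ?thesis unfolding mirror_def e by simp
  qed
qed

lemma int_len: "0 \<le> i \<Longrightarrow> i \<le> a \<Longrightarrow> int (len i) = a + b - i - mirror i"
  unfolding len_def using mirror_range[of i] ab by simp

lemma bij_mirror: "bij_betw mirror {0..<a + 1} {0..<a + 1}"
  by (rule bij_betw_byWitness[where f' = mirror]) (auto simp: mirror_mirror mirror_range)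

text \<open>\<open>mirror\<close> permutes {0..a}, so i and \<open>mirror\<close> i have the same
  sum a (a + 1) / 2, and (a + b + 1) (a + 1) - a (a + 1) remains.\<close>

lemma sum_len: "(\<Sum>i\<in>{0..<a + 1}. Suc (len i)) = nat (a + 1) * nat (b + 1)"
proof -
  let ?S = "{0..<a + 1}"
  have a: "0 \<le> a" using em f d by simp
  then have b: "0 \<le> b" using ab by linarith
  have "(\<Sum>i\<in>?S. i) = (\<Sum>i\<in>?S. a - i)"
    by (rule sum.reindex_bij_witness[where i = "\<lambda>i. a - i" and j = "\<lambda>i. a - i"]) auto
  also have "\<dots> = a * (a + 1) - (\<Sum>i\<in>?S. i)"
    using a by (simp add: sum_subtractf)
  finally have s: "2 * (\<Sum>i\<in>?S. i) = a * (a + 1)" by simp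
  have "int (\<Sum>i\<in>?S. Suc (len i)) = (\<Sum>i\<in>?S. a + b + 1 - i - mirror i)"
    unfolding of_nat_sum by (rule sum.cong) (auto simp: int_len)
  also have "\<dots> = (a + b + 1) * (a + 1) - (\<Sum>i\<in>?S. i) - (\<Sum>i\<in>?S. mirror i)"
    using a by (simp add: sum_subtractf)
  also have "(\<Sum>i\<in>?S. mirror i) = (\<Sum>i\<in>?S. i)"
    by (rule sum.reindex_bij_betw[OF bij_mirror])
  also have "(a + b + 1) * (a + 1) - (\<Sum>i\<in>?S. i) - (\<Sum>i\<in>?S. i) = (a + 1) * (b + 1)"
    using s by (simp add: algebra_simps)
  also have "\<dots> = int (nat (a + 1) * nat (b + 1))" using a b by simp
  finally show ?thesis by (simp only: of_nat_eq_iff)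
qed

lemma chain_vector:
  assumes i: "0 \<le> i" "i \<le> a"
  shows "\<exists>w\<in>homog (V 0 (nat a) \<otimes>\<^bsub>q\<^esub> V 0 (nat b)) tdeg i.
     (tstep (nat a) (nat b) q ^^ len i) w \<noteq> 0 \<and> (tstep (nat a) (nat b) q ^^ Suc (len i)) w = 0"
proof -
  have na: "nat a = nat e * nat d + nat f" and nb: "nat b = nat m * nat d + nat h"
    using em f h d by (simp_all add: nat_add_distrib nat_mult_distrib)
  let ?k = "i div d" and ?p = "i mod d"
  have k: "0 \<le> ?k" using i d by (simp add: pos_imp_zdiv_nonneg_iff)
  have p: "0 \<le> ?p" "?p < d" using d by auto
  have ik: "nat i = nat ?k * nat d + nat ?p"
  proof -
    have "i = ?k * d + ?p" by simp
    then have "nat i = nat (?k * d + ?p)" by (rule arg_cong)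
    also have "\<dots> = nat ?k * nat d + nat ?p" using k p d by (simp only: nat_add_distrib nat_mult_distrib mult_nonneg_nonneg)
    finally show ?thesis .
  qed
  have ii: "int (nat i) = i" using i by simp
  have "int (len i) = int (nat a) + int (nat b) - 2 * int (nat d) * int (nat ?k) - int (nat ?p) -
      mirror_digit (int (nat d)) (int (nat f)) (int (nat h)) (int (nat ?p))"
  proof -
    have "a \<ge> 0" "b \<ge> 0" using i ab by linarith+
    moreover have "i = ?k * d + ?p" by simp
    ultimately have "a + b - i - mirror i = int (nat a) + int (nat b) - 2 * d * ?k - ?p - mirror_digit d f h ?p"
      unfolding mirror_def by (simp add: algebra_simps)
    then show ?thesis using int_len[OF i] d f h k p by simp
  qed
  moreover have "nat a \<le> nat b" "nat i \<le> nat a" using ab i by auto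
  ultimately show ?thesis
    using digit_chain[of "nat f" "nat h" "nat e" "nat m" "nat ?p" "nat ?k" "len i"] f h d p
    unfolding na[symmetric] nb[symmetric] ik[symmetric] ii by simp
qed

lemma tensor_iso:
  assumes "chain_decomp Y {0..<a + 1} len"
  shows "V 0 (nat a) \<otimes>\<^bsub>q\<^esub> V 0 (nat b) \<cong> Y"
proof -
  have "\<forall>i\<in>{0..<a + 1}. \<exists>w. w \<in> homog (V 0 (nat a) \<otimes>\<^bsub>q\<^esub> V 0 (nat b)) tdeg i \<and>
     (tstep (nat a) (nat b) q ^^ len i) w \<noteq> 0 \<and> (tstep (nat a) (nat b) q ^^ Suc (len i)) w = 0"
    using chain_vector by force
  from bchoice[OF this] obtain w where w: "\<forall>i\<in>{0..<a + 1}. w i \<in> homog (V 0 (nat a) \<otimes>\<^bsub>q\<^esub> V 0 (nat b)) tdeg i \<and>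
     (tstep (nat a) (nat b) q ^^ len i) (w i) \<noteq> 0 \<and> (tstep (nat a) (nat b) q ^^ Suc (len i)) (w i) = 0" by blast
  show ?thesis
  proof (rule chain_decomp_iso[OF tensor_graded_rep assms])
    \<comment> \<open>The end degree is a + b - \<open>mirror\<close> i, and an involution is
      injective.\<close>
    show "inj_on (\<lambda>i. i + int (len i)) {0..<a + 1}"
      by (rule inj_onI) (simp add: int_len, metis mirror_mirror)
    show "card (basis (V 0 (nat a) \<otimes>\<^bsub>q\<^esub> V 0 (nat b))) = (\<Sum>i\<in>{0..<a + 1}. Suc (len i))"
    proof -
      have "a \<ge> 0" using em f d by simp
      then have "b \<ge> 0" using ab by linarith
      then show ?thesis unfolding sum_len using \<open>a \<ge> 0\<close>
        by (simp add: tensor_comodule_def V_def card_cartesian_product nat_add_distrib)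
    qed
  qed (use w in blast)+
qed

text \<open>Reduces each inner sum of the theorem to a formula for \<open>mirror_digit\<close> on
  one range of digits.\<close>

lemma chain_decomp_digits:
  assumes "0 \<le> p" "r < d" "\<And>i. p \<le> i \<Longrightarrow> i \<le> r \<Longrightarrow> l i = a + b - 2 * k * d - i - mirror_digit d f h i"
    and "x = k * d + p" "y = k * d + r + 1"
  shows "chain_decomp (dsum {p..r} (\<lambda>i. V (k * d + i) (nat (l i)))) {x..<y} len"
proof (rule chain_decomp_dsum_V)
  fix i assume i: "p \<le> i" "i \<le> r"
  have "a + b - (k * d + i) - mirror (k * d + i) = l i"
    using i assms(1,2) by (simp add: assms(3)[OF i] mirror_def div_mod_digit algebra_simps)
  then show "nat (l i) = len (k * d + i)" by (simp only: len_def)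
qed (use assms in auto)

end

lemma chain_decomp_four:
  assumes "chain_decomp A {x0..<x1} L" "chain_decomp B {x1..<x2} L" "chain_decomp C {x2..<x3} L" "chain_decomp D {x3..<x4} L"
    and "x0 \<le> x1" "x1 \<le> x2" "x2 \<le> x3" "x3 \<le> x4"
  shows "chain_decomp (A \<oplus> B \<oplus> C \<oplus> D) {x0..<x4} L"
  using assms by (intro chain_decomp_sum_ivl[where y = x3] chain_decomp_sum_ivl[where y = x2] chain_decomp_sum_ivl[where y = x1]) auto

theorem theorem4p12:
  fixes q :: "'k::{alg_closed_field, field_char_0}" and d e m f h \<gamma> :: int
  assumes "d \<ge> 2"
    and "q ^ nat d = 1" and "\<forall>n::nat. 0 < n \<and> n < nat d \<longrightarrow> q ^ n \<noteq> 1"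
    and "e \<ge> 0" and "m \<ge> 0"
    and "0 \<le> f" and "f \<le> d - 1" and "0 \<le> h" and "h \<le> d - 1"
    and "e * d + f \<le> m * d + h"
    and "\<gamma> = f + h - d + 1"
  shows
   "(0 \<le> f \<and> f \<le> h \<and> f + h < d - 1 \<longrightarrow>
      V 0 (nat (e*d + f)) \<otimes>\<^bsub>q\<^esub> V 0 (nat (m*d + h)) \<cong>
        dsum {0..e-1} (\<lambda>k.
            dsum {0..f} (\<lambda>i. V (k*d + i) (nat ((e + m - 2*k)*d + f + h - 2*i)))
          \<oplus> dsum {f+1..h} (\<lambda>j. V (k*d + j) (nat ((e + m - 2*k)*d - 1)))
          \<oplus> dsum {h+1..f+h+1} (\<lambda>r. V (k*d + r) (nat ((e + m - 2*k)*d + h + f - 2*r)))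
          \<oplus> dsum {f+h+2..d-1} (\<lambda>s. V (k*d + s) (nat ((e + m - 1 - 2*k)*d - 1))))
        \<oplus> dsum {0..f} (\<lambda>i. V (e*d + i) (nat ((m - e)*d + h + f - 2*i))))
    \<and>
    (0 < f \<and> f \<le> h \<and> h < d \<and> f + h \<ge> d \<longrightarrow>
      V 0 (nat (e*d + f)) \<otimes>\<^bsub>q\<^esub> V 0 (nat (m*d + h)) \<cong>
        dsum {0..e-1} (\<lambda>k.
            dsum {0..\<gamma>} (\<lambda>i. V (k*d + i) (nat ((e + m - 2*k)*d + d - 1)))
          \<oplus> dsum {\<gamma>+1..f} (\<lambda>j. V (k*d + j) (nat ((e + m - 2*k)*d + f + h - 2*j)))
          \<oplus> dsum {f+1..h} (\<lambda>r. V (k*d + r) (nat ((e + m - 2*k)*d - 1)))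
          \<oplus> dsum {h+1..d-1} (\<lambda>s. V (k*d + s) (nat ((e + m - 2*k)*d + h + f - 2*s))))
        \<oplus> dsum {0..\<gamma>} (\<lambda>i. V (e*d + i) (nat ((m - e)*d + d - 1)))
        \<oplus> dsum {\<gamma>+1..f} (\<lambda>i. V (e*d + i) (nat ((m - e)*d + f + h - 2*i))))
    \<and>
    (0 \<le> h \<and> h < f \<and> f < d \<and> f + h < d - 1 \<longrightarrow>
      V 0 (nat (e*d + f)) \<otimes>\<^bsub>q\<^esub> V 0 (nat (m*d + h)) \<cong>
        dsum {0..e-1} (\<lambda>k.
            dsum {0..h} (\<lambda>i. V (k*d + i) (nat ((e + m - 2*k)*d + h + f - 2*i)))
          \<oplus> dsum {h+1..f} (\<lambda>j. V (k*d + j) (nat ((e + m - 2*k)*d - 1)))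
          \<oplus> dsum {f+1..h+f+1} (\<lambda>r. V (k*d + r) (nat ((e + m - 2*k)*d + h + f - 2*r)))
          \<oplus> dsum {f+h+2..d-1} (\<lambda>s. V (k*d + s) (nat ((e + m - 1 - 2*k)*d - 1))))
        \<oplus> dsum {0..h} (\<lambda>i. V (e*d + i) (nat ((m - e)*d + h + f - 2*i)))
        \<oplus> dsum {h+1..f} (\<lambda>i. V (e*d + i) (nat ((m - e)*d - 1))))
    \<and>
    (0 < h \<and> h < f \<and> f < d \<and> f + h \<ge> d \<longrightarrow>
      V 0 (nat (e*d + f)) \<otimes>\<^bsub>q\<^esub> V 0 (nat (m*d + h)) \<cong>
        dsum {0..e-1} (\<lambda>k.
            dsum {0..\<gamma>} (\<lambda>i. V (k*d + i) (nat ((e + m - 2*k)*d + d - 1)))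
          \<oplus> dsum {\<gamma>+1..h} (\<lambda>j. V (k*d + j) (nat ((e + m - 2*k)*d + f + h - 2*j)))
          \<oplus> dsum {h+1..f} (\<lambda>r. V (k*d + r) (nat ((e + m - 2*k)*d - 1)))
          \<oplus> dsum {f+1..d-1} (\<lambda>s. V (k*d + s) (nat ((e + m - 2*k)*d + h + f - 2*s))))
        \<oplus> dsum {0..\<gamma>} (\<lambda>i. V (e*d + i) (nat ((m - e)*d + d - 1)))
        \<oplus> dsum {\<gamma>+1..h} (\<lambda>i. V (e*d + i) (nat ((m - e)*d + f + h - 2*i)))
        \<oplus> dsum {h+1..f} (\<lambda>i. V (e*d + i) (nat ((m - e)*d - 1))))"
proof -
  interpret tensor_digits q d e m f h
    by unfold_locales (use assms in auto)
  have d0: "d > 0" using d by simp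
  have \<gamma>: "\<gamma> = f + h + 1 - d" using assms(11) by simp
  show ?thesis
  \<comment> \<open>In each case the four inner ranges tile the digits of a full block k < e, and
    the outer sums cover the digits 0..f of block e. For f + h < d - 1 the first reflected range of
    \<open>mirror_digit\<close> contains no digit, for f + h \<ge> d the last one contains
    none.\<close>
  proof (intro conjI impI; rule tensor_iso)
    assume c: "0 \<le> f \<and> f \<le> h \<and> f + h < d - 1"
    have I1: "chain_decomp (dsum {0..f} (\<lambda>i. V (k*d + i) (nat ((e + m - 2*k)*d + f + h - 2*i)))) {k*d..<k*d + (f+1)} len" for k
      by (rule chain_decomp_digits) (use c f h \<gamma> in \<open>auto simp: mirror_digit_def algebra_simps\<close>)
    have I2: "chain_decomp (dsum {f+1..h} (\<lambda>j. V (k*d + j) (nat ((e + m - 2*k)*d - 1)))) {k*d + (f+1)..<k*d + (h+1)} len" for k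
      by (rule chain_decomp_digits) (use c f h \<gamma> in \<open>auto simp: mirror_digit_def algebra_simps\<close>)
    have I3: "chain_decomp (dsum {h+1..f+h+1} (\<lambda>r. V (k*d + r) (nat ((e + m - 2*k)*d + h + f - 2*r)))) {k*d + (h+1)..<k*d + (f+h+2)} len" for k
      by (rule chain_decomp_digits) (use c f h \<gamma> in \<open>auto simp: mirror_digit_def algebra_simps\<close>)
    have I4: "chain_decomp (dsum {f+h+2..d-1} (\<lambda>s. V (k*d + s) (nat ((e + m - 1 - 2*k)*d - 1)))) {k*d + (f+h+2)..<k*d + d} len" for k
      by (rule chain_decomp_digits) (use c f h \<gamma> in \<open>auto simp: mirror_digit_def algebra_simps\<close>)
    have O1: "chain_decomp (dsum {0..f} (\<lambda>i. V (e*d + i) (nat ((m - e)*d + h + f - 2*i)))) {e*d..<a + 1} len"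
      by (rule chain_decomp_digits) (use c f h \<gamma> in \<open>auto simp: mirror_digit_def algebra_simps\<close>)
    show "chain_decomp (dsum {0..e-1} (\<lambda>k.
            dsum {0..f} (\<lambda>i. V (k*d + i) (nat ((e + m - 2*k)*d + f + h - 2*i)))
          \<oplus> dsum {f+1..h} (\<lambda>j. V (k*d + j) (nat ((e + m - 2*k)*d - 1)))
          \<oplus> dsum {h+1..f+h+1} (\<lambda>r. V (k*d + r) (nat ((e + m - 2*k)*d + h + f - 2*r)))
          \<oplus> dsum {f+h+2..d-1} (\<lambda>s. V (k*d + s) (nat ((e + m - 1 - 2*k)*d - 1))))
        \<oplus> dsum {0..f} (\<lambda>i. V (e*d + i) (nat ((m - e)*d + h + f - 2*i)))) {0..<a + 1} len"
      by (rule chain_decomp_sum_ivl[OF chain_decomp_dsum_blocks[OF d0 chain_decomp_four[OF I1 I2 I3 I4]] O1])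
        (use c f h \<gamma> d em in auto)
  next
    assume c: "0 < f \<and> f \<le> h \<and> h < d \<and> f + h \<ge> d"
    have I1: "chain_decomp (dsum {0..\<gamma>} (\<lambda>i. V (k*d + i) (nat ((e + m - 2*k)*d + d - 1)))) {k*d..<k*d + (\<gamma>+1)} len" for k
      by (rule chain_decomp_digits) (use c f h \<gamma> in \<open>auto simp: mirror_digit_def algebra_simps\<close>)
    have I2: "chain_decomp (dsum {\<gamma>+1..f} (\<lambda>j. V (k*d + j) (nat ((e + m - 2*k)*d + f + h - 2*j)))) {k*d + (\<gamma>+1)..<k*d + (f+1)} len" for k
      by (rule chain_decomp_digits) (use c f h \<gamma> in \<open>auto simp: mirror_digit_def algebra_simps\<close>)
    have I3: "chain_decomp (dsum {f+1..h} (\<lambda>r. V (k*d + r) (nat ((e + m - 2*k)*d - 1)))) {k*d + (f+1)..<k*d + (h+1)} len" for k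
      by (rule chain_decomp_digits) (use c f h \<gamma> in \<open>auto simp: mirror_digit_def algebra_simps\<close>)
    have I4: "chain_decomp (dsum {h+1..d-1} (\<lambda>s. V (k*d + s) (nat ((e + m - 2*k)*d + h + f - 2*s)))) {k*d + (h+1)..<k*d + d} len" for k
      by (rule chain_decomp_digits) (use c f h \<gamma> in \<open>auto simp: mirror_digit_def algebra_simps\<close>)
    have O1: "chain_decomp (dsum {0..\<gamma>} (\<lambda>i. V (e*d + i) (nat ((m - e)*d + d - 1)))) {e*d..<e*d + (\<gamma>+1)} len"
      by (rule chain_decomp_digits) (use c f h \<gamma> in \<open>auto simp: mirror_digit_def algebra_simps\<close>)
    have O2: "chain_decomp (dsum {\<gamma>+1..f} (\<lambda>i. V (e*d + i) (nat ((m - e)*d + f + h - 2*i)))) {e*d + (\<gamma>+1)..<a + 1} len"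
      by (rule chain_decomp_digits) (use c f h \<gamma> in \<open>auto simp: mirror_digit_def algebra_simps\<close>)
    show "chain_decomp (dsum {0..e-1} (\<lambda>k.
            dsum {0..\<gamma>} (\<lambda>i. V (k*d + i) (nat ((e + m - 2*k)*d + d - 1)))
          \<oplus> dsum {\<gamma>+1..f} (\<lambda>j. V (k*d + j) (nat ((e + m - 2*k)*d + f + h - 2*j)))
          \<oplus> dsum {f+1..h} (\<lambda>r. V (k*d + r) (nat ((e + m - 2*k)*d - 1)))
          \<oplus> dsum {h+1..d-1} (\<lambda>s. V (k*d + s) (nat ((e + m - 2*k)*d + h + f - 2*s))))
        \<oplus> dsum {0..\<gamma>} (\<lambda>i. V (e*d + i) (nat ((m - e)*d + d - 1)))
        \<oplus> dsum {\<gamma>+1..f} (\<lambda>i. V (e*d + i) (nat ((m - e)*d + f + h - 2*i)))) {0..<a + 1} len"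
      by (rule chain_decomp_sum_ivl[OF chain_decomp_sum_ivl[OF chain_decomp_dsum_blocks[OF d0 chain_decomp_four[OF I1 I2 I3 I4]] O1] O2])
        (use c f h \<gamma> d em in auto)
  next
    assume c: "0 \<le> h \<and> h < f \<and> f < d \<and> f + h < d - 1"
    have I1: "chain_decomp (dsum {0..h} (\<lambda>i. V (k*d + i) (nat ((e + m - 2*k)*d + h + f - 2*i)))) {k*d..<k*d + (h+1)} len" for k
      by (rule chain_decomp_digits) (use c f h \<gamma> in \<open>auto simp: mirror_digit_def algebra_simps\<close>)
    have I2: "chain_decomp (dsum {h+1..f} (\<lambda>j. V (k*d + j) (nat ((e + m - 2*k)*d - 1)))) {k*d + (h+1)..<k*d + (f+1)} len" for k
      by (rule chain_decomp_digits) (use c f h \<gamma> in \<open>auto simp: mirror_digit_def algebra_simps\<close>)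
    have I3: "chain_decomp (dsum {f+1..h+f+1} (\<lambda>r. V (k*d + r) (nat ((e + m - 2*k)*d + h + f - 2*r)))) {k*d + (f+1)..<k*d + (f+h+2)} len" for k
      by (rule chain_decomp_digits) (use c f h \<gamma> in \<open>auto simp: mirror_digit_def algebra_simps\<close>)
    have I4: "chain_decomp (dsum {f+h+2..d-1} (\<lambda>s. V (k*d + s) (nat ((e + m - 1 - 2*k)*d - 1)))) {k*d + (f+h+2)..<k*d + d} len" for k
      by (rule chain_decomp_digits) (use c f h \<gamma> in \<open>auto simp: mirror_digit_def algebra_simps\<close>)
    have O1: "chain_decomp (dsum {0..h} (\<lambda>i. V (e*d + i) (nat ((m - e)*d + h + f - 2*i)))) {e*d..<e*d + (h+1)} len"
      by (rule chain_decomp_digits) (use c f h \<gamma> in \<open>auto simp: mirror_digit_def algebra_simps\<close>)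
    have O2: "chain_decomp (dsum {h+1..f} (\<lambda>i. V (e*d + i) (nat ((m - e)*d - 1)))) {e*d + (h+1)..<a + 1} len"
      by (rule chain_decomp_digits) (use c f h \<gamma> in \<open>auto simp: mirror_digit_def algebra_simps\<close>)
    show "chain_decomp (dsum {0..e-1} (\<lambda>k.
            dsum {0..h} (\<lambda>i. V (k*d + i) (nat ((e + m - 2*k)*d + h + f - 2*i)))
          \<oplus> dsum {h+1..f} (\<lambda>j. V (k*d + j) (nat ((e + m - 2*k)*d - 1)))
          \<oplus> dsum {f+1..h+f+1} (\<lambda>r. V (k*d + r) (nat ((e + m - 2*k)*d + h + f - 2*r)))
          \<oplus> dsum {f+h+2..d-1} (\<lambda>s. V (k*d + s) (nat ((e + m - 1 - 2*k)*d - 1))))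
        \<oplus> dsum {0..h} (\<lambda>i. V (e*d + i) (nat ((m - e)*d + h + f - 2*i)))
        \<oplus> dsum {h+1..f} (\<lambda>i. V (e*d + i) (nat ((m - e)*d - 1)))) {0..<a + 1} len"
      by (rule chain_decomp_sum_ivl[OF chain_decomp_sum_ivl[OF chain_decomp_dsum_blocks[OF d0 chain_decomp_four[OF I1 I2 I3 I4]] O1] O2])
        (use c f h \<gamma> d em in auto)
  next
    assume c: "0 < h \<and> h < f \<and> f < d \<and> f + h \<ge> d"
    have I1: "chain_decomp (dsum {0..\<gamma>} (\<lambda>i. V (k*d + i) (nat ((e + m - 2*k)*d + d - 1)))) {k*d..<k*d + (\<gamma>+1)} len" for k
      by (rule chain_decomp_digits) (use c f h \<gamma> in \<open>auto simp: mirror_digit_def algebra_simps\<close>)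
    have I2: "chain_decomp (dsum {\<gamma>+1..h} (\<lambda>j. V (k*d + j) (nat ((e + m - 2*k)*d + f + h - 2*j)))) {k*d + (\<gamma>+1)..<k*d + (h+1)} len" for k
      by (rule chain_decomp_digits) (use c f h \<gamma> in \<open>auto simp: mirror_digit_def algebra_simps\<close>)
    have I3: "chain_decomp (dsum {h+1..f} (\<lambda>r. V (k*d + r) (nat ((e + m - 2*k)*d - 1)))) {k*d + (h+1)..<k*d + (f+1)} len" for k
      by (rule chain_decomp_digits) (use c f h \<gamma> in \<open>auto simp: mirror_digit_def algebra_simps\<close>)
    have I4: "chain_decomp (dsum {f+1..d-1} (\<lambda>s. V (k*d + s) (nat ((e + m - 2*k)*d + h + f - 2*s)))) {k*d + (f+1)..<k*d + d} len" for k
      by (rule chain_decomp_digits) (use c f h \<gamma> in \<open>auto simp: mirror_digit_def algebra_simps\<close>)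
    have O1: "chain_decomp (dsum {0..\<gamma>} (\<lambda>i. V (e*d + i) (nat ((m - e)*d + d - 1)))) {e*d..<e*d + (\<gamma>+1)} len"
      by (rule chain_decomp_digits) (use c f h \<gamma> in \<open>auto simp: mirror_digit_def algebra_simps\<close>)
    have O2: "chain_decomp (dsum {\<gamma>+1..h} (\<lambda>i. V (e*d + i) (nat ((m - e)*d + f + h - 2*i)))) {e*d + (\<gamma>+1)..<e*d + (h+1)} len"
      by (rule chain_decomp_digits) (use c f h \<gamma> in \<open>auto simp: mirror_digit_def algebra_simps\<close>)
    have O3: "chain_decomp (dsum {h+1..f} (\<lambda>i. V (e*d + i) (nat ((m - e)*d - 1)))) {e*d + (h+1)..<a + 1} len"
      by (rule chain_decomp_digits) (use c f h \<gamma> in \<open>auto simp: mirror_digit_def algebra_simps\<close>)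
    show "chain_decomp (dsum {0..e-1} (\<lambda>k.
            dsum {0..\<gamma>} (\<lambda>i. V (k*d + i) (nat ((e + m - 2*k)*d + d - 1)))
          \<oplus> dsum {\<gamma>+1..h} (\<lambda>j. V (k*d + j) (nat ((e + m - 2*k)*d + f + h - 2*j)))
          \<oplus> dsum {h+1..f} (\<lambda>r. V (k*d + r) (nat ((e + m - 2*k)*d - 1)))
          \<oplus> dsum {f+1..d-1} (\<lambda>s. V (k*d + s) (nat ((e + m - 2*k)*d + h + f - 2*s))))
        \<oplus> dsum {0..\<gamma>} (\<lambda>i. V (e*d + i) (nat ((m - e)*d + d - 1)))
        \<oplus> dsum {\<gamma>+1..h} (\<lambda>i. V (e*d + i) (nat ((m - e)*d + f + h - 2*i)))
        \<oplus> dsum {h+1..f} (\<lambda>i. V (e*d + i) (nat ((m - e)*d - 1)))) {0..<a + 1} len"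
      by (rule chain_decomp_sum_ivl[OF chain_decomp_sum_ivl[OF chain_decomp_sum_ivl[OF chain_decomp_dsum_blocks[OF d0 chain_decomp_four[OF I1 I2 I3 I4]] O1] O2] O3])
        (use c f h \<gamma> d em in auto)
  qed
qed

end
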